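(* Let $n\ge2$, $1\le p<\infty$, $\alpha\in\mathbb{R}$, $\beta\le p\alpha-n$, and let $s,t\in\mathbb{R}$ with $\alpha+t>0$. If $f\in b^\infty_\alpha$, then the following conditions are equivalent: (i) $f\in b^\infty_{\alpha0}$. (ii) $f\in\mathcal{C}_{b^\infty_\alpha}(b^p_\beta)$, the closure of $b^p_\beta$ in $b^\infty_\alpha$. (iii) For every $\varepsilon>0$, $$\int_{\Omega^{\alpha,t}_\varepsilon(f)}(1-|x|^2)^{-n}\,d\nu(x)<\infty,$$ where $\Omega^{\alpha,t}_\varepsilon(f)=\{x\in\mathbb{B}:(1-|x|^2)^\alpha|I^t_sf(x)|\ge\varepsilon\}$.
   Context: Let $n\ge 2$, let $\mathbb{B}$ be the open unit ball of $\mathbb{R}^n$, $\nu$ the normalized Lebesgue measure on $\mathbb{B}$ ($\nu(\mathbb{B})=1$), and $h(\mathbb{B})$ the space of complex-valued harmonic functions on $\mathbb{B}$. For $\alpha\in\mathbb{R}$ let $d\nu_\alpha(x)=\frac1{V_\alpha}(1-|x|^2)^\alpha d\nu(x)$, where $V_\alpha$ is chosen so that $\nu_\alpha(\mathbb{B})=1$ if $\alpha>-1$, and $V_\alpha=1$ if $\alpha\le -1$; $L^p_\alpha$ is the Lebesgue class $L^p(\nu_\alpha)$, $0<p<\infty$. Let $L^\infty_\alpha=\{\varphi:(1-|x|^2)^\alpha\varphi(x)\in L^\infty(\mathbb{B})\}$ with norm $\|\varphi\|_{L^\infty_\alpha}=\|(1-|x|^2)^\alpha\varphi\|_{L^\infty}$.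 With the Pochhammer symbol $(a)_k=\Gamma(a+k)/\Gamma(a)$, for $\alpha\in\mathbb{R}$ and integers $k\ge0$ put $\gamma_k(\alpha)=\frac{(1+n/2+\alpha)_k}{(n/2)_k}$ if $\alpha>-(1+n/2)$, and $\gamma_k(\alpha)=\frac{((1)_k)^2}{(1-(n/2+\alpha))_k\,(n/2)_k}$ if $\alpha\le-(1+n/2)$. Every $f\in h(\mathbb{B})$ has a homogeneous expansion $f=\sum_{k\ge0}f_k$ with $f_k$ a homogeneous harmonic polynomial of degree $k$ (converging absolutely and uniformly on compact subsets of $\mathbb{B}$). For $s,t\in\mathbb{R}$ define $D^t_s f=\sum_{k\ge0}\frac{\gamma_k(s+t)}{\gamma_k(s)}f_k\in h(\mathbb{B})$ and $I^t_sf(x)=(1-|x|^2)^tD^t_sf(x)$. Harmonic Bergman–Besov space: for $\alpha\in\mathbb{R}$, $0<p<\infty$, $b^p_\alpha$ is the set of $f\in h(\mathbb{B})$ with $I^t_sf\in L^p_\alpha$ for some $s,t\in\mathbb{R}$ with $\alpha+pt>-1$ (it is known that this does not depend on the choice of such $s,t$). Weighted harmonic Bloch space: for $\alpha\in\mathbb{R}$, $b^\infty_\alpha$ is the set of $f\in h(\mathbb{B})$ with $I^t_sf\in L^\infty_\alpha$ for some $s,t\in\mathbb{R}$ with $\alpha+t>0$, with norm $\|f\|_{b^\infty_\alpha}=\|I^t_sf\|_{L^\infty_\alpha}=\sup_{x\in\mathbb{B}}(1-|x|^2)^{\alpha+t}|D^t_sf(x)|$ (it is known that the space does not depend on the choice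 of such $s,t$ and that all these norms are equivalent). Weighted harmonic little Bloch space: $b^\infty_{\alpha0}$ is the set of $f\in b^\infty_\alpha$ with $\lim_{|x|\to1^-}(1-|x|^2)^\alpha|I^t_sf(x)|=0$, where $s,t$ satisfy $\alpha+t>0$ (again independent of the choice). It is known that $b^p_\beta\subset b^\infty_\alpha$ when $\beta\le p\alpha-n$. For a subspace $A$ of $b^\infty_\alpha$, $\mathcal{C}_{b^\infty_\alpha}(A)$ denotes the closure of $A$ in the norm of $b^\infty_\alpha$. *)

theory Defs
  imports "HOL-Analysis.Analysis" "HOL-Probability.Essential_Supremum"
begin

section \<open>Harmonic functions and homogeneous expansions\<close>

text \<open>Twice continuously differentiable with vanishing Laplacian, on an open set \<open>S\<close>. Here
  \<open>f' x v\<close> is the derivative of \<open>f\<close> at \<open>x\<close> in direction \<open>v\<close>, and \<open>f'' x v w\<close> is the derivative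
  of \<open>\<lambda>y. f' y v\<close> at \<open>x\<close> in direction \<open>w\<close>.\<close>

definition harmonic_on :: "('a::euclidean_space \<Rightarrow> complex) \<Rightarrow> 'a set \<Rightarrow> bool" where
  "harmonic_on f S \<longleftrightarrow>
     (\<exists>f' f''.
        (\<forall>x\<in>S. (f has_derivative f' x) (at x)) \<and>
        (\<forall>x\<in>S. \<forall>v. ((\<lambda>y. f' y v) has_derivative f'' x v) (at x)) \<and>
        (\<forall>v w. continuous_on S (\<lambda>x. f'' x v w)) \<and>
        (\<forall>x\<in>S. (\<Sum>b\<in>Basis. f'' x b b) = 0))"

definition homogeneous_harmonic_poly :: "nat \<Rightarrow> ('a::euclidean_space \<Rightarrow> complex) \<Rightarrow> bool" where
  "homogeneous_harmonic_poly k p \<longleftrightarrow>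
     polynomial_function p \<and>
     (\<forall>c x. p (c *\<^sub>R x) = of_real (c ^ k) * p x) \<and>
     harmonic_on p UNIV"

text \<open>The components \<open>f\<^sub>k\<close> of the homogeneous expansion of \<open>f\<close> on the unit ball. They are unique:
  on each ray \<open>r \<mapsto> f (r *\<^sub>R x)\<close> is a power series in \<open>r\<close> with coefficients \<open>f\<^sub>k x\<close>.\<close>

definition homogeneous_part :: "('a::euclidean_space \<Rightarrow> complex) \<Rightarrow> nat \<Rightarrow> 'a \<Rightarrow> complex" where
  "homogeneous_part f =
     (THE F. (\<forall>k. homogeneous_harmonic_poly k (F k)) \<and>
             (\<forall>x\<in>ball 0 1. (\<lambda>k. F k x) sums f x))"

section \<open>Weighted measures and Lebesgue classes on the unit ball\<close>

definition ball_measure :: "'a::euclidean_space measure" where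
  "ball_measure = uniform_measure (lebesgue_on (ball 0 1)) (ball 0 1)"

definition weight :: "real \<Rightarrow> 'a::euclidean_space \<Rightarrow> real" where
  "weight \<alpha> x = (1 - (norm x)\<^sup>2) powr \<alpha>"

definition weighted_ball_measure :: "real \<Rightarrow> 'a::euclidean_space measure" where
  "weighted_ball_measure \<alpha> =
     (let V = (if \<alpha> > -1 then \<integral>x. weight \<alpha> x \<partial>(ball_measure :: 'a measure) else 1)
      in density ball_measure (\<lambda>x. ennreal (weight \<alpha> x / V)))"

definition weighted_Lp :: "real \<Rightarrow> real \<Rightarrow> ('a::euclidean_space \<Rightarrow> complex) set" where
  "weighted_Lp p \<alpha> =
     {\<phi> \<in> borel_measurable (weighted_ball_measure \<alpha>).
        (\<integral>\<^sup>+x. ennreal (norm (\<phi> x) powr p) \<partial>weighted_ball_measure \<alpha>) < \<infinity>}"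

definition weighted_Linf_norm :: "real \<Rightarrow> ('a::euclidean_space \<Rightarrow> complex) \<Rightarrow> ennreal" where
  "weighted_Linf_norm \<alpha> \<phi> = esssup ball_measure (\<lambda>x. ennreal (weight \<alpha> x * norm (\<phi> x)))"

definition weighted_Linf :: "real \<Rightarrow> ('a::euclidean_space \<Rightarrow> complex) set" where
  "weighted_Linf \<alpha> =
     {\<phi> \<in> borel_measurable ball_measure. weighted_Linf_norm \<alpha> \<phi> < \<infinity>}"

section \<open>Radial differential operators\<close>

definition gamma_coeff :: "nat \<Rightarrow> real \<Rightarrow> nat \<Rightarrow> real" where
  "gamma_coeff n \<alpha> k =
     (if \<alpha> > - (1 + real n / 2)
      then pochhammer (1 + real n / 2 + \<alpha>) k / pochhammer (real n / 2) k
      else (pochhammer 1 k)\<^sup>2 /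
           (pochhammer (1 - (real n / 2 + \<alpha>)) k * pochhammer (real n / 2) k))"

definition D_op :: "real \<Rightarrow> real \<Rightarrow> ('a::euclidean_space \<Rightarrow> complex) \<Rightarrow> 'a \<Rightarrow> complex" where
  "D_op s t f x =
     (\<Sum>k. of_real (gamma_coeff DIM('a) (s + t) k / gamma_coeff DIM('a) s k)
            * homogeneous_part f k x)"

definition I_op :: "real \<Rightarrow> real \<Rightarrow> ('a::euclidean_space \<Rightarrow> complex) \<Rightarrow> 'a \<Rightarrow> complex" where
  "I_op s t f x = of_real (weight t x) * D_op s t f x"

section \<open>Bergman--Besov, Bloch and little Bloch spaces\<close>

text \<open>Functions are total in HOL; elements of the spaces below matter only on \<open>ball 0 1\<close>.\<close>

definition bergman_besov :: "real \<Rightarrow> real \<Rightarrow> ('a::euclidean_space \<Rightarrow> complex) set" where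
  "bergman_besov p \<alpha> =
     {f. harmonic_on f (ball 0 1) \<and>
         (\<exists>s t. \<alpha> + p * t > -1 \<and> I_op s t f \<in> weighted_Lp p \<alpha>)}"

definition bloch :: "real \<Rightarrow> ('a::euclidean_space \<Rightarrow> complex) set" where
  "bloch \<alpha> =
     {f. harmonic_on f (ball 0 1) \<and>
         (\<exists>s t. \<alpha> + t > 0 \<and> I_op s t f \<in> weighted_Linf \<alpha>)}"

text \<open>One norm of \<open>bloch \<alpha>\<close> for each pair \<open>s\<close>, \<open>t\<close> with \<open>\<alpha> + t > 0\<close>.\<close>

definition bloch_norm :: "real \<Rightarrow> real \<Rightarrow> real \<Rightarrow> ('a::euclidean_space \<Rightarrow> complex) \<Rightarrow> ennreal" where
  "bloch_norm \<alpha> s t f = weighted_Linf_norm \<alpha> (I_op s t f)"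

definition little_bloch :: "real \<Rightarrow> ('a::euclidean_space \<Rightarrow> complex) set" where
  "little_bloch \<alpha> =
     {f \<in> bloch \<alpha>. \<exists>s t. \<alpha> + t > 0 \<and>
        ((\<lambda>x. weight \<alpha> x * norm (I_op s t f x)) \<longlongrightarrow> 0) (filtercomap norm (at_left 1))}"

definition bloch_closure ::
  "real \<Rightarrow> real \<Rightarrow> real \<Rightarrow> ('a::euclidean_space \<Rightarrow> complex) set \<Rightarrow> ('a \<Rightarrow> complex) set" where
  "bloch_closure \<alpha> s t A =
     {f \<in> bloch \<alpha>. \<forall>\<epsilon>>0. \<exists>g\<in>A. bloch_norm \<alpha> s t (\<lambda>x. f x - g x) < ennreal \<epsilon>}"

definition Omega_set ::
  "real \<Rightarrow> real \<Rightarrow> real \<Rightarrow> real \<Rightarrow> ('a::euclidean_space \<Rightarrow> complex) \<Rightarrow> 'a set" where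
  "Omega_set \<alpha> s t \<epsilon> f = {x \<in> ball 0 1. weight \<alpha> x * norm (I_op s t f x) \<ge> \<epsilon>}"

end

theory Submission
  imports Defs
begin

text \<open>A harmonic function on the ball is a series \<open>f = \<Sum> f\<^sub>k\<close> of homogeneous harmonic polynomials, and
  \<open>D\<^sub>s\<^sup>t\<close> multiplies \<open>f\<^sub>k\<close> by a quotient of Pochhammer symbols of order \<open>k\<^sup>t\<close>. Such a multiplier factors into
  steps \<open>k + b\<close>, controlled by gradient estimates, and moment sequences of Beta distributions, which
  average over the radius; it therefore turns the growth \<open>(1 - \<bar>x\<bar>)\<^sup>-\<^sup>A\<close> into \<open>(1 - \<bar>x\<bar>)\<^sup>-\<^sup>A\<^sup>-\<^sup>u\<close> as long as both
  exponents stay negative. Consequently the Bloch and little Bloch conditions do not depend on \<open>s, t\<close>.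

  A little Bloch function is the Bloch limit of its dilates, which lie in every Bergman--Besov space.
  Conversely, the mean value property bounds the value at \<open>x\<close> by the mean over \<open>B(x, (1 - \<bar>x\<bar>) / 2)\<close>, on which
  \<open>(1 - \<bar>z\<bar>)\<^sup>-\<^sup>n dz\<close> is comparable to normalized Lebesgue measure. If \<open>(1 - \<bar>z\<bar>\<^sup>2)\<^sup>\<alpha>\<bar>I\<^sub>s\<^sup>t f\<bar>\<close> is bounded by an
  arbitrary \<open>\<eta> > 0\<close> plus a function integrable against \<open>(1 - \<bar>z\<bar>)\<^sup>-\<^sup>n dz\<close>, it thus vanishes at the boundary.
  This applies to Bergman--Besov functions, where the error is a multiple of a \<open>p\<close>-th power, and under the
  integrability condition on \<open>\<Omega>\<^sub>\<epsilon>(f)\<close>, where it is a multiple of an indicator.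

  The only integration by parts is against \<open>bump\<^sup>2\<close> with \<open>bump = max 0 (1 - \<bar>y\<bar>\<^sup>2)\<close> and polynomials: it gives
  orthogonality of homogeneous harmonic polynomials of different degrees, hence mean values and bounds on
  components, and everything else about harmonic functions follows by approximation.\<close>

section \<open>Polynomials and the Gauss decomposition\<close>

text \<open>All three conditions are compared through one predicate, \<open>vanishing\<close>, since
  each brings its own pair of parameters: the norm and the level sets have theirs prescribed, while
  membership in a little Bloch or Bergman--Besov space merely provides some pair. The obstacle is
  therefore the change of parameters, for arbitrary real orders and both branches of
  \<open>gamma_coeff\<close>. In either branch the coefficient is a quotient of Pochhammer symbols
  with positive bases times a factor independent of the parameter, and that factor cancels in
  \<open>D_op\<close>. Averaging over the radius improves (1 - |x|)^-A to (1 - |x|)^-(A - v) only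
  while A - v > 0; in the applications A is \<alpha> + t. The exponent p is handled pointwise: where
  G > \<eta> one has G \<le> \<eta>^(1 - p) G^p because p \<ge> 1, so a function G with integrable
  p-th power is at most \<eta> plus an integrable error. The hypothesis \<beta> \<le> p \<alpha> - n
  says exactly that the weight exponent p (\<alpha> + t) - n of this error is at least the exponent
  \<beta> + p t of the Bergman--Besov integral.\<close>

inductive cpoly :: "('a::euclidean_space \<Rightarrow> complex) \<Rightarrow> bool" where
  cpoly_const: "cpoly (\<lambda>x. c)"
| cpoly_coord: "cpoly (\<lambda>x. of_real (x \<bullet> b))"
| cpoly_add: "cpoly p \<Longrightarrow> cpoly q \<Longrightarrow> cpoly (\<lambda>x. p x + q x)"
| cpoly_mult: "cpoly p \<Longrightarrow> cpoly q \<Longrightarrow> cpoly (\<lambda>x. p x * q x)"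

text \<open>Like \<open>cpoly\<close>, an inductive presentation under which closure and
  differentiation rules follow by induction. The degree counts the coordinates multiplied onto a
  constant; zero has every degree, so truncated degrees such as \<open>k - 1\<close> do no
  harm.\<close>

inductive hpoly :: "nat \<Rightarrow> ('a::euclidean_space \<Rightarrow> complex) \<Rightarrow> bool" where
  hpoly_const: "hpoly 0 (\<lambda>x. c)"
| hpoly_coord_mult: "hpoly k p \<Longrightarrow> b \<in> Basis \<Longrightarrow> hpoly (Suc k) (\<lambda>x. of_real (x \<bullet> b) * p x)"
| hpoly_add: "hpoly k p \<Longrightarrow> hpoly k q \<Longrightarrow> hpoly k (\<lambda>x. p x + q x)"

section \<open>Directional derivatives and Laplacians of polynomials\<close>

definition pd :: "'a \<Rightarrow> ('a::euclidean_space \<Rightarrow> complex) \<Rightarrow> 'a \<Rightarrow> complex" where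
  "pd v p x = frechet_derivative p (at x) v"

definition lap :: "('a::euclidean_space \<Rightarrow> complex) \<Rightarrow> 'a \<Rightarrow> complex" where
  "lap p x = (\<Sum>b\<in>Basis. pd b (pd b p) x)"

lemma pd_eqI: "(p has_derivative D) (at x) \<Longrightarrow> pd v p x = D v"
  unfolding pd_def using frechet_derivative_at by metis

lemma has_derivative_pd: "p differentiable at x \<Longrightarrow> (p has_derivative (\<lambda>v. pd v p x)) (at x)"
  unfolding pd_def by (simp add: frechet_derivative_works[symmetric] eta_contract_eq)

lemma pd_const [simp]: "pd v (\<lambda>x. c) x = 0"
  by (rule pd_eqI[where D="\<lambda>_. 0"]) (auto intro!: derivative_eq_intros)

lemma pd_const_fun: "pd v (\<lambda>x. c) = (\<lambda>x. 0)"
  by (rule ext) simp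

lemma pd_coord [simp]: "pd v (\<lambda>x. of_real (x \<bullet> b)) x = of_real (v \<bullet> b)"
  by (rule pd_eqI) (auto intro!: derivative_eq_intros)

lemma pd_add:
  assumes "p differentiable at x" "q differentiable at x"
  shows "pd v (\<lambda>x. p x + q x) x = pd v p x + pd v q x"
  by (rule pd_eqI) (intro has_derivative_add has_derivative_pd assms)

lemma pd_diff:
  assumes "p differentiable at x" "q differentiable at x"
  shows "pd v (\<lambda>x. p x - q x) x = pd v p x - pd v q x"
  by (rule pd_eqI) (intro has_derivative_diff has_derivative_pd assms)

lemma pd_mult:
  assumes "p differentiable at x" "q differentiable at x"
  shows "pd v (\<lambda>x. p x * q x) x = p x * pd v q x + pd v p x * q x"
  by (rule pd_eqI) (intro has_derivative_mult has_derivative_pd assms)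

lemma pd_cmult:
  assumes "p differentiable at x"
  shows "pd v (\<lambda>x. c * p x) x = c * pd v p x"
  using pd_mult[of "\<lambda>x. c" x p v] assms by simp

lemma pd_sum:
  assumes "\<And>i. i \<in> I \<Longrightarrow> p i differentiable at x"
  shows "pd v (\<lambda>x. \<Sum>i\<in>I. p i x) x = (\<Sum>i\<in>I. pd v (p i) x)"
  by (rule pd_eqI) (intro has_derivative_sum has_derivative_pd assms)

lemma pd_affine:
  assumes "p differentiable at (a + c *\<^sub>R x)"
  shows "pd v (\<lambda>x. p (a + c *\<^sub>R x)) x = of_real c * pd v p (a + c *\<^sub>R x)"
proof -
  have "((\<lambda>x. a + c *\<^sub>R x) has_derivative (\<lambda>v. c *\<^sub>R v)) (at x)"
    by (auto intro!: derivative_eq_intros)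
  from has_derivative_compose[OF this has_derivative_pd[OF assms]]
  have "pd v (\<lambda>x. p (a + c *\<^sub>R x)) x = pd (c *\<^sub>R v) p (a + c *\<^sub>R x)"
    by (rule pd_eqI)
  also have "\<dots> = c *\<^sub>R pd v p (a + c *\<^sub>R x)"
    using linear_cmul[OF has_derivative_linear[OF has_derivative_pd[OF assms]]] .
  finally show ?thesis by (simp add: scaleR_conv_of_real)
qed

lemma cpoly_differentiable: "cpoly p \<Longrightarrow> p differentiable at x"
proof (induction rule: cpoly.induct)
  case (cpoly_coord b)
  have "((\<lambda>x. complex_of_real (x \<bullet> b)) has_derivative (\<lambda>v. of_real (v \<bullet> b))) (at x)"
    by (auto intro!: derivative_eq_intros)
  then show ?case unfolding differentiable_def by blast
qed (auto intro: differentiable_mult)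

lemma cpoly_sum: "(\<And>i. i \<in> I \<Longrightarrow> cpoly (p i)) \<Longrightarrow> cpoly (\<lambda>x. \<Sum>i\<in>I. p i x)"
  by (induction I rule: infinite_finite_induct) (auto intro: cpoly.intros)

lemma cpoly_cmult: "cpoly p \<Longrightarrow> cpoly (\<lambda>x. c * p x)"
  by (intro cpoly.intros)

lemma cpoly_diff: "cpoly p \<Longrightarrow> cpoly q \<Longrightarrow> cpoly (\<lambda>x. p x - q x)"
  using cpoly_add[OF _ cpoly_cmult[of q "-1"], of p] by simp

lemma cpoly_pd: "cpoly p \<Longrightarrow> cpoly (pd v p)"
proof (induction rule: cpoly.induct)
  case (cpoly_const c)
  then show ?case using cpoly.cpoly_const[of 0] by (simp add: pd_const_fun)
next
  case (cpoly_coord b)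
  then show ?case using cpoly.cpoly_const[of "of_real (v \<bullet> b)"] by simp
next
  case (cpoly_add p q)
  have "pd v (\<lambda>x. p x + q x) = (\<lambda>x. pd v p x + pd v q x)"
    using cpoly_add by (auto simp: pd_add cpoly_differentiable)
  then show ?case using cpoly_add by (auto intro: cpoly.intros)
next
  case (cpoly_mult p q)
  have "pd v (\<lambda>x. p x * q x) = (\<lambda>x. p x * pd v q x + pd v p x * q x)"
    using cpoly_mult by (auto simp: pd_mult cpoly_differentiable)
  then show ?case using cpoly_mult by (auto intro: cpoly.intros)
qed

lemma cpoly_affine: "cpoly p \<Longrightarrow> cpoly (\<lambda>x. p (a + c *\<^sub>R x))"
proof (induction rule: cpoly.induct)
  case (cpoly_coord b)
  have "cpoly (\<lambda>x::'a. of_real (a \<bullet> b) + of_real c * of_real (x \<bullet> b))"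
    by (intro cpoly.intros)
  then show ?case by (simp add: inner_add_left)
qed (auto intro: cpoly.intros)

lemma cpoly_cnj: "cpoly p \<Longrightarrow> cpoly (\<lambda>x. cnj (p x))"
  by (induction rule: cpoly.induct) (auto intro: cpoly.intros)

lemma pd_add_cpoly: "cpoly p \<Longrightarrow> cpoly q \<Longrightarrow> pd v (\<lambda>x. p x + q x) = (\<lambda>x. pd v p x + pd v q x)"
  by (auto simp: pd_add cpoly_differentiable)

lemma pd_mult_cpoly:
  "cpoly p \<Longrightarrow> cpoly q \<Longrightarrow> pd v (\<lambda>x. p x * q x) = (\<lambda>x. p x * pd v q x + pd v p x * q x)"
  by (auto simp: pd_mult cpoly_differentiable)

lemma pd_cmult_cpoly: "cpoly p \<Longrightarrow> pd v (\<lambda>x. c * p x) = (\<lambda>x. c * pd v p x)"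
  by (auto simp: pd_cmult cpoly_differentiable)

lemma pd_sum_cpoly:
  "(\<And>i. i \<in> I \<Longrightarrow> cpoly (p i)) \<Longrightarrow> pd v (\<lambda>x. \<Sum>i\<in>I. p i x) = (\<lambda>x. \<Sum>i\<in>I. pd v (p i) x)"
  by (auto simp: pd_sum cpoly_differentiable)

lemma pd_affine_cpoly:
  "cpoly p \<Longrightarrow> pd v (\<lambda>x. p (a + c *\<^sub>R x)) = (\<lambda>x. of_real c * pd v p (a + c *\<^sub>R x))"
  by (auto simp: pd_affine cpoly_differentiable)

lemma pd_cnj:
  assumes "p differentiable at x"
  shows "pd v (\<lambda>x. cnj (p x)) x = cnj (pd v p x)"
  by (rule pd_eqI) (intro has_derivative_cnj has_derivative_pd assms)

lemma lap_add: "cpoly p \<Longrightarrow> cpoly q \<Longrightarrow> lap (\<lambda>x. p x + q x) = (\<lambda>x. lap p x + lap q x)"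
  by (auto simp: lap_def pd_add_cpoly cpoly_pd sum.distrib)

lemma lap_cmult: "cpoly p \<Longrightarrow> lap (\<lambda>x. c * p x) = (\<lambda>x. c * lap p x)"
  by (auto simp: lap_def pd_cmult_cpoly cpoly_pd sum_distrib_left)

lemma lap_diff:
  assumes "cpoly p" "cpoly q" shows "lap (\<lambda>x. p x - q x) = (\<lambda>x. lap p x - lap q x)"
  using lap_add[OF assms(1) cpoly_cmult[OF assms(2), of "-1"]] lap_cmult[OF assms(2), of "-1"]
  by simp

lemma lap_sum:
  "(\<And>i. i \<in> I \<Longrightarrow> cpoly (p i)) \<Longrightarrow> lap (\<lambda>x. \<Sum>i\<in>I. p i x) = (\<lambda>x. \<Sum>i\<in>I. lap (p i) x)"
  by (auto simp: lap_def pd_sum_cpoly cpoly_pd intro!: ext sum.swap)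

lemma lap_affine:
  "cpoly p \<Longrightarrow> lap (\<lambda>x. p (a + c *\<^sub>R x)) = (\<lambda>x. of_real (c\<^sup>2) * lap p (a + c *\<^sub>R x))"
  by (auto simp: lap_def pd_affine_cpoly pd_cmult_cpoly cpoly_pd cpoly_affine sum_distrib_left
      power2_eq_square mult.assoc)

lemma lap_cnj:
  assumes "cpoly p" shows "lap (\<lambda>x. cnj (p x)) = (\<lambda>x. cnj (lap p x))"
proof -
  have *: "pd v (\<lambda>x. cnj (q x)) = (\<lambda>x. cnj (pd v q x))" if "cpoly q" for v and q :: "'a \<Rightarrow> complex"
    using that by (auto simp: pd_cnj cpoly_differentiable)
  show ?thesis using assms by (intro ext) (simp add: lap_def cpoly_pd *)
qed

lemma hpoly_cpoly: "hpoly k p \<Longrightarrow> cpoly p"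
  by (induction rule: hpoly.induct) (auto intro: cpoly.intros)

lemma hpoly_zero: "hpoly k (\<lambda>x::'a::euclidean_space. 0)"
proof (induction k)
  case (Suc k)
  obtain b :: 'a where "b \<in> Basis" using nonempty_Basis by blast
  from hpoly_coord_mult[OF Suc this] show ?case by simp
qed (rule hpoly_const)

lemma hpoly_cmult: "hpoly k p \<Longrightarrow> hpoly k (\<lambda>x. c * p x)"
proof (induction rule: hpoly.induct)
  case (hpoly_coord_mult k p b)
  from hpoly.hpoly_coord_mult[OF hpoly_coord_mult(3,2)] show ?case by (simp add: mult.left_commute)
qed (auto intro: hpoly.intros simp: distrib_left)

lemma hpoly_diff: "hpoly k p \<Longrightarrow> hpoly k q \<Longrightarrow> hpoly k (\<lambda>x. p x - q x)"
  using hpoly_add[OF _ hpoly_cmult[of k q "-1"], of p] by simp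

lemma hpoly_sum: "(\<And>i. i \<in> I \<Longrightarrow> hpoly k (p i)) \<Longrightarrow> hpoly k (\<lambda>x. \<Sum>i\<in>I. p i x)"
  by (induction I rule: infinite_finite_induct) (auto intro: hpoly_zero hpoly_add)

lemma hpoly_mult: "hpoly k p \<Longrightarrow> hpoly l q \<Longrightarrow> hpoly (k + l) (\<lambda>x. p x * q x)"
proof (induction rule: hpoly.induct)
  case (hpoly_coord_mult k p b)
  from hpoly.hpoly_coord_mult[OF hpoly_coord_mult(3)[OF hpoly_coord_mult(4)] hpoly_coord_mult(2)]
  show ?case by (simp add: mult.assoc)
qed (auto intro: hpoly_cmult hpoly_add simp: distrib_right)

lemma hpoly_homogeneous: "hpoly k p \<Longrightarrow> p (c *\<^sub>R x) = of_real (c ^ k) * p x"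
  by (induction rule: hpoly.induct) (auto simp: algebra_simps)

lemma hpoly_0_const: "hpoly 0 p \<Longrightarrow> p x = p 0"
  using hpoly_homogeneous[of 0 p 0 x] by simp

lemma hpoly_pd: "hpoly k p \<Longrightarrow> hpoly (k - 1) (pd v p)"
proof (induction rule: hpoly.induct)
  case (hpoly_const c)
  then show ?case using hpoly_zero[of 0] by (simp add: pd_const_fun)
next
  case (hpoly_coord_mult k p b)
  have cp: "cpoly p" using hpoly_coord_mult hpoly_cpoly by blast
  have eq: "pd v (\<lambda>x. of_real (x \<bullet> b) * p x) = (\<lambda>x. of_real (x \<bullet> b) * pd v p x + of_real (v \<bullet> b) * p x)"
    using pd_mult_cpoly[OF cpoly_coord cp] by (simp add: fun_eq_iff)
  \<comment> \<open>For \<open>k = 0\<close> the coordinate factor would give degree 1 instead of 0,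
    so the derivative of a constant has to be recognized as zero.\<close>
  have "hpoly k (\<lambda>x. of_real (x \<bullet> b) * pd v p x)"
  proof (cases k)
    case 0
    then have "p = (\<lambda>x. p 0)" using hpoly_0_const hpoly_coord_mult by blast
    then have "pd v p x = 0" for x by (metis pd_const)
    then show ?thesis by (simp add: hpoly_zero)
  next
    case (Suc j)
    then show ?thesis using hpoly.hpoly_coord_mult[OF hpoly_coord_mult(3,2)] by simp
  qed
  then show ?case using hpoly_coord_mult by (auto simp: eq intro!: hpoly_add hpoly_cmult)
next
  case (hpoly_add k p q)
  then show ?case by (simp add: pd_add_cpoly hpoly_cpoly hpoly.hpoly_add)
qed

lemma hpoly_lap: "hpoly k p \<Longrightarrow> hpoly (k - 2) (lap p)"
  unfolding lap_def[abs_def] using hpoly_pd[OF hpoly_pd] by (auto intro!: hpoly_sum simp: numeral_2_eq_2)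

lemma lap_hpoly_less_2:
  assumes "hpoly k p" "k < 2" shows "lap p = (\<lambda>x. 0)"
proof -
  have "pd b (pd b p) x = 0" for b x
  proof -
    have "hpoly 0 (pd b p)" using hpoly_pd[OF assms(1), of b] assms(2) by (cases k) auto
    then have "pd b p = (\<lambda>x. pd b p 0)" using hpoly_0_const by blast
    then show ?thesis by (metis pd_const)
  qed
  then show ?thesis by (simp add: lap_def[abs_def])
qed

lemma euler_hpoly: "hpoly k p \<Longrightarrow> (\<Sum>b\<in>Basis. of_real (x \<bullet> b) * pd b p x) = of_nat k * p x"
proof (induction rule: hpoly.induct)
  case (hpoly_coord_mult k p c)
  have cp: "cpoly p" using hpoly_coord_mult hpoly_cpoly by blast
  have "(\<Sum>b\<in>Basis. of_real (x \<bullet> b) * pd b (\<lambda>x. of_real (x \<bullet> c) * p x) x)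
    = (\<Sum>b\<in>Basis. of_real (x \<bullet> c) * (of_real (x \<bullet> b) * pd b p x) + (if b = c then of_real (x \<bullet> b) * p x else 0))"
    unfolding pd_mult_cpoly[OF cpoly_coord cp] using hpoly_coord_mult(2)
    by (intro sum.cong refl) (auto simp: inner_Basis algebra_simps)
  also have "\<dots> = of_real (x \<bullet> c) * (of_nat k * p x) + of_real (x \<bullet> c) * p x"
    using hpoly_coord_mult(2) by (simp add: sum.distrib flip: sum_distrib_left hpoly_coord_mult(3))
  finally show ?case by (simp add: algebra_simps)
next
  case (hpoly_add k p q)
  then show ?case by (simp add: pd_add_cpoly hpoly_cpoly distrib_left sum.distrib)
qed simp

section \<open>Harmonic decomposition of polynomials\<close>

definition nsq :: "'a::euclidean_space \<Rightarrow> complex" where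
  "nsq x = (\<Sum>b\<in>Basis. of_real (x \<bullet> b) * of_real (x \<bullet> b))"

lemma nsq_eq: "nsq x = of_real ((norm x)\<^sup>2)"
  unfolding nsq_def power2_norm_eq_inner by (subst euclidean_inner) simp

lemma hpoly_coord: "b \<in> Basis \<Longrightarrow> hpoly 1 (\<lambda>x. of_real (x \<bullet> b))"
  using hpoly_coord_mult[OF hpoly_const[of 1], of b] by simp

lemma hpoly_nsq: "hpoly 2 nsq"
  unfolding nsq_def[abs_def] using hpoly_mult[OF hpoly_coord hpoly_coord] by (auto intro!: hpoly_sum simp: numeral_2_eq_2)

lemma pd_nsq: "b \<in> Basis \<Longrightarrow> pd b nsq = (\<lambda>x. 2 * of_real (x \<bullet> b))"
proof -
  assume b: "b \<in> Basis"
  have "pd b nsq x = (\<Sum>c\<in>Basis. if c = b then 2 * of_real (x \<bullet> b) else 0)" for x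
    unfolding nsq_def[abs_def]
  proof (subst pd_sum)
    show "(\<Sum>i\<in>Basis. pd b (\<lambda>x. complex_of_real (x \<bullet> i) * complex_of_real (x \<bullet> i)) x) =
      (\<Sum>c\<in>Basis. if c = b then 2 * of_real (x \<bullet> b) else 0)"
      using b by (intro sum.cong refl)
        (auto simp: pd_mult_cpoly[OF cpoly_coord cpoly_coord] inner_Basis)
  qed (intro cpoly_differentiable cpoly.intros)
  then show ?thesis using b by auto
qed

text \<open>The mixed term is twice the gradient of |x|^2 against that of \<open>p\<close>, that is
  4 x . grad p = 4 k p by Euler's relation; \<open>2 * DIM('a)\<close> is the Laplacian of
  |x|^2.\<close>

lemma lap_nsq_mult:
  fixes p :: "'a::euclidean_space \<Rightarrow> complex"
  assumes "hpoly k p"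
  shows "lap (\<lambda>x. nsq x * p x) = (\<lambda>x. of_nat (2 * DIM('a) + 4 * k) * p x + nsq x * lap p x)"
proof
  fix x :: 'a
  have cp: "cpoly p" and cn: "cpoly (nsq :: 'a \<Rightarrow> complex)" using assms hpoly_cpoly hpoly_nsq by blast+
  have c2: "cpoly (\<lambda>x. 2 * of_real (x \<bullet> b))" for b :: 'a by (intro cpoly.intros)
  have "pd b (pd b (\<lambda>x. nsq x * p x)) x
      = nsq x * pd b (pd b p) x + 4 * (of_real (x \<bullet> b) * pd b p x) + 2 * p x" if "b \<in> Basis" for b
  proof -
    have "pd b (\<lambda>x. 2 * complex_of_real (x \<bullet> b)) = (\<lambda>x. 2 * of_real (b \<bullet> b))"
      by (auto simp: pd_cmult_cpoly[OF cpoly_coord])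
    then show ?thesis using that
      by (simp add: pd_mult_cpoly cp cn pd_nsq pd_add_cpoly cpoly_mult cpoly_pd c2 inner_Basis algebra_simps)
  qed
  then have "lap (\<lambda>x. nsq x * p x) x = nsq x * lap p x + 4 * (of_nat k * p x) + of_nat (2 * DIM('a)) * p x"
    by (simp add: lap_def sum.distrib euler_hpoly[OF assms] flip: sum_distrib_left)
  then show "lap (\<lambda>x. nsq x * p x) x = of_nat (2 * DIM('a) + 4 * k) * p x + nsq x * lap p x"
    by (simp add: algebra_simps)
qed

text \<open>The extra term \<open>of_nat c * Q\<close> makes the induction close. With d = 2n + 4m +
  c the equation reads d Q + |x|^2 lap Q = q; the ansatz Q = (q - |x|^2 R) / d with R = lap Q leads,
  after taking Laplacians, to the same kind of equation for R in degree m - 2, with right-hand side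
  lap q and with d in place of c.\<close>

lemma lap_nsq_surj:
  fixes q :: "'a::euclidean_space \<Rightarrow> complex"
  assumes "hpoly m q"
  shows "\<exists>Q. hpoly m Q \<and> (\<forall>x. lap (\<lambda>x. nsq x * Q x) x + of_nat c * Q x = q x)"
  using assms
proof (induction m arbitrary: q c rule: less_induct)
  case (less m)
  define d where "d = 2 * DIM('a) + 4 * m + c"
  have d: "of_nat d \<noteq> (0::complex)" unfolding d_def using DIM_positive[where 'a='a] by (simp del: of_nat_add)
  have dd: "of_nat (2 * DIM('a) + 4 * m) + of_nat c = (of_nat d :: complex)" unfolding d_def by simp
  show ?case
  proof (cases "m < 2")
    case True
    let ?Q = "\<lambda>x. (1 / of_nat d) * q x"
    have Q: "hpoly m ?Q" using less hpoly_cmult by blast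
    have "lap (\<lambda>x. nsq x * ?Q x) x + of_nat c * ?Q x = q x" for x
    proof -
      have "lap (\<lambda>x. nsq x * ?Q x) x + of_nat c * ?Q x
          = (of_nat (2 * DIM('a) + 4 * m) + of_nat c) * ?Q x"
        unfolding lap_nsq_mult[OF Q] lap_hpoly_less_2[OF Q True] by (simp only: distrib_right) simp
      also have "\<dots> = q x" using d by (simp only: dd) simp
      finally show ?thesis .
    qed
    then show ?thesis using Q by blast
  next
    case False
    from less(1)[of "m - 2" "lap q" d] obtain R where R: "hpoly (m - 2) R"
      "\<And>x. lap (\<lambda>x. nsq x * R x) x + of_nat d * R x = lap q x"
      using hpoly_lap[OF less(2)] False by auto
    have nR: "hpoly m (\<lambda>x. nsq x * R x)"
      using hpoly_mult[OF hpoly_nsq R(1)] False by (metis add_diff_inverse_nat)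
    let ?Q = "\<lambda>x. (1 / of_nat d) * (q x - nsq x * R x)"
    have h: "hpoly m (\<lambda>x. q x - nsq x * R x)" using less nR hpoly_diff by blast
    then have Q: "hpoly m ?Q" using hpoly_cmult by blast
    have "lap ?Q x = R x" for x
      using d R(2)[of x]
      unfolding lap_cmult[OF hpoly_cpoly[OF h]] lap_diff[OF hpoly_cpoly[OF less(2)] hpoly_cpoly[OF nR]]
      by (simp add: field_simps)
    then have "lap (\<lambda>x. nsq x * ?Q x) x + of_nat c * ?Q x = q x" for x
    proof -
      assume *: "\<And>x. lap ?Q x = R x"
      have "lap (\<lambda>x. nsq x * ?Q x) x + of_nat c * ?Q x
          = (of_nat (2 * DIM('a) + 4 * m) + of_nat c) * ?Q x + nsq x * R x"
        unfolding lap_nsq_mult[OF Q] * by (simp only: distrib_right add_ac)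
      also have "\<dots> = q x" using d by (simp only: dd) simp
      finally show ?thesis .
    qed
    then show ?thesis using Q by blast
  qed
qed

definition hhpoly :: "nat \<Rightarrow> ('a::euclidean_space \<Rightarrow> complex) \<Rightarrow> bool" where
  "hhpoly k p \<longleftrightarrow> hpoly k p \<and> (\<forall>x. lap p x = 0)"

lemma hhpoly_zero: "hhpoly k (\<lambda>x. 0)"
  unfolding hhpoly_def by (simp add: hpoly_zero lap_def pd_const_fun)

lemma hhpoly_add: "hhpoly k p \<Longrightarrow> hhpoly k q \<Longrightarrow> hhpoly k (\<lambda>x. p x + q x)"
  unfolding hhpoly_def by (auto simp: hpoly_add lap_add hpoly_cpoly)

lemma hhpoly_cmult: "hhpoly k p \<Longrightarrow> hhpoly k (\<lambda>x. c * p x)"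
  unfolding hhpoly_def by (auto simp: hpoly_cmult lap_cmult hpoly_cpoly)

lemma hhpoly_diff: "hhpoly k p \<Longrightarrow> hhpoly k q \<Longrightarrow> hhpoly k (\<lambda>x. p x - q x)"
  unfolding hhpoly_def by (auto simp: hpoly_diff lap_diff hpoly_cpoly)

lemma hpoly_cnj: "hpoly k p \<Longrightarrow> hpoly k (\<lambda>x. cnj (p x))"
  by (induction rule: hpoly.induct) (auto intro: hpoly.intros)

lemma hhpoly_cnj: "hhpoly k p \<Longrightarrow> hhpoly k (\<lambda>x. cnj (p x))"
  unfolding hhpoly_def by (auto simp: hpoly_cnj lap_cnj hpoly_cpoly)

text \<open>A harmonic polynomial together with its components. Since \<open>h j\<close> vanishes
  from \<open>K\<close> on, the family is fixed at every index: decompositions of different lengths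
  can be added, and estimates for \<open>h k\<close> make sense for all \<open>k\<close>.\<close>

definition hhsum :: "('a::euclidean_space \<Rightarrow> complex) \<Rightarrow> (nat \<Rightarrow> 'a \<Rightarrow> complex) \<Rightarrow> nat \<Rightarrow> bool" where
  "hhsum p h K \<longleftrightarrow> (\<forall>j. hhpoly j (h j)) \<and> (\<forall>j\<ge>K. h j = (\<lambda>x. 0)) \<and> (\<forall>x. p x = (\<Sum>j<K. h j x))"

lemma hhsum_mono:
  assumes "hhsum p h K" "K \<le> L" shows "hhsum p h L"
proof -
  have "(\<Sum>j<K. h j x) = (\<Sum>j<L. h j x)" for x
    using assms unfolding hhsum_def by (intro sum.mono_neutral_left) auto
  then show ?thesis using assms unfolding hhsum_def by auto
qed

lemma hhsum_add:
  assumes "hhsum p h K" "hhsum q g L"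
  shows "hhsum (\<lambda>x. p x + q x) (\<lambda>j x. h j x + g j x) (max K L)"
  using hhsum_mono[OF assms(1), of "max K L"] hhsum_mono[OF assms(2), of "max K L"]
  unfolding hhsum_def by (auto simp: hhpoly_add sum.distrib)

lemma hhsum_diff:
  assumes "hhsum p h K" "hhsum q g L"
  shows "hhsum (\<lambda>x. p x - q x) (\<lambda>j x. h j x - g j x) (max K L)"
  using hhsum_mono[OF assms(1), of "max K L"] hhsum_mono[OF assms(2), of "max K L"]
  unfolding hhsum_def by (auto simp: hhpoly_diff sum_subtractf)

lemma hhsum_cmult: "hhsum p h K \<Longrightarrow> hhsum (\<lambda>x. c * p x) (\<lambda>j x. c * h j x) K"
  unfolding hhsum_def by (auto simp: hhpoly_cmult sum_distrib_left)

lemma hhsum_single: "hhpoly k p \<Longrightarrow> hhsum p (\<lambda>j. if j = k then p else (\<lambda>x. 0)) (Suc k)"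
  unfolding hhsum_def by (auto simp: hhpoly_zero if_distribR)

lemma hhsum_zero: "hhsum (\<lambda>x. 0) (\<lambda>j x. 0) 0"
  unfolding hhsum_def by (auto simp: hhpoly_zero)

text \<open>Gauss decomposition \<open>p = h + \<bar>x\<bar>\<^sup>2 Q\<close> with \<open>h\<close> harmonic, iterated; on a sphere the factor
  \<open>\<bar>x\<bar>\<^sup>2\<close> is constant.\<close>

lemma hpoly_eq_hhsum_on_sphere:
  assumes "hpoly k p" shows "\<exists>q h K. hhsum q h K \<and> (\<forall>x. norm x = r \<longrightarrow> p x = q x)"
  using assms
proof (induction k arbitrary: p rule: less_induct)
  case (less k)
  show ?case
  proof (cases "k < 2")
    case True
    then have "hhpoly k p" unfolding hhpoly_def using less(2) lap_hpoly_less_2 by metis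
    then show ?thesis using hhsum_single by blast
  next
    case False
    from lap_nsq_surj[OF hpoly_lap[OF less(2)], of 0] obtain Q where
      Q: "hpoly (k - 2) Q" "\<And>x. lap (\<lambda>x. nsq x * Q x) x = lap p x" by auto
    have nQ: "hpoly k (\<lambda>x. nsq x * Q x)" using hpoly_mult[OF hpoly_nsq Q(1)] False by (metis add_diff_inverse_nat)
    have hh: "hhpoly k (\<lambda>x. p x - nsq x * Q x)"
      unfolding hhpoly_def using less(2) nQ by (simp add: hpoly_diff lap_diff hpoly_cpoly Q(2))
    from less(1)[OF _ Q(1)] False obtain q h K where q: "hhsum q h K" "\<And>x. norm x = r \<Longrightarrow> Q x = q x"
      by auto
    have "p x = (p x - nsq x * Q x) + of_real (r\<^sup>2) * q x" if "norm x = r" for x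
      using that q(2)[OF that] by (simp add: nsq_eq)
    then show ?thesis
      using hhsum_add[OF hhsum_single[OF hh] hhsum_cmult[OF q(1), of "of_real (r\<^sup>2)"]] by blast
  qed
qed

lemma cpoly_hpoly_sum:
  assumes "cpoly p" shows "\<exists>h K. (\<forall>j. hpoly j (h j)) \<and> (\<forall>x. p x = (\<Sum>j<(K::nat). h j x))"
proof -
  define S where "S p \<longleftrightarrow> (\<exists>h K. (\<forall>j. hpoly j (h j)) \<and> (\<forall>x. p x = (\<Sum>j<(K::nat). h j x)))"
    for p :: "'a \<Rightarrow> complex"
  have single: "S p" if "hpoly k p" for p k
  proof -
    have "\<forall>j. hpoly j (if j = k then p else (\<lambda>x. 0))" using that by (simp add: hpoly_zero)
    moreover have "\<forall>x. p x = (\<Sum>j<Suc k. (if j = k then p else (\<lambda>x. 0)) x)" by (simp add: if_distribR)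
    ultimately show ?thesis unfolding S_def
      by (intro exI[of _ "\<lambda>j. if j = k then p else (\<lambda>x. 0)"] exI[of _ "Suc k"] conjI)
  qed
  have add: "S (\<lambda>x. p x + q x)" if "S p" "S q" for p q
  proof -
    from that obtain h K g L where h: "\<forall>j. hpoly j (h j)" "\<forall>x. p x = (\<Sum>j<(K::nat). h j x)"
      "\<forall>j. hpoly j (g j)" "\<forall>x. q x = (\<Sum>j<(L::nat). g j x)" unfolding S_def by blast
    define f where "f j x = (if j < K then h j x else 0) + (if j < L then g j x else 0)" for j x
    have "hpoly j (f j)" for j
      unfolding f_def[abs_def] using h by (intro hpoly_add) (cases "j < K"; cases "j < L"; simp add: hpoly_zero)+
    moreover have "p x + q x = (\<Sum>j<max K L. f j x)" for x
    proof -
      have "(\<Sum>j<max K L. if j < K then h j x else 0) = (\<Sum>j<K. h j x)"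
        by (rule sum.mono_neutral_cong_right) auto
      moreover have "(\<Sum>j<max K L. if j < L then g j x else 0) = (\<Sum>j<L. g j x)"
        by (rule sum.mono_neutral_cong_right) auto
      ultimately show ?thesis using h by (simp add: f_def sum.distrib)
    qed
    ultimately show ?thesis unfolding S_def by blast
  qed
  have sum: "S (\<lambda>x. \<Sum>i\<in>I. f i x)" if "finite I" "\<And>i. i \<in> I \<Longrightarrow> S (f i)" for f and I :: "nat set"
    using that by (induction I rule: finite_induct) (auto intro!: single[OF hpoly_zero] add)
  have "S p" using assms
  proof (induction rule: cpoly.induct)
    case (cpoly_const c)
    then show ?case using single hpoly_const by blast
  next
    case (cpoly_coord b)
    \<comment> \<open>Here \<open>b\<close> is an arbitrary vector, whereas \<open>hpoly\<close>
      admits only basis directions; hence the expansion of \<open>b\<close>.\<close>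
    have "S (\<lambda>x. \<Sum>c\<in>Basis. of_real (b \<bullet> c) * of_real (x \<bullet> c))"
      by (intro single[of 1] hpoly_sum hpoly_cmult hpoly_coord)
    moreover have "(\<lambda>x. \<Sum>c\<in>Basis. complex_of_real (b \<bullet> c) * of_real (x \<bullet> c)) = (\<lambda>x. of_real (x \<bullet> b))"
      by (subst euclidean_inner) (simp add: mult.commute)
    ultimately show ?case by simp
  next
    case (cpoly_add p q)
    then show ?case using add by blast
  next
    case (cpoly_mult p q)
    then obtain h K g L where h: "\<forall>j. hpoly j (h j)" "\<forall>x. p x = (\<Sum>j<(K::nat). h j x)"
      "\<forall>j. hpoly j (g j)" "\<forall>x. q x = (\<Sum>j<(L::nat). g j x)" unfolding S_def by blast
    have "S (\<lambda>x. \<Sum>i\<in>{..<K}. \<Sum>j\<in>{..<L}. h i x * g j x)"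
      using h by (intro sum) (blast intro: single hpoly_mult finite_lessThan)+
    then show ?case using h by (simp add: sum_product)
  qed
  then show ?thesis unfolding S_def .
qed

section \<open>Approximation of harmonic functions by harmonic polynomials\<close>

text \<open>The product rule for \<open>polynomial_function\<close> has a real-valued factor, so a
  complex product is split into Re p times q plus Im p times i q.\<close>

lemma polynomial_function_cpoly: "cpoly p \<Longrightarrow> polynomial_function p"
proof (induction rule: cpoly.induct)
  case (cpoly_coord b)
  have "bounded_linear (\<lambda>x. complex_of_real (x \<bullet> b))"
    by (rule bounded_linear_compose[OF bounded_linear_of_real bounded_linear_inner_left])
  then show ?case by (rule polynomial_function_bounded_linear)
next
  case (cpoly_mult p q)
  have lin: "polynomial_function (\<lambda>x. l (r x))"
    if l: "bounded_linear l" and r: "polynomial_function r"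
    for l :: "complex \<Rightarrow> 'c::euclidean_space" and r :: "'a \<Rightarrow> complex"
    unfolding polynomial_function_def o_def
  proof (intro allI impI)
    fix f :: "'c \<Rightarrow> real" assume "bounded_linear f"
    from bounded_linear_compose[OF this l] show "real_polynomial_function (\<lambda>x. f (l (r x)))"
      using r[unfolded polynomial_function_def o_def, rule_format, of "\<lambda>x. f (l x)"] by simp
  qed
  have "polynomial_function (\<lambda>x. Re (p x) *\<^sub>R q x + Im (p x) *\<^sub>R (\<i> * q x))"
    by (rule polynomial_function_add[OF
          polynomial_function_mult[OF lin[OF bounded_linear_Re cpoly_mult(3)] cpoly_mult(4)]
          polynomial_function_mult[OF lin[OF bounded_linear_Im cpoly_mult(3)]
            lin[OF bounded_linear_mult_right[of \<i>] cpoly_mult(4)]]])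
  moreover have "(\<lambda>x. Re (p x) *\<^sub>R q x + Im (p x) *\<^sub>R (\<i> * q x)) = (\<lambda>x. p x * q x)"
    by (auto simp: complex_eq_iff)
  ultimately show ?case by simp
next
  case (cpoly_const c)
  show ?case by (rule polynomial_function_const)
next
  case (cpoly_add p q)
  then show ?case by (intro polynomial_function_add)
qed

text \<open>Real linear functionals are inner products with a vector, and real and imaginary parts
  are recombined. This carries the Stone--Weierstrass approximant over to
  \<open>cpoly\<close>.\<close>

lemma cpoly_polynomial_function:
  fixes g :: "'a::euclidean_space \<Rightarrow> complex"
  assumes "polynomial_function g" shows "cpoly g"
proof -
  have real: "cpoly (\<lambda>x::'a. of_real (r x))" if "real_polynomial_function r" for r
    using that
  proof (induction rule: real_polynomial_function.induct)
    case (linear f)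
    have "f x = x \<bullet> (\<Sum>b\<in>Basis. f b *\<^sub>R b)" for x
    proof -
      have "f x = f (\<Sum>b\<in>Basis. (x \<bullet> b) *\<^sub>R b)" by (simp add: euclidean_representation)
      also have "\<dots> = (\<Sum>b\<in>Basis. (x \<bullet> b) * f b)"
        by (simp only: linear_sum[OF bounded_linear.linear[OF linear]]
            linear_cmul[OF bounded_linear.linear[OF linear]] real_scaleR_def)
      finally show ?thesis by (simp add: inner_sum_right mult.commute)
    qed
    then obtain v where "\<And>x. f x = x \<bullet> v" by blast
    then show ?case by (simp add: cpoly_coord)
  next
    case (const c)
    show ?case by (rule cpoly_const)
  next
    case (add f g)
    from cpoly_add[OF add(3,4)] show ?case by simp
  next
    case (mult f g)
    from cpoly_mult[OF mult(3,4)] show ?case by simp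
  qed
  have part: "real_polynomial_function (\<lambda>x. l (g x))" if "bounded_linear l" for l
    using assms that unfolding polynomial_function_def o_def by simp
  from cpoly_add[OF real[OF part[OF bounded_linear_Re]] cpoly_cmult[OF real[OF part[OF bounded_linear_Im]], of \<i>]]
  have "cpoly (\<lambda>x. of_real (Re (g x)) + \<i> * of_real (Im (g x)))" .
  moreover have "(\<lambda>x. of_real (Re (g x)) + \<i> * of_real (Im (g x))) = g"
    by (rule ext) (simp add: complex_eq_iff)
  ultimately show ?thesis by simp
qed

lemma cpoly_continuous_on: "cpoly p \<Longrightarrow> continuous_on S p"
  by (meson cpoly_differentiable differentiable_imp_continuous_within continuous_at_imp_continuous_on)

lemma harmonic_onE:
  assumes "harmonic_on f S"
  obtains f' f'' where "\<And>x. x \<in> S \<Longrightarrow> (f has_derivative f' x) (at x)"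
    "\<And>x v. x \<in> S \<Longrightarrow> ((\<lambda>y. f' y v) has_derivative f'' x v) (at x)"
    "\<And>v w. continuous_on S (\<lambda>x. f'' x v w)"
    "\<And>x. x \<in> S \<Longrightarrow> (\<Sum>b\<in>Basis. f'' x b b) = 0"
proof -
  from assms obtain f' f'' where *: "(\<forall>x\<in>S. (f has_derivative f' x) (at x)) \<and>
        (\<forall>x\<in>S. \<forall>v. ((\<lambda>y. f' y v) has_derivative f'' x v) (at x)) \<and>
        (\<forall>v w. continuous_on S (\<lambda>x. f'' x v w)) \<and>
        (\<forall>x\<in>S. (\<Sum>b\<in>Basis. f'' x b b) = 0)" unfolding harmonic_on_def by (elim exE)
  show thesis by (rule that[of f' f'']) (use * in auto)
qed

lemma harmonic_onI:
  assumes "\<And>x. x \<in> S \<Longrightarrow> (f has_derivative f' x) (at x)"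
    "\<And>x v. x \<in> S \<Longrightarrow> ((\<lambda>y. f' y v) has_derivative f'' x v) (at x)"
    "\<And>v w. continuous_on S (\<lambda>x. f'' x v w)"
    "\<And>x. x \<in> S \<Longrightarrow> (\<Sum>b\<in>Basis. f'' x b b) = 0"
  shows "harmonic_on f S"
  unfolding harmonic_on_def
  by (rule exI[of _ f'], rule exI[of _ f'']) (use assms in auto)

lemma harmonic_on_diff:
  assumes "harmonic_on f S" "harmonic_on g S" shows "harmonic_on (\<lambda>x. f x - g x) S"
proof -
  from assms(1) obtain f' f'' where f: "\<And>x. x \<in> S \<Longrightarrow> (f has_derivative f' x) (at x)"
    "\<And>x v. x \<in> S \<Longrightarrow> ((\<lambda>y. f' y v) has_derivative f'' x v) (at x)"
    "\<And>v w. continuous_on S (\<lambda>x. f'' x v w)"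
    "\<And>x. x \<in> S \<Longrightarrow> (\<Sum>b\<in>Basis. f'' x b b) = 0" by (rule harmonic_onE) auto
  from assms(2) obtain g' g'' where g: "\<And>x. x \<in> S \<Longrightarrow> (g has_derivative g' x) (at x)"
    "\<And>x v. x \<in> S \<Longrightarrow> ((\<lambda>y. g' y v) has_derivative g'' x v) (at x)"
    "\<And>v w. continuous_on S (\<lambda>x. g'' x v w)"
    "\<And>x. x \<in> S \<Longrightarrow> (\<Sum>b\<in>Basis. g'' x b b) = 0" by (rule harmonic_onE) auto
  show ?thesis
  proof (rule harmonic_onI[of S _ "\<lambda>x v. f' x v - g' x v" "\<lambda>x v w. f'' x v w - g'' x v w"])
    show "(\<Sum>b\<in>Basis. f'' x b b - g'' x b b) = 0" if "x \<in> S" for x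
      using f(4)[OF that] g(4)[OF that] by (simp add: sum_subtractf)
  qed (intro has_derivative_diff continuous_on_diff f g; assumption)+
qed

lemma harmonic_on_cpoly:
  assumes "cpoly p" "\<And>x. lap p x = 0" shows "harmonic_on p S"
proof (rule harmonic_onI[of S p "\<lambda>x v. pd v p x" "\<lambda>x v w. pd w (pd v p) x"])
  show "(\<Sum>b\<in>Basis. pd b (pd b p) x) = 0" for x using assms(2) by (simp add: lap_def)
qed (intro has_derivative_pd cpoly_differentiable cpoly_pd cpoly_continuous_on assms(1))+

lemma homogeneous_harmonic_poly_hhpoly: "hhpoly k p \<Longrightarrow> homogeneous_harmonic_poly k p"
  unfolding hhpoly_def homogeneous_harmonic_poly_def
  using harmonic_on_cpoly[OF hpoly_cpoly, of k p UNIV] hpoly_homogeneous[of k p]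
    polynomial_function_cpoly[OF hpoly_cpoly, of k p] by simp

lemma harmonic_on_subset:
  assumes "harmonic_on f S" "T \<subseteq> S" shows "harmonic_on f T"
proof -
  from assms(1) obtain f' f'' where "\<And>x. x \<in> S \<Longrightarrow> (f has_derivative f' x) (at x)"
    "\<And>x v. x \<in> S \<Longrightarrow> ((\<lambda>y. f' y v) has_derivative f'' x v) (at x)"
    "\<And>v w. continuous_on S (\<lambda>x. f'' x v w)"
    "\<And>x. x \<in> S \<Longrightarrow> (\<Sum>b\<in>Basis. f'' x b b) = 0" by (rule harmonic_onE) auto
  note * = this
  show ?thesis
  proof (rule harmonic_onI[of T f f' f''])
    show "continuous_on T (\<lambda>x. f'' x v w)" for v w by (rule continuous_on_subset[OF *(3) assms(2)])
  qed (use *(1,2,4) assms(2) in \<open>simp_all add: subset_iff\<close>)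
qed

lemma harmonic_on_continuous: "harmonic_on f S \<Longrightarrow> continuous_on S f"
  by (erule harmonic_onE) (meson continuous_at_imp_continuous_on has_derivative_continuous)

section \<open>The maximum principle and approximation on balls\<close>

lemma second_derivative_local_max:
  fixes g :: "real \<Rightarrow> real"
  assumes d: "0 < d" and g: "\<And>t. \<bar>t\<bar> < d \<Longrightarrow> (g has_real_derivative g' t) (at t)"
    and g': "(g' has_real_derivative l) (at 0)"
    and max: "\<And>t. \<bar>t\<bar> < d \<Longrightarrow> g t \<le> g 0"
  shows "l \<le> 0"
proof (rule ccontr)
  assume "\<not> l \<le> 0"
  have 0: "g' 0 = 0" using DERIV_local_max[OF g[of 0] d] d max by simp
  \<comment> \<open>A positive derivative of \<open>g'\<close> at 0, where \<open>g' 0 = 0\<close>,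
    makes \<open>g'\<close> positive just to the right, so \<open>g\<close> would increase
    there.\<close>
  from DERIV_pos_inc_right[OF g'] \<open>\<not> l \<le> 0\<close> obtain e where
    e: "e > 0" "\<And>h. 0 < h \<Longrightarrow> h < e \<Longrightarrow> g' 0 < g' h" by auto
  define h where "h = min d e / 2"
  have h: "0 < h" "h < d" "h < e" using d e by (auto simp: h_def min_def)
  from MVT2[of 0 h g g'] h g obtain z where z: "0 < z" "z < h" "g h - g 0 = (h - 0) * g' z" by auto
  have "g' z > 0" using e(2)[of z] z h 0 by simp
  then have "g h - g 0 > 0" using z h by simp
  then show False using max[of h] h by simp
qed

text \<open>The real part of a rotated \<open>u\<close> is perturbed by e |x|^2, whose Laplacian is
  the positive number 2 n e. At an interior maximum all pure second derivatives are at most 0,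
  contradicting their sum 2 n e; a maximum on the sphere is excluded by the size of
  \<open>e\<close>.\<close>

lemma harmonic_on_max_principle:
  fixes u :: "'a::euclidean_space \<Rightarrow> complex"
  assumes u: "harmonic_on u (cball 0 r)"
    and M: "\<And>x. norm x = r \<Longrightarrow> norm (u x) \<le> M" and x0: "norm x0 \<le> r"
  shows "norm (u x0) \<le> M"
proof (rule ccontr)
  assume not: "\<not> norm (u x0) \<le> M"
  from u obtain f' f'' where f':
    "\<And>x. x \<in> cball 0 r \<Longrightarrow> (u has_derivative f' x) (at x)"
    "\<And>x v. x \<in> cball 0 r \<Longrightarrow> ((\<lambda>y. f' y v) has_derivative f'' x v) (at x)"
    "\<And>x. x \<in> cball 0 r \<Longrightarrow> (\<Sum>b\<in>Basis. f'' x b b) = 0"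
    by (rule harmonic_onE) blast
  \<comment> \<open>Rotates the value at \<open>x0\<close> onto the nonnegative real axis.\<close>
  define c where "c = cnj (sgn (u x0))"
  have nc: "norm c \<le> 1" unfolding c_def by (simp add: norm_sgn)
  have cx: "Re (c * u x0) = norm (u x0)"
  proof -
    have "c * u x0 = (u x0 * cnj (u x0)) / of_real (norm (u x0))"
      unfolding c_def sgn_div_norm by (simp add: scaleR_conv_of_real field_simps)
    also have "\<dots> = of_real ((norm (u x0))\<^sup>2 / norm (u x0))"
      by (simp only: complex_norm_square[symmetric] of_real_divide)
    also have "\<dots> = of_real (norm (u x0))" by (simp add: power2_eq_square)
    finally show ?thesis by simp
  qed
  have r: "r \<ge> 0" using x0 norm_ge_zero order_trans by blast
  \<comment> \<open>Keeps e r^2 below the gap between |u(x0)| and \<open>M\<close>; the summand 1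
    covers r = 0.\<close>
  define e where "e = (norm (u x0) - M) / (2 * (r\<^sup>2 + 1))"
  have e: "e > 0" unfolding e_def using not by (auto intro!: divide_pos_pos add_nonneg_pos)
  have er: "e * r\<^sup>2 < norm (u x0) - M"
  proof -
    have "e * (2 * (r\<^sup>2 + 1)) = norm (u x0) - M"
      unfolding e_def by (simp add: add_nonneg_eq_0_iff)
    moreover have "e * (2 * (r\<^sup>2 + 1)) = 2 * (e * r\<^sup>2) + 2 * e" by (simp add: algebra_simps)
    moreover have "e * r\<^sup>2 \<ge> 0" using e by simp
    ultimately show ?thesis using e by linarith
  qed
  define w where "w x = Re (c * u x) + e * (x \<bullet> x)" for x
  have contu: "continuous_on (cball 0 r) u" using u harmonic_on_continuous by blast
  have "continuous_on (cball 0 r) w"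
    unfolding w_def by (intro continuous_intros contu)
  then obtain y where y: "y \<in> cball 0 r" "\<And>x. x \<in> cball 0 r \<Longrightarrow> w x \<le> w y"
    using continuous_attains_sup[of "cball 0 r" w] r by auto
  have "norm y \<noteq> r"
  proof
    assume ny: "norm y = r"
    have "Re (c * u y) \<le> norm (c * u y)" by (rule complex_Re_le_cmod)
    also have "\<dots> \<le> 1 * norm (u y)" unfolding norm_mult using nc by (intro mult_right_mono) auto
    also have "\<dots> \<le> M" using M[OF ny] by simp
    finally have "w y \<le> M + e * r\<^sup>2" unfolding w_def using ny by (simp add: dot_square_norm)
    moreover have "w x0 \<ge> norm (u x0)" unfolding w_def using cx e by simp
    ultimately show False using y(2)[of x0] x0 er by simp
  qed
  then have ny: "norm y < r" using y by simp
  define d where "d = r - norm y"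
  have d: "d > 0" using ny by (simp add: d_def)
  have "Re (c * f'' y b b) + 2 * e \<le> 0" if b: "b \<in> Basis" for b
  proof (rule second_derivative_local_max[OF d, of "\<lambda>t. w (y + t *\<^sub>R b)"
      "\<lambda>t. Re (c * f' (y + t *\<^sub>R b) b) + 2 * e * ((y + t *\<^sub>R b) \<bullet> b)"])
    have inc: "y + t *\<^sub>R b \<in> cball 0 r" if "\<bar>t\<bar> < d" for t
      using that norm_triangle_ineq[of y "t *\<^sub>R b"] b by (simp add: d_def)
    have ln: "((\<lambda>t. y + t *\<^sub>R b) has_derivative (\<lambda>h. h *\<^sub>R b)) (at t)" for t
      by (auto intro!: derivative_eq_intros)
    fix t :: real assume t: "\<bar>t\<bar> < d"
    have "((\<lambda>t. u (y + t *\<^sub>R b)) has_derivative (\<lambda>h. f' (y + t *\<^sub>R b) (h *\<^sub>R b))) (at t)"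
      using has_derivative_compose[OF ln f'(1)[OF inc[OF t]]] .
    then have D: "((\<lambda>t. w (y + t *\<^sub>R b)) has_derivative (\<lambda>h. Re (c * f' (y + t *\<^sub>R b) (h *\<^sub>R b))
        + e * ((y + t *\<^sub>R b) \<bullet> (h *\<^sub>R b) + (h *\<^sub>R b) \<bullet> (y + t *\<^sub>R b)))) (at t)"
      unfolding w_def
      by (intro has_derivative_add has_derivative_Re has_derivative_mult_right has_derivative_inner ln)
    have L: "f' (y + t *\<^sub>R b) (h *\<^sub>R b) = h *\<^sub>R f' (y + t *\<^sub>R b) b" for h
      using linear_cmul[OF has_derivative_linear[OF f'(1)[OF inc[OF t]]]] .
    show "((\<lambda>t. w (y + t *\<^sub>R b)) has_real_derivative
        Re (c * f' (y + t *\<^sub>R b) b) + 2 * e * ((y + t *\<^sub>R b) \<bullet> b)) (at t)"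
      unfolding has_field_derivative_def
      by (rule has_derivative_eq_rhs[OF D]) (simp add: L fun_eq_iff algebra_simps inner_commute)
    show "w (y + t *\<^sub>R b) \<le> w (y + 0 *\<^sub>R b)" using y(2)[OF inc[OF t]] by simp
  next
    have ln: "((\<lambda>t. y + t *\<^sub>R b) has_derivative (\<lambda>h. h *\<^sub>R b)) (at 0)"
      by (auto intro!: derivative_eq_intros)
    have *: "((\<lambda>t. f' (y + t *\<^sub>R b) b) has_derivative (\<lambda>h. f'' y b (h *\<^sub>R b))) (at 0)"
      using has_derivative_compose[OF ln, of "\<lambda>z. f' z b" "f'' y b"] f'(2)[OF y(1)] by simp
    have D: "((\<lambda>t. Re (c * f' (y + t *\<^sub>R b) b) + 2 * e * ((y + t *\<^sub>R b) \<bullet> b)) has_derivative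
       (\<lambda>h. Re (c * f'' y b (h *\<^sub>R b)) + 2 * e * ((h *\<^sub>R b) \<bullet> b))) (at 0)"
      by (intro has_derivative_add has_derivative_Re has_derivative_mult_right * has_derivative_inner_left ln)
    have L: "f'' y b (h *\<^sub>R b) = h *\<^sub>R f'' y b b" for h
      using linear_cmul[OF has_derivative_linear[OF f'(2)[OF y(1)]]] .
    show "((\<lambda>t. Re (c * f' (y + t *\<^sub>R b) b) + 2 * e * ((y + t *\<^sub>R b) \<bullet> b)) has_real_derivative
        Re (c * f'' y b b) + 2 * e) (at 0)"
      unfolding has_field_derivative_def
      by (rule has_derivative_eq_rhs[OF D]) (use b in \<open>simp add: L fun_eq_iff algebra_simps\<close>)
  qed
  then have "(\<Sum>b\<in>(Basis::'a set). Re (c * f'' y b b) + 2 * e) \<le> 0" by (rule sum_nonpos)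
  moreover have "(\<Sum>b\<in>(Basis::'a set). Re (c * f'' y b b)) = Re (c * (\<Sum>b\<in>Basis. f'' y b b))"
    by (simp add: sum_distrib_left)
  ultimately have "real DIM('a) * (2 * e) \<le> 0" using f'(3)[OF y(1)] by (simp add: sum.distrib)
  moreover have "real DIM('a) * (2 * e) > 0" using e by (intro mult_pos_pos) auto
  ultimately show False by simp
qed

lemma cpoly_eq_hhsum_on_sphere:
  assumes "cpoly p" shows "\<exists>q h K. hhsum q h K \<and> (\<forall>x. norm x = r \<longrightarrow> p x = q x)"
proof -
  from cpoly_hpoly_sum[OF assms] obtain h K where
    h: "\<And>j. hpoly j (h j)" "\<And>x. p x = (\<Sum>j<(K::nat). h j x)" by blast
  have "\<exists>q g L. hhsum q g L \<and> (\<forall>x. norm x = r \<longrightarrow> (\<Sum>j<N. h j x) = q x)" for N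
  proof (induction N)
    case 0
    then show ?case using hhsum_zero by (intro exI conjI) auto
  next
    case (Suc N)
    then obtain q g L where q: "hhsum q g L" "\<And>x. norm x = r \<Longrightarrow> (\<Sum>j<N. h j x) = q x" by blast
    from hpoly_eq_hhsum_on_sphere[OF h(1)[of N]] obtain q' g' L' where
      q': "hhsum q' g' L'" "\<And>x. norm x = r \<Longrightarrow> h N x = q' x" by blast
    show ?case using hhsum_add[OF q(1) q'(1)] q(2) q'(2) by (intro exI conjI) auto
  qed
  from this[of K] show ?thesis unfolding h(2) .
qed

lemma hhsum_cpoly: assumes "hhsum q h K" shows "cpoly q"
proof -
  have "cpoly (\<lambda>x. \<Sum>j<K. h j x)"
    using assms unfolding hhsum_def hhpoly_def by (blast intro: cpoly_sum hpoly_cpoly)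
  moreover have "q = (\<lambda>x. \<Sum>j<K. h j x)" using assms unfolding hhsum_def by auto
  ultimately show ?thesis by simp
qed

lemma lap_hhsum: assumes "hhsum q h K" shows "lap q x = 0"
proof -
  have "q = (\<lambda>x. \<Sum>j<K. h j x)" using assms unfolding hhsum_def by blast
  moreover have "lap (\<lambda>x. \<Sum>j<K. h j x) = (\<lambda>x. \<Sum>j<K. lap (h j) x)"
    using assms unfolding hhsum_def hhpoly_def by (intro lap_sum) (blast intro: hpoly_cpoly)
  ultimately show ?thesis using assms unfolding hhsum_def hhpoly_def by simp
qed

text \<open>The Dirichlet problem is solved exactly for a polynomial close to \<open>f\<close> on the sphere; the maximum
  principle transports closeness to the ball.\<close>

lemma harmonic_approx:
  fixes f :: "'a::euclidean_space \<Rightarrow> complex"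
  assumes f: "harmonic_on f (ball 0 1)" and r: "r < 1" and e: "e > 0"
  shows "\<exists>q h K. hhsum q h K \<and> (\<forall>x. norm x \<le> r \<longrightarrow> norm (f x - q x) \<le> e)"
proof -
  have sub: "cball 0 r \<subseteq> ball 0 (1::real)" "sphere 0 r \<subseteq> ball (0::'a) 1" "cball 0 r \<subseteq> ball (0::'a) 1" using r by auto
  have "continuous_on (sphere 0 r) f"
    using harmonic_on_continuous[OF f] continuous_on_subset sub by blast
  from Stone_Weierstrass_polynomial_function[OF compact_sphere this e]
  obtain g where g: "polynomial_function g" "\<And>x. x \<in> sphere 0 r \<Longrightarrow> norm (f x - g x) < e" by blast
  from cpoly_eq_hhsum_on_sphere[OF cpoly_polynomial_function[OF g(1)]] obtain q h K where
    q: "hhsum q h K" "\<And>x. norm x = r \<Longrightarrow> g x = q x" by blast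
  have "harmonic_on (\<lambda>x. f x - q x) (cball 0 r)"
    using harmonic_on_diff[OF harmonic_on_subset[OF f sub(3)] harmonic_on_cpoly[OF hhsum_cpoly[OF q(1)] lap_hhsum[OF q(1)]]] .
  from harmonic_on_max_principle[OF this] have "norm (f x - q x) \<le> e" if "norm x \<le> r" for x
    using that g(2) q(2) by (force simp: less_imp_le)
  then show ?thesis using q(1) by blast
qed

section \<open>Orthogonality and the mean value property\<close>

text \<open>Once the lower coefficients are known to vanish, the series divided by t^m is still zero
  for t \<noteq> 0, and its limit at 0 is \<open>a m\<close>.\<close>

lemma real_powser_sums_zero:
  fixes a :: "nat \<Rightarrow> real"
  assumes "\<And>t. \<bar>t\<bar> < 1 \<Longrightarrow> (\<lambda>k. a k * t ^ k) sums 0"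
  shows "a m = 0"
proof (induction m rule: less_induct)
  case (less m)
  have "(\<lambda>k. a (k + m) * t ^ k) sums 0" if "t \<noteq> 0" "\<bar>t\<bar> < 1" for t
  proof -
    have "(\<lambda>k. a (k + m) * t ^ (k + m)) sums (0 - (\<Sum>i<m. a i * t ^ i))"
      using sums_split_initial_segment[OF assms[OF that(2)]] by simp
    moreover have "(\<Sum>i<m. a i * t ^ i) = 0" using less by (intro sum.neutral) auto
    ultimately have "(\<lambda>k. a (k + m) * t ^ (k + m) / t ^ m) sums (0 / t ^ m)"
      by (intro sums_divide) simp
    then show ?thesis using that(1) by (simp add: power_add)
  qed
  then have "((\<lambda>_. 0) \<longlongrightarrow> a (0 + m)) (at (0::real))"
    using powser_limit_0_strong[of 1 "\<lambda>k. a (k + m)" "\<lambda>_. 0"] by simp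
  then show ?case using tendsto_const_iff[of "at (0::real)" 0 "a m"] by simp
qed

text \<open>On the ray through \<open>x\<close> homogeneity turns the series into a power series in
  \<open>t\<close>; the scaling by \<open>d\<close> moves \<open>x\<close> into the unit ball. This
  serves both the uniqueness of expansions and the separation of a sum by degrees.\<close>

lemma homogeneous_sums_zero:
  fixes F :: "nat \<Rightarrow> 'a::real_normed_vector \<Rightarrow> complex"
  assumes hom: "\<And>k c x. F k (c *\<^sub>R x) = of_real (c ^ k) * F k x"
    and sums: "\<And>x. norm x < 1 \<Longrightarrow> (\<lambda>k. F k x) sums 0"
  shows "F k x = 0"
proof -
  define d where "d = 1 / (1 + norm x)"
  have np: "1 + norm x > 0" by (simp add: add_pos_nonneg)
  have d: "d > 0" "d * norm x < 1" using np by (simp_all add: d_def field_simps)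
  define a where "a k = F k (d *\<^sub>R x)" for k
  have a: "(\<lambda>k. of_real (t ^ k) * a k) sums 0" if "\<bar>t\<bar> < 1" for t
  proof -
    have "norm (t *\<^sub>R (d *\<^sub>R x)) = \<bar>t\<bar> * (d * norm x)" using d by (simp add: abs_mult)
    also have "\<dots> \<le> 1 * (d * norm x)" using that d by (intro mult_right_mono) auto
    also have "\<dots> < 1" using d by simp
    finally have "(\<lambda>k. F k (t *\<^sub>R (d *\<^sub>R x))) sums 0" by (rule sums)
    then show ?thesis unfolding hom[of _ t] by (simp add: a_def)
  qed
  have "Re (a k) = 0"
    using sums_Re[OF a] by (intro real_powser_sums_zero[of "\<lambda>k. Re (a k)"]) (simp add: mult.commute)
  moreover have "Im (a k) = 0"
    using sums_Im[OF a] by (intro real_powser_sums_zero[of "\<lambda>k. Im (a k)"]) (simp add: mult.commute)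
  ultimately have "a k = 0" by (simp add: complex_eq_iff)
  then show ?thesis using d by (simp add: a_def hom)
qed

section \<open>The bump and integration by parts\<close>

definition bump :: "'a::euclidean_space \<Rightarrow> real" where
  "bump y = max 0 (1 - y \<bullet> y)"

lemma bump_nonneg: "bump y \<ge> 0" unfolding bump_def by simp

lemma bump_le_1: "bump y \<le> 1" unfolding bump_def by simp

lemma bump_eq: "norm y \<le> 1 \<Longrightarrow> bump y = 1 - (norm y)\<^sup>2"
  unfolding bump_def by (simp add: dot_square_norm power_le_one)

lemma bump_zero: "norm y \<ge> 1 \<Longrightarrow> bump y = 0"
  unfolding bump_def by (simp add: dot_square_norm)

lemma bump_pos_iff: "bump y > 0 \<longleftrightarrow> norm y < 1"
  unfolding bump_def using abs_square_less_1[of "norm y"] by (auto simp: dot_square_norm max_def)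

lemma continuous_on_bump [continuous_intros]: "continuous_on S g \<Longrightarrow> continuous_on S (\<lambda>x. bump (g x))"
  unfolding bump_def by (intro continuous_intros)

lemma bump_measurable [measurable]: "bump \<in> borel_measurable borel"
  unfolding bump_def[abs_def] by measurable

lemma bump_lipschitz: "\<bar>bump x - bump y\<bar> \<le> 2 * norm (x - y)"
proof -
  have *: "\<bar>(1 - u\<^sup>2) - (1 - v\<^sup>2)\<bar> \<le> 2 * \<bar>u - v\<bar>" if "0 \<le> u" "u \<le> 1" "0 \<le> v" "v \<le> 1" for u v :: real
  proof -
    have "\<bar>(1 - u\<^sup>2) - (1 - v\<^sup>2)\<bar> = \<bar>u + v\<bar> * \<bar>u - v\<bar>"
      by (simp add: abs_mult[symmetric] power2_eq_square algebra_simps abs_minus_commute)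
    also have "\<dots> \<le> 2 * \<bar>u - v\<bar>" using that by (intro mult_right_mono) auto
    finally show ?thesis .
  qed
  have b: "bump z = 1 - (min 1 (norm z))\<^sup>2" for z :: 'a
    by (cases "norm z \<le> 1") (auto simp: bump_eq bump_zero)
  have "\<bar>bump x - bump y\<bar> \<le> 2 * \<bar>min 1 (norm x) - min 1 (norm y)\<bar>"
    unfolding b by (rule *) auto
  also have "\<dots> \<le> 2 * \<bar>norm x - norm y\<bar>" by (auto simp: min_def abs_if)
  also have "\<dots> \<le> 2 * norm (x - y)" using norm_triangle_ineq3[of x y] by simp
  finally show ?thesis .
qed

lemma integrable_continuous_support:
  fixes F :: "'a::euclidean_space \<Rightarrow> 'b::{banach, second_countable_topology}"
  assumes "continuous_on UNIV F" "\<And>y. norm y > 1 \<Longrightarrow> F y = 0"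
  shows "integrable lborel F"
proof -
  have "integrable lborel (\<lambda>x. indicator (cball 0 1) x *\<^sub>R F x)"
    using assms(1) continuous_on_subset by (intro borel_integrable_compact) auto
  moreover have "(\<lambda>x. indicator (cball 0 1) x *\<^sub>R F x) = F"
    using assms(2) by (auto simp: indicator_def fun_eq_iff)
  ultimately show ?thesis by simp
qed

lemma integral_translation:
  fixes F :: "'a::euclidean_space \<Rightarrow> 'b::{banach, second_countable_topology}"
  assumes [measurable]: "F \<in> borel_measurable borel"
  shows "integrable lborel (\<lambda>y. F (c + y)) \<longleftrightarrow> integrable lborel F"
    "(\<integral>y. F (c + y) \<partial>lborel) = (\<integral>y. F y \<partial>lborel)"
proof -
  have "integrable (distr lborel borel ((+) c)) F \<longleftrightarrow> integrable lborel (\<lambda>y. F (c + y))"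
    by (rule integrable_distr_eq) auto
  then show "integrable lborel (\<lambda>y. F (c + y)) \<longleftrightarrow> integrable lborel F" by (simp add: lborel_distr_plus)
  have "integral\<^sup>L (distr lborel borel ((+) c)) F = (\<integral>y. F (c + y) \<partial>lborel)"
    by (rule integral_distr) auto
  then show "(\<integral>y. F (c + y) \<partial>lborel) = (\<integral>y. F y \<partial>lborel)" by (simp add: lborel_distr_plus)
qed

text \<open>Translation invariance makes the integrals of all difference quotients vanish.\<close>

lemma integral_directional_derivative:
  fixes F :: "'a::euclidean_space \<Rightarrow> complex"
  assumes contF: "continuous_on UNIV F" and cont: "continuous_on UNIV F'"
    and supp: "\<And>y. norm y > 1 \<Longrightarrow> F y = 0" "\<And>y. norm y > 1 \<Longrightarrow> F' y = 0"
    and der: "\<And>y. ((\<lambda>t. F (y + t *\<^sub>R b)) has_vector_derivative F' y) (at 0)"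
    and b: "norm b \<le> 1"
  shows "(\<integral>y. F' y \<partial>lborel) = 0"
proof -
  have meas[measurable]: "F \<in> borel_measurable borel" "F' \<in> borel_measurable borel"
    using contF cont by (auto intro: borel_measurable_continuous_onI)
  have "compact (F' ` cball 0 1)"
    using cont continuous_on_subset by (intro compact_continuous_image) auto
  then obtain B0 where B0: "\<And>y. y \<in> cball 0 1 \<Longrightarrow> norm (F' y) \<le> B0"
    using compact_imp_bounded bounded_iff by (metis image_eqI)
  define B where "B = max B0 0"
  have B: "norm (F' y) \<le> B" "B \<ge> 0" for y
    using B0[of y] supp(2)[of y] by (cases "norm y \<le> 1"; auto simp: B_def)+
  have der': "((\<lambda>t. F (y + t *\<^sub>R b)) has_vector_derivative F' (y + s *\<^sub>R b)) (at s)" for y s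
  proof -
    have "((\<lambda>t. F ((y + s *\<^sub>R b) + t *\<^sub>R b)) has_vector_derivative F' (y + s *\<^sub>R b)) (at (s - s))"
      using der by simp
    moreover have "((\<lambda>t. t - s) has_vector_derivative 1) (at s)"
      by (auto intro!: derivative_eq_intros)
    ultimately have "((\<lambda>t. F ((y + s *\<^sub>R b) + t *\<^sub>R b)) \<circ> (\<lambda>t. t - s) has_vector_derivative 1 *\<^sub>R F' (y + s *\<^sub>R b)) (at s)"
      by (intro vector_diff_chain_at) auto
    then show ?thesis by (simp add: o_def algebra_simps)
  qed
  have lip: "norm (F (y + t *\<^sub>R b) - F y) \<le> B * \<bar>t\<bar>" for y t
  proof -
    have "norm (F (y + t *\<^sub>R b) - F (y + 0 *\<^sub>R b)) \<le> B * norm (t - 0)"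
    proof (rule differentiable_bound[of UNIV "\<lambda>t. F (y + t *\<^sub>R b)" "\<lambda>s k. k *\<^sub>R F' (y + s *\<^sub>R b)"])
      show "onorm (\<lambda>k::real. k *\<^sub>R F' (y + s *\<^sub>R b)) \<le> B" for s
        using B(1)[of "y + s *\<^sub>R b"] by (intro onorm_le) (auto simp: mult.commute[of B] intro: mult_left_mono)
    qed (use der' in \<open>auto simp: has_vector_derivative_def\<close>)
    then show ?thesis by simp
  qed
  define h where "h m = 1 / real (Suc m)" for m
  have h: "h m > 0" "h m \<le> 1" for m by (auto simp: h_def)
  define s where "s m y = (1 / h m) *\<^sub>R (F (y + h m *\<^sub>R b) - F y)" for m y
  have intF: "integrable lborel F" using integrable_continuous_support[OF contF supp(1)] .
  have ints: "(\<integral>y. s m y \<partial>lborel) = 0" for m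
    using integral_translation[of F "h m *\<^sub>R b"] intF
    by (simp add: s_def add.commute)
  have lim: "(\<lambda>m. s m y) \<longlonglongrightarrow> F' y" for y
  proof -
    have "((\<lambda>t. (F (y + t *\<^sub>R b) - F (y + 0 *\<^sub>R b)) /\<^sub>R (t - 0)) \<longlongrightarrow> F' y) (at 0)"
    proof -
      have "((\<lambda>t. norm (F (y + t *\<^sub>R b) - F (y + 0 *\<^sub>R b) - (t - 0) *\<^sub>R F' y) / norm (t - 0)) \<longlongrightarrow> 0) (at 0)"
        using der[of y] by (simp add: has_vector_derivative_def has_derivative_iff_norm)
      moreover have "\<forall>\<^sub>F t in at 0. norm (F (y + t *\<^sub>R b) - F (y + 0 *\<^sub>R b) - (t - 0) *\<^sub>R F' y) / norm (t - 0)
          = norm ((F (y + t *\<^sub>R b) - F (y + 0 *\<^sub>R b)) /\<^sub>R (t - 0) - F' y)"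
      proof (rule eventually_at_filter[THEN iffD2], intro always_eventually allI impI)
        fix t :: real assume "t \<noteq> 0"
        then have "(F (y + t *\<^sub>R b) - F (y + 0 *\<^sub>R b)) /\<^sub>R (t - 0) - F' y
            = (1 / t) *\<^sub>R (F (y + t *\<^sub>R b) - F (y + 0 *\<^sub>R b) - (t - 0) *\<^sub>R F' y)"
          by (simp add: scaleR_diff_right inverse_eq_divide)
        then show "norm (F (y + t *\<^sub>R b) - F (y + 0 *\<^sub>R b) - (t - 0) *\<^sub>R F' y) / norm (t - 0)
          = norm ((F (y + t *\<^sub>R b) - F (y + 0 *\<^sub>R b)) /\<^sub>R (t - 0) - F' y)"
          by simp
      qed
      ultimately have "((\<lambda>t. norm ((F (y + t *\<^sub>R b) - F (y + 0 *\<^sub>R b)) /\<^sub>R (t - 0) - F' y)) \<longlongrightarrow> 0) (at 0)"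
        by (rule Lim_transform_eventually)
      then show ?thesis
        using Lim_null tendsto_norm_zero_iff by blast
    qed
    moreover have "h \<longlonglongrightarrow> 0"
      unfolding h_def[abs_def] using LIMSEQ_inverse_real_of_nat by (simp only: inverse_eq_divide)
    then have "filterlim h (at 0) sequentially"
      unfolding filterlim_at using h(1) by (simp add: less_imp_neq[symmetric])
    ultimately have "((\<lambda>m. (F (y + h m *\<^sub>R b) - F (y + 0 *\<^sub>R b)) /\<^sub>R (h m - 0)) \<longlonglongrightarrow> F' y)"
      by (rule filterlim_compose)
    then show ?thesis by (simp add: s_def inverse_eq_divide)
  qed
  \<comment> \<open>The quotients are bounded by the Lipschitz constant \<open>B\<close> and
    supported in the ball of radius 2, since the increment has length at most 1.\<close>
  have "(\<lambda>m. \<integral>y. s m y \<partial>lborel) \<longlonglongrightarrow> (\<integral>y. F' y \<partial>lborel)"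
  proof (rule integral_dominated_convergence[where w="\<lambda>y. B * indicator (cball 0 2) y"])
    show "AE y in lborel. (\<lambda>m. s m y) \<longlonglongrightarrow> F' y" using lim by simp
    show "integrable lborel (\<lambda>y::'a. B * indicator (cball 0 2) y)"
      using borel_integrable_compact[of "cball (0::'a) 2" "\<lambda>_. B"] by (simp add: mult.commute)
    show "AE y in lborel. norm (s m y) \<le> B * indicator (cball 0 2) y" for m
    proof (intro AE_I2)
      fix y :: 'a
      show "norm (s m y) \<le> B * indicator (cball 0 2) y"
      proof (cases "norm y \<le> 2")
        case True
        have "norm (s m y) \<le> (1 / h m) * (B * \<bar>h m\<bar>)"
          unfolding s_def norm_scaleR using h(1)[of m] lip[of y "h m"] by (intro mult_mono) auto
        then show ?thesis using h(1)[of m] True by simp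
      next
        case False
        have "norm (h m *\<^sub>R b) \<le> 1" using h[of m] b by (simp add: mult_le_one)
        then have "norm (y + h m *\<^sub>R b) > 1" using False norm_diff_ineq[of y "h m *\<^sub>R b"] by simp
        then show ?thesis using False supp(1) B by (simp add: s_def)
      qed
    qed
  qed (simp_all add: s_def)
  then show ?thesis using LIMSEQ_unique ints by (simp add: LIMSEQ_const_iff)
qed


text \<open>Chain rule through the function max(0, t)^2, which is differentiable also at 0.
  \<open>bump\<close> itself has a kink on the unit sphere, its square has none; differentiating the
  square produces the factor \<open>bump\<close>, and this is why the averages below carry
  \<open>bump\<close> as weight.\<close>

lemma has_derivative_bump_square:
  "((\<lambda>y. (bump y)\<^sup>2) has_derivative (\<lambda>v. - 4 * bump y * (y \<bullet> v))) (at y)"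
proof -
  have m: "((\<lambda>t::real. (max 0 t)\<^sup>2) has_real_derivative 2 * max 0 t) (at t)" for t
  proof -
    consider "t > 0" | "t < 0" | "t = 0" by linarith
    then show ?thesis
    proof cases
      case 1
      have "((\<lambda>t::real. t\<^sup>2) has_real_derivative 2 * max 0 t) (at t)"
        using 1 by (auto intro!: derivative_eq_intros)
      then show ?thesis
        by (rule has_field_derivative_transform_within_open[where S="{0<..}"]) (use 1 in auto)
    next
      case 2
      have "((\<lambda>t::real. 0) has_real_derivative 2 * max 0 t) (at t)"
        using 2 by simp
      then show ?thesis
        by (rule has_field_derivative_transform_within_open[where S="{..<0}"]) (use 2 in auto)
    next
      case 3
      have "((\<lambda>h::real. ((max 0 (0 + h))\<^sup>2 - (max 0 0)\<^sup>2) / h) \<longlongrightarrow> 0) (at 0)"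
      proof (rule Lim_null_comparison[where g="\<lambda>h. \<bar>h\<bar>"])
        show "\<forall>\<^sub>F h::real in at 0. norm (((max 0 (0 + h))\<^sup>2 - (max 0 0)\<^sup>2) / h) \<le> \<bar>h\<bar>"
          by (intro always_eventually allI) (auto simp: max_def power2_eq_square)
      qed (auto intro!: tendsto_eq_intros)
      then show ?thesis using 3 by (simp add: DERIV_def)
    qed
  qed
  have "((\<lambda>y. 1 - y \<bullet> y) has_derivative (\<lambda>v. - 2 * (y \<bullet> v))) (at y)"
    by (auto intro!: derivative_eq_intros simp: inner_commute)
  from has_derivative_compose[OF this m[unfolded has_field_derivative_def]]
  have "((\<lambda>y. (bump y)\<^sup>2) has_derivative (\<lambda>v. 2 * bump y * (- 2 * (y \<bullet> v)))) (at y)"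
    unfolding bump_def .
  then show ?thesis by (simp add: mult.assoc)
qed

lemma integrable_bump_cpoly:
  "cpoly p \<Longrightarrow> integrable lborel (\<lambda>y. of_real (bump y) * p y)"
  by (rule integrable_continuous_support)
    (use cpoly_continuous_on in \<open>auto intro!: continuous_intros simp: bump_zero\<close>)

text \<open>The integrand is the derivative of bump^2 P in direction \<open>b\<close>.\<close>

lemma bump_integration_by_parts:
  fixes P :: "'a::euclidean_space \<Rightarrow> complex"
  assumes P: "cpoly P" and b: "b \<in> Basis"
  shows "(\<integral>y. of_real ((bump y)\<^sup>2) * pd b P y - 4 * of_real (bump y) * (of_real (y \<bullet> b) * P y) \<partial>lborel) = 0"
proof (rule integral_directional_derivative[where F="\<lambda>y. of_real ((bump y)\<^sup>2) * P y" and b=b])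
  fix y :: 'a
  have "((\<lambda>t. y + t *\<^sub>R b) has_derivative (\<lambda>h. h *\<^sub>R b)) (at 0)"
    by (auto intro!: derivative_eq_intros)
  moreover have "((\<lambda>y. of_real ((bump y)\<^sup>2) * P y) has_derivative
      (\<lambda>v. of_real ((bump y)\<^sup>2) * pd v P y + of_real (- 4 * bump y * (y \<bullet> v)) * P y)) (at (y + 0 *\<^sub>R b))"
    using has_derivative_mult[OF has_derivative_of_real[OF has_derivative_bump_square]
        has_derivative_pd[OF cpoly_differentiable[OF P]], of y] by simp
  ultimately have D: "((\<lambda>t. of_real ((bump (y + t *\<^sub>R b))\<^sup>2) * P (y + t *\<^sub>R b)) has_derivative
      (\<lambda>h. of_real ((bump y)\<^sup>2) * pd (h *\<^sub>R b) P y + of_real (- 4 * bump y * (y \<bullet> (h *\<^sub>R b))) * P y)) (at 0)"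
    by (rule has_derivative_compose)
  have L: "pd (h *\<^sub>R b) P y = h *\<^sub>R pd b P y" for h
    using linear_cmul[OF has_derivative_linear[OF has_derivative_pd[OF cpoly_differentiable[OF P]]]] .
  show "((\<lambda>t. of_real ((bump (y + t *\<^sub>R b))\<^sup>2) * P (y + t *\<^sub>R b)) has_vector_derivative
      of_real ((bump y)\<^sup>2) * pd b P y - 4 * of_real (bump y) * (of_real (y \<bullet> b) * P y)) (at 0)"
    unfolding has_vector_derivative_def
    by (rule has_derivative_eq_rhs[OF D]) (simp add: L fun_eq_iff algebra_simps scaleR_conv_of_real)
qed (use cpoly_continuous_on[OF P] cpoly_continuous_on[OF cpoly_pd[OF P]] b in
    \<open>auto intro!: continuous_intros simp: bump_zero\<close>)

text \<open>Green's identity against \<open>bump\<^sup>2\<close>: the gradient of \<open>bump\<^sup>2\<close> is radial, so Euler's relation applies.\<close>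

lemma hhpoly_orthogonal:
  fixes u v :: "'a::euclidean_space \<Rightarrow> complex"
  assumes u: "hhpoly j u" and v: "hhpoly k v" and "j \<noteq> k"
  shows "(\<integral>y. of_real (bump y) * (u y * v y) \<partial>lborel) = 0"
proof -
  have cu: "cpoly u" and cv: "cpoly v" using u v hpoly_cpoly unfolding hhpoly_def by blast+
  \<comment> \<open>The field u grad v - v grad u: its divergence u lap v - v lap u vanishes, and by
    Euler's relation its product with y is (k - j) u v.\<close>
  define P where "P b = (\<lambda>y. u y * pd b v y - v y * pd b u y)" for b
  have cP: "cpoly (P b)" for b unfolding P_def using cu cv by (intro cpoly_diff cpoly_mult cpoly_pd)
  have pP: "pd b (P b) y = u y * pd b (pd b v) y - v y * pd b (pd b u) y" for b y
  proof -
    have "pd b (P b) y = pd b (\<lambda>y. u y * pd b v y) y - pd b (\<lambda>y. v y * pd b u y) y"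
      unfolding P_def using cu cv by (intro pd_diff cpoly_differentiable cpoly_mult cpoly_pd)
    then show ?thesis using cu cv by (simp add: pd_mult_cpoly cpoly_pd)
  qed
  let ?I = "\<lambda>b y. of_real ((bump y)\<^sup>2) * pd b (P b) y - 4 * of_real (bump y) * (of_real (y \<bullet> b) * P b y)"
  have int: "integrable lborel (?I b)" for b
    by (rule integrable_continuous_support)
      (use cpoly_continuous_on[OF cP] cpoly_continuous_on[OF cpoly_pd[OF cP]] in
        \<open>auto intro!: continuous_intros simp: bump_zero\<close>)
  have eq: "(\<Sum>b\<in>Basis. ?I b y) = 4 * (of_nat j - of_nat k) * (of_real (bump y) * (u y * v y))" for y
  proof -
    have "(\<Sum>b\<in>Basis. ?I b y) = of_real ((bump y)\<^sup>2) * (\<Sum>b\<in>Basis. pd b (P b) y)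
       - 4 * of_real (bump y) * (\<Sum>b\<in>Basis. of_real (y \<bullet> b) * P b y)"
      by (simp add: sum_subtractf sum_distrib_left)
    also have "(\<Sum>b\<in>Basis. pd b (P b) y) = u y * lap v y - v y * lap u y"
      by (simp add: pP lap_def sum_subtractf sum_distrib_left)
    also have "(\<Sum>b\<in>Basis. of_real (y \<bullet> b) * P b y)
       = u y * (\<Sum>b\<in>Basis. of_real (y \<bullet> b) * pd b v y) - v y * (\<Sum>b\<in>Basis. of_real (y \<bullet> b) * pd b u y)"
      unfolding P_def by (simp add: sum_subtractf sum_distrib_left algebra_simps)
    also have "\<dots> = (of_nat k - of_nat j) * (u y * v y)"
    proof -
      have "(\<Sum>b\<in>Basis. of_real (y \<bullet> b) * pd b u y) = of_nat j * u y"
        "(\<Sum>b\<in>Basis. of_real (y \<bullet> b) * pd b v y) = of_nat k * v y"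
        using u v euler_hpoly unfolding hhpoly_def by blast+
      then show ?thesis by (simp only:) (simp add: algebra_simps)
    qed
    finally show ?thesis using u v unfolding hhpoly_def by (simp add: algebra_simps)
  qed
  have "(\<integral>y. (\<Sum>b\<in>Basis. ?I b y) \<partial>lborel) = (\<Sum>b\<in>Basis. \<integral>y. ?I b y \<partial>lborel)"
    using int by (intro Bochner_Integration.integral_sum) auto
  also have "\<dots> = 0" using bump_integration_by_parts[OF cP] by (intro sum.neutral) auto
  finally have "4 * (of_nat j - of_nat k) * (\<integral>y. of_real (bump y) * (u y * v y) \<partial>lborel) = (0::complex)"
    unfolding eq by simp
  then show ?thesis using \<open>j \<noteq> k\<close> by simp
qed

definition bump_mass :: "'a::euclidean_space itself \<Rightarrow> real" where
  "bump_mass _ = integral\<^sup>L lborel (bump :: 'a \<Rightarrow> real)"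

lemma integrable_bump: "integrable lborel (bump :: 'a::euclidean_space \<Rightarrow> real)"
  by (rule integrable_continuous_support) (auto intro!: continuous_intros simp: bump_zero)

lemma bump_mass_pos: "bump_mass TYPE('a::euclidean_space) > 0"
proof -
  have "bump_mass TYPE('a) \<noteq> 0"
  proof
    assume "bump_mass TYPE('a) = 0"
    then have "AE y in lborel. bump (y::'a) = 0"
      unfolding bump_mass_def using integral_nonneg_eq_0_iff_AE[OF integrable_bump[where 'a='a]] by (simp add: bump_nonneg)
    then have "AE y in lborel. (y::'a) \<notin> ball 0 1"
    proof (rule AE_mp, intro AE_I2 impI)
      fix y :: 'a assume "bump y = 0"
      then show "y \<notin> ball 0 1" using bump_pos_iff[of y] by auto
    qed
    then have "emeasure lborel (ball (0::'a) 1) = 0"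
      by (subst (asm) AE_iff_measurable[where N="ball 0 1"]) auto
    then show False using content_ball_pos[of 1 "0::'a"] by (simp add: measure_def)
  qed
  moreover have "bump_mass TYPE('a) \<ge> 0"
    unfolding bump_mass_def by (simp add: bump_nonneg)
  ultimately show ?thesis by linarith
qed

text \<open>Orthogonality to the constant 1, of degree 0, removes all components of positive degree;
  these also vanish at the origin.\<close>

lemma hhsum_mean_value_zero:
  fixes q :: "'a::euclidean_space \<Rightarrow> complex"
  assumes q: "hhsum q h K"
  shows "(\<integral>y. of_real (bump y) * q y \<partial>lborel) = of_real (bump_mass TYPE('a)) * q 0"
proof -
  have h: "hhpoly j (h j)" for j using q unfolding hhsum_def by blast
  have h0: "h j 0 = 0" if "j > 0" for j
    using hpoly_homogeneous[of j "h j" 0 0] h[of j] that unfolding hhpoly_def by (auto simp: power_0_left)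
  have one: "hhpoly 0 (\<lambda>x::'a. 1)" using hpoly_const[of 1] lap_hpoly_less_2 unfolding hhpoly_def by fastforce
  have ij: "(\<integral>y. of_real (bump y) * h j y \<partial>lborel) = of_real (bump_mass TYPE('a)) * h j 0" for j
  proof (cases "j = 0")
    case True
    have "h 0 y = h 0 0" for y using hpoly_0_const h[of 0] unfolding hhpoly_def by blast
    then have "(\<integral>y. of_real (bump y) * h j y \<partial>lborel) = (\<integral>y. of_real (bump y) * h 0 0 \<partial>(lborel :: 'a measure))"
      using True by metis
    also have "\<dots> = of_real (bump_mass TYPE('a)) * h 0 0"
      by (simp add: bump_mass_def)
    finally show ?thesis using True by simp
  next
    case False
    then show ?thesis using hhpoly_orthogonal[OF h[of j] one] h0[of j] by simp
  qed
  have qe: "q y = (\<Sum>j<K. h j y)" for y using q unfolding hhsum_def by blast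
  have "(\<integral>y. of_real (bump y) * q y \<partial>lborel) = (\<integral>y. (\<Sum>j<K. of_real (bump y) * h j y) \<partial>lborel)"
    by (simp add: qe sum_distrib_left)
  also have "\<dots> = (\<Sum>j<K. of_real (bump_mass TYPE('a)) * h j 0)"
    using h hpoly_cpoly unfolding hhpoly_def
    by (subst Bochner_Integration.integral_sum) (auto simp: ij intro!: integrable_bump_cpoly)
  finally show ?thesis by (simp add: qe sum_distrib_left)
qed

text \<open>The homogeneous components of a harmonic polynomial are harmonic since their Laplacians have
  different degrees.\<close>

lemma harmonic_cpoly_hhsum:
  fixes p :: "'a::euclidean_space \<Rightarrow> complex"
  assumes p: "cpoly p" and lap: "\<And>x. lap p x = 0"
  shows "\<exists>h K. hhsum p h K"
proof -
  from cpoly_hpoly_sum[OF p] obtain h K where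
    h: "\<And>j. hpoly j (h j)" "\<And>x. p x = (\<Sum>j<(K::nat). h j x)" by blast
  define h' where "h' j = (if j < K then h j else (\<lambda>x. 0))" for j
  have h': "hpoly j (h' j)" for j unfolding h'_def using h by (simp add: hpoly_zero)
  have ph': "p x = (\<Sum>j<K. h' j x)" for x by (simp add: h h'_def)
  have "lap p = (\<lambda>x. \<Sum>j<K. lap (h' j) x)"
    unfolding ph'[abs_def] using h' hpoly_cpoly by (intro lap_sum) blast
  then have z: "(\<Sum>j<K. lap (h' j) x) = 0" for x using lap by metis
  have low: "lap (h' j) = (\<lambda>x. 0)" if "j < 2" for j using lap_hpoly_less_2[OF h' that] .
  have high: "lap (h' j) = (\<lambda>x. 0)" if "j \<ge> K" for j
    using that unfolding h'_def lap_def[abs_def] by (simp add: pd_const_fun)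
  \<comment> \<open>The shift by 2 matches index and degree: \<open>lap (h' (j + 2))\<close> is
    homogeneous of degree \<open>j\<close>, so the vanishing sum separates. Components of degree
    below 2 have Laplacian zero anyway.\<close>
  have "lap (h' (j + 2)) x = 0" for j x
  proof (rule homogeneous_sums_zero[of "\<lambda>j. lap (h' (j + 2))"])
    show "lap (h' (j + 2)) (c *\<^sub>R x) = of_real (c ^ j) * lap (h' (j + 2)) x" for j c x
      using hpoly_homogeneous[OF hpoly_lap[OF h'[of "j + 2"]]] by simp
    fix x
    have "(\<lambda>j. lap (h' j) x) sums (\<Sum>j<K. lap (h' j) x)"
      by (rule sums_finite) (use high in \<open>auto simp: not_less\<close>)
    then have "(\<lambda>j. lap (h' j) x) sums 0" by (simp add: z)
    from sums_split_initial_segment[OF this, of 2] show "(\<lambda>j. lap (h' (j + 2)) x) sums 0"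
      using low[of 0] low[of 1] by (simp add: numeral_2_eq_2)
  qed
  then have "lap (h' j) x = 0" for j x
    using low[of j] by (cases "j < 2") (simp, metis add.commute le_add_diff_inverse not_less)
  then have "hhsum p h' K" unfolding hhsum_def hhpoly_def using h' ph' by (auto simp: h'_def)
  then show ?thesis by blast
qed

text \<open>Translation and dilation preserve harmonicity, so q(x + r y) is again a sum of
  homogeneous harmonic polynomials in y, with value q(x) at the origin.\<close>

lemma hhsum_mean_value:
  fixes q :: "'a::euclidean_space \<Rightarrow> complex"
  assumes "hhsum q h K"
  shows "(\<integral>y. of_real (bump y) * q (x + r *\<^sub>R y) \<partial>lborel) = of_real (bump_mass TYPE('a)) * q x"
proof -
  have "cpoly q" using assms hhsum_cpoly by blast
  then have "cpoly (\<lambda>y. q (x + r *\<^sub>R y))" "lap (\<lambda>y. q (x + r *\<^sub>R y)) y = 0" for y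
    using lap_hhsum[OF assms] by (simp_all add: cpoly_affine lap_affine)
  from harmonic_cpoly_hhsum[OF this] obtain g L where "hhsum (\<lambda>y. q (x + r *\<^sub>R y)) g L" by blast
  from hhsum_mean_value_zero[OF this] show ?thesis by simp
qed

section \<open>Homogeneous expansions\<close>

lemma integral_affine:
  fixes f :: "'a::euclidean_space \<Rightarrow> 'b::{banach, second_countable_topology}"
  assumes [measurable]: "f \<in> borel_measurable borel" and c: "c \<noteq> 0"
  shows "(\<integral>z. f z \<partial>lborel) = \<bar>c\<bar> ^ DIM('a) *\<^sub>R (\<integral>y. f (t + c *\<^sub>R y) \<partial>lborel)"
proof -
  have "(\<integral>z. f z \<partial>lborel) = (\<integral>z. f z \<partial>density (distr lborel borel (\<lambda>x. t + c *\<^sub>R x)) (\<lambda>_. ennreal (\<bar>c\<bar> ^ DIM('a))))"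
    using lborel_affine[OF c, of t] by (simp add: ennreal_power)
  also have "\<dots> = (\<integral>z. (\<bar>c\<bar> ^ DIM('a)) *\<^sub>R f z \<partial>distr lborel borel (\<lambda>x. t + c *\<^sub>R x))"
    by (rule integral_density) auto
  also have "\<dots> = \<bar>c\<bar> ^ DIM('a) *\<^sub>R (\<integral>y. f (t + c *\<^sub>R y) \<partial>lborel)"
    by (subst integral_distr) auto
  finally show ?thesis .
qed

text \<open>Stands in for the Cauchy--Schwarz inequality wherever a first power is estimated by a
  square.\<close>

lemma half_square_bound: "(x::real) \<le> (1 + x\<^sup>2) / 2"
  using zero_le_power2[of "x - 1"] by (simp add: power2_eq_square algebra_simps)

text \<open>Bessel's inequality on the ball of radius \<open>r\<close>. Orthogonality expresses the
  left side E as the weighted inner product of the component with q; as |q| \<le> 1,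
  \<open>half_square_bound\<close> gives E \<le> (mass + E) / 2, in which E is absorbed.\<close>

lemma hhsum_component_L2:
  fixes q :: "'a::euclidean_space \<Rightarrow> complex"
  assumes q: "hhsum q h K" and r: "r > 0" and bd: "\<And>x. norm x \<le> r \<Longrightarrow> norm (q x) \<le> 1"
  shows "(\<integral>y. bump y * (norm (h k (r *\<^sub>R y)))\<^sup>2 \<partial>lborel) \<le> bump_mass TYPE('a)"
proof -
  define H where "H j y = of_real (r ^ j) * h j y" for j y
  have h: "hhpoly j (h j)" for j using q unfolding hhsum_def by blast
  have H: "hhpoly j (H j)" for j unfolding H_def[abs_def] using h by (rule hhpoly_cmult)
  have Heq: "h j (r *\<^sub>R y) = H j y" for j y
    unfolding H_def using h hpoly_homogeneous unfolding hhpoly_def by blast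
  have cH: "cpoly (H j)" for j using H hpoly_cpoly unfolding hhpoly_def by blast
  have qe: "q (r *\<^sub>R y) = (\<Sum>j<K. H j y)" for y using q Heq unfolding hhsum_def by simp
  have cq: "cpoly q" using hhsum_cpoly[OF q] .
  have contH: "continuous_on UNIV (H k)" using cpoly_continuous_on[OF cH] .
  have contq: "continuous_on UNIV (\<lambda>y. q (r *\<^sub>R y))"
    using cpoly_continuous_on[OF cpoly_affine[OF cq, of 0 r]] by simp
  define E where "E = (\<integral>y. bump y * (norm (H k y))\<^sup>2 \<partial>lborel)"
  have E0: "E \<ge> 0" unfolding E_def by (intro Bochner_Integration.integral_nonneg) (simp add: bump_nonneg)
  have intE: "integrable lborel (\<lambda>y. bump y * (norm (H k y))\<^sup>2)"
    by (rule integrable_continuous_support) (use contH in \<open>auto intro!: continuous_intros simp: bump_zero\<close>)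
  have kz: "H k = (\<lambda>x. 0)" if "\<not> k < K" using that q unfolding hhsum_def H_def[abs_def] by auto
  have "of_real E = (\<integral>y. of_real (bump y) * (H k y * cnj (H k y)) \<partial>lborel)"
    unfolding E_def integral_complex_of_real[symmetric]
    by (intro Bochner_Integration.integral_cong refl) (simp add: complex_norm_square[symmetric])
  \<comment> \<open>The terms with j \<noteq> k contribute nothing, so the remaining components may
    be added to complete q.\<close>
  also have "\<dots> = (\<integral>y. (\<Sum>j<K. of_real (bump y) * (H k y * cnj (H j y))) \<partial>lborel)"
  proof (cases "k < K")
    case True
    have "(\<integral>y. (\<Sum>j<K. of_real (bump y) * (H k y * cnj (H j y))) \<partial>lborel)
        = (\<Sum>j<K. \<integral>y. of_real (bump y) * (H k y * cnj (H j y)) \<partial>lborel)"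
      by (intro Bochner_Integration.integral_sum integrable_bump_cpoly cpoly_mult cpoly_cnj cH)
    also have "\<dots> = (\<Sum>j<K. if j = k then \<integral>y. of_real (bump y) * (H k y * cnj (H k y)) \<partial>lborel else 0)"
      using hhpoly_orthogonal[OF H[of k] hhpoly_cnj[OF H]] by (intro sum.cong) auto
    finally show ?thesis using True by simp
  next
    case False
    then show ?thesis using kz by simp
  qed
  also have "\<dots> = (\<integral>y. of_real (bump y) * (H k y * cnj (q (r *\<^sub>R y))) \<partial>lborel)"
    by (simp add: qe sum_distrib_left)
  finally have "E = norm (\<integral>y. of_real (bump y) * (H k y * cnj (q (r *\<^sub>R y))) \<partial>lborel)"
    using E0 by (metis abs_of_nonneg norm_of_real)
  also have "\<dots> \<le> (\<integral>y. norm (of_real (bump y) * (H k y * cnj (q (r *\<^sub>R y)))) \<partial>lborel)"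
    by (rule integral_norm_bound)
  also have "\<dots> \<le> (\<integral>y. (bump y + bump y * (norm (H k y))\<^sup>2) / 2 \<partial>lborel)"
  proof (rule Bochner_Integration.integral_mono)
    show "integrable lborel (\<lambda>y. norm (of_real (bump y) * (H k y * cnj (q (r *\<^sub>R y)))))"
      by (rule integrable_continuous_support) (use contH contq in \<open>auto intro!: continuous_intros simp: bump_zero\<close>)
    show "integrable lborel (\<lambda>y. (bump y + bump y * (norm (H k y))\<^sup>2) / 2)"
      using intE integrable_bump[where 'a='a] by simp
    fix y :: 'a
    show "norm (of_real (bump y) * (H k y * cnj (q (r *\<^sub>R y)))) \<le> (bump y + bump y * (norm (H k y))\<^sup>2) / 2"
    proof (cases "norm y \<le> 1")
      case True
      have "norm (q (r *\<^sub>R y)) \<le> 1" using True r by (intro bd) simp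
      then have "norm (H k y) * norm (q (r *\<^sub>R y)) \<le> norm (H k y)" by (simp add: mult_left_le)
      also have "\<dots> \<le> (1 + (norm (H k y))\<^sup>2) / 2" by (rule half_square_bound)
      finally have "bump y * (norm (H k y) * norm (q (r *\<^sub>R y))) \<le> bump y * ((1 + (norm (H k y))\<^sup>2) / 2)"
        by (intro mult_left_mono bump_nonneg)
      then show ?thesis by (simp add: norm_mult bump_nonneg algebra_simps)
    qed (simp add: bump_zero)
  qed
  also have "\<dots> = (bump_mass TYPE('a) + E) / 2"
    unfolding E_def bump_mass_def using intE integrable_bump[where 'a='a] by simp
  finally show ?thesis unfolding Heq E_def by simp
qed

text \<open>The mean over the ball of radius rho = (1 - t) / 2 about \<open>x\<close> is compared
  with the weighted mean square over the unit ball. The small ball lies within radius (1 + t) / 2,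
  where \<open>bump\<close> is at least 1 - ((1 + t) / 2)^2; the reciprocal of this is one factor of
  the constant, and rescaling the small ball gives the other, rho^-n.\<close>

lemma hhsum_component_sup:
  fixes q :: "'a::euclidean_space \<Rightarrow> complex"
  assumes q: "hhsum q h K" and r: "r > 0" and bd: "\<And>x. norm x \<le> r \<Longrightarrow> norm (q x) \<le> 1"
    and t: "0 < t" "t < 1" and x: "norm x \<le> t"
  shows "norm (h k (r *\<^sub>R x)) \<le> (1 + (1 / ((1 - t) / 2) ^ DIM('a)) * (1 / (1 - ((1 + t) / 2)\<^sup>2))) / 2"
proof -
  define rho where "rho = (1 - t) / 2"
  define A where "A = 1 / (1 - ((1 + t) / 2)\<^sup>2)"
  have rho: "rho > 0" using t by (simp add: rho_def)
  have "((1 + t) / 2)\<^sup>2 < 1" using t abs_square_less_1[of "(1 + t) / 2"] by simp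
  then have A: "A > 0" by (simp add: A_def)
  have h: "hhpoly k (h k)" using q unfolding hhsum_def by blast
  have hs: "hhsum (h k) (\<lambda>j. if j = k then h k else (\<lambda>x. 0)) (Suc k)" using hhsum_single[OF h] .
  have ch: "cpoly (h k)" using h hpoly_cpoly unfolding hhpoly_def by blast
  define H where "H y = h k (r *\<^sub>R y)" for y
  have cH: "cpoly H" unfolding H_def[abs_def] using cpoly_affine[OF ch, of 0 r] by simp
  have contH: "continuous_on UNIV H" using cpoly_continuous_on[OF cH] .
  have contH': "continuous_on UNIV (\<lambda>y. H (x + rho *\<^sub>R y))" using cpoly_continuous_on[OF cpoly_affine[OF cH]] .
  have lap: "lap H y = 0" for y
    unfolding H_def[abs_def] using lap_affine[OF ch, of 0 r] h unfolding hhpoly_def by simp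
  from harmonic_cpoly_hhsum[OF cH lap] obtain g L where "hhsum H g L" by blast
  from hhsum_mean_value[OF this, of x rho]
  have "of_real (bump_mass TYPE('a)) * H x = (\<integral>y. of_real (bump y) * H (x + rho *\<^sub>R y) \<partial>lborel)" by simp
  then have "bump_mass TYPE('a) * norm (H x) = norm (\<integral>y. of_real (bump y) * H (x + rho *\<^sub>R y) \<partial>lborel)"
    using bump_mass_pos[where 'a='a] by (metis abs_of_pos norm_mult norm_of_real)
  also have "\<dots> \<le> (\<integral>y. norm (of_real (bump y) * H (x + rho *\<^sub>R y)) \<partial>lborel)" by (rule integral_norm_bound)
  also have "\<dots> \<le> (\<integral>y. (bump y + bump y * (norm (H (x + rho *\<^sub>R y)))\<^sup>2) / 2 \<partial>lborel)"
  proof (rule Bochner_Integration.integral_mono)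
    show "integrable lborel (\<lambda>y. norm (of_real (bump y) * H (x + rho *\<^sub>R y)))"
      by (rule integrable_continuous_support) (use contH' in \<open>auto intro!: continuous_intros simp: bump_zero\<close>)
    show "integrable lborel (\<lambda>y. (bump y + bump y * (norm (H (x + rho *\<^sub>R y)))\<^sup>2) / 2)"
      by (rule integrable_continuous_support) (use contH' in \<open>auto intro!: continuous_intros simp: bump_zero\<close>)
    fix y :: 'a
    have "bump y * norm (H (x + rho *\<^sub>R y)) \<le> bump y * ((1 + (norm (H (x + rho *\<^sub>R y)))\<^sup>2) / 2)"
      by (intro mult_left_mono bump_nonneg half_square_bound)
    then show "norm (of_real (bump y) * H (x + rho *\<^sub>R y)) \<le> (bump y + bump y * (norm (H (x + rho *\<^sub>R y)))\<^sup>2) / 2"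
      by (simp add: norm_mult bump_nonneg algebra_simps)
  qed
  also have "\<dots> = (bump_mass TYPE('a) + (\<integral>y. bump y * (norm (H (x + rho *\<^sub>R y)))\<^sup>2 \<partial>lborel)) / 2"
  proof -
    have "integrable lborel (\<lambda>y. bump y * (norm (H (x + rho *\<^sub>R y)))\<^sup>2)"
      by (rule integrable_continuous_support) (use contH' in \<open>auto intro!: continuous_intros simp: bump_zero\<close>)
    then show ?thesis unfolding bump_mass_def using integrable_bump[where 'a='a] by simp
  qed
  also have "(\<integral>y. bump y * (norm (H (x + rho *\<^sub>R y)))\<^sup>2 \<partial>lborel)
      = (1 / rho ^ DIM('a)) * (\<integral>z. bump ((1 / rho) *\<^sub>R (z - x)) * (norm (H z))\<^sup>2 \<partial>lborel)"
  proof -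
    have "(\<integral>z. bump ((1 / rho) *\<^sub>R (z - x)) * (norm (H z))\<^sup>2 \<partial>lborel)
       = \<bar>rho\<bar> ^ DIM('a) *\<^sub>R (\<integral>y. bump ((1 / rho) *\<^sub>R ((x + rho *\<^sub>R y) - x)) * (norm (H (x + rho *\<^sub>R y)))\<^sup>2 \<partial>lborel)"
      using contH rho by (intro integral_affine borel_measurable_continuous_onI continuous_intros) auto
    then show ?thesis using rho by simp
  qed
  also have "(\<integral>z. bump ((1 / rho) *\<^sub>R (z - x)) * (norm (H z))\<^sup>2 \<partial>lborel)
      \<le> (\<integral>z. A * (bump z * (norm (H z))\<^sup>2) \<partial>lborel)"
  proof (rule Bochner_Integration.integral_mono)
    have far: "bump ((1 / rho) *\<^sub>R (z - x)) = 0" if "norm z > (1 + t) / 2" for z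
    proof -
      have "rho \<le> norm (z - x)" using that x norm_triangle_ineq2[of z x] by (simp add: rho_def field_simps)
      then have "1 \<le> norm ((1 / rho) *\<^sub>R (z - x))"
        unfolding norm_scaleR using rho by (simp add: divide_simps)
      then show ?thesis by (rule bump_zero)
    qed
    show "integrable lborel (\<lambda>z. bump ((1 / rho) *\<^sub>R (z - x)) * (norm (H z))\<^sup>2)"
      by (rule integrable_continuous_support) (use contH far t in \<open>auto intro!: continuous_intros\<close>)
    show "integrable lborel (\<lambda>z. A * (bump z * (norm (H z))\<^sup>2))"
      by (rule integrable_continuous_support) (use contH in \<open>auto intro!: continuous_intros simp: bump_zero\<close>)
    fix z :: 'a
    have "bump ((1 / rho) *\<^sub>R (z - x)) \<le> A * bump z"
    proof (cases "norm z > (1 + t) / 2")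
      case True
      then show ?thesis using far A bump_nonneg[of z] by simp
    next
      case False
      then have "(norm z)\<^sup>2 \<le> ((1 + t) / 2)\<^sup>2" by (intro power_mono) auto
      moreover have "bump z = 1 - (norm z)\<^sup>2" using False t by (intro bump_eq) auto
      ultimately have "1 - ((1 + t) / 2)\<^sup>2 \<le> bump z" by simp
      then have "A * (1 - ((1 + t) / 2)\<^sup>2) \<le> A * bump z" using A by (intro mult_left_mono) auto
      then have "1 \<le> A * bump z" using A by (simp add: A_def)
      then show ?thesis using bump_le_1 order_trans by blast
    qed
    then have "bump ((1 / rho) *\<^sub>R (z - x)) * (norm (H z))\<^sup>2 \<le> (A * bump z) * (norm (H z))\<^sup>2"
      by (intro mult_right_mono) auto
    then show "bump ((1 / rho) *\<^sub>R (z - x)) * (norm (H z))\<^sup>2 \<le> A * (bump z * (norm (H z))\<^sup>2)"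
      by (simp add: mult.assoc)
  qed
  also have "(\<integral>z. A * (bump z * (norm (H z))\<^sup>2) \<partial>lborel) \<le> A * bump_mass TYPE('a)"
    using hhsum_component_L2[OF q r bd, of k] A by (simp add: H_def)
  finally have "bump_mass TYPE('a) * norm (H x)
      \<le> (bump_mass TYPE('a) + 1 / rho ^ DIM('a) * (A * bump_mass TYPE('a))) / 2"
    using rho by (simp add: divide_right_mono)
  also have "\<dots> = bump_mass TYPE('a) * ((1 + 1 / rho ^ DIM('a) * A) / 2)" by (simp add: algebra_simps)
  finally show ?thesis
    using bump_mass_pos[where 'a='a] unfolding H_def rho_def A_def by (simp only: mult_le_cancel_left_pos)
qed

text \<open>Scaling reduces to M = 1, and homogeneity transports the estimate from the sphere of
  radius r t to all \<open>x\<close>. The constant depends on \<open>t\<close> and the dimension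
  alone, neither on the degree nor on the polynomial.\<close>

lemma hhsum_component_bound:
  assumes t: "0 < t" "t < (1::real)"
  obtains C where "C > 0" "\<And>(q :: 'a::euclidean_space \<Rightarrow> complex) h K r M k x.
    \<lbrakk>hhsum q h K; r > 0; M > 0; \<And>x. norm x \<le> r \<Longrightarrow> norm (q x) \<le> M\<rbrakk>
    \<Longrightarrow> norm (h k x) * (r * t) ^ k \<le> C * M * norm x ^ k"
proof -
  define C where "C = (1 + (1 / ((1 - t) / 2) ^ DIM('a)) * (1 / (1 - ((1 + t) / 2)\<^sup>2))) / 2"
  have "((1 + t) / 2)\<^sup>2 < 1" using t abs_square_less_1[of "(1 + t) / 2"] by simp
  then have C: "C > 0" unfolding C_def using t by (intro divide_pos_pos add_pos_pos mult_pos_pos) auto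
  moreover have "norm (h k x) * (r * t) ^ k \<le> C * M * norm x ^ k"
    if q: "hhsum q h K" and r: "r > 0" and M: "M > 0" and bd: "\<And>x. norm x \<le> r \<Longrightarrow> norm (q x) \<le> M"
    for q :: "'a \<Rightarrow> complex" and h K r M k x
  proof -
    have q': "hhsum (\<lambda>x. of_real (1 / M) * q x) (\<lambda>j x. of_real (1 / M) * h j x) K"
      using hhsum_cmult[OF q] .
    have *: "norm (h k (r *\<^sub>R y)) \<le> C * M" if "norm y \<le> t" for y
      using hhsum_component_sup[OF q' r _ t that, of k] bd M
      unfolding C_def[symmetric] by (simp add: norm_mult norm_divide field_simps)
    have h: "hpoly k (h k)" using q unfolding hhsum_def hhpoly_def by blast
    show ?thesis
    proof (cases "x = 0")
      case True
      have "norm (h k (r *\<^sub>R 0)) \<le> C * M" using *[of 0] t by simp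
      moreover have "h k 0 = 0" if "k > 0" using hpoly_homogeneous[OF h, of 0 0] that by (auto simp: power_0_left)
      ultimately show ?thesis using True by (cases "k = 0") auto
    next
      case False
      have "norm (h k (r *\<^sub>R ((t / norm x) *\<^sub>R x))) \<le> C * M" using False t by (intro *) simp
      also have "h k (r *\<^sub>R ((t / norm x) *\<^sub>R x)) = of_real ((r * t / norm x) ^ k) * h k x"
        using hpoly_homogeneous[OF h, of "r * t / norm x" x] by simp
      finally have "(r * t / norm x) ^ k * norm (h k x) \<le> C * M"
        using r t by (simp add: norm_mult norm_power norm_divide)
      then show ?thesis using False by (simp add: power_divide field_simps)
    qed
  qed
  ultimately show thesis by (rule that)
qed


section \<open>Finite-dimensional function spaces and pointwise limits\<close>

inductive fspan :: "('x \<Rightarrow> complex) set \<Rightarrow> ('x \<Rightarrow> complex) \<Rightarrow> bool" for M where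
  fspan_zero: "fspan M (\<lambda>x. 0)"
| fspan_step: "fspan M p \<Longrightarrow> m \<in> M \<Longrightarrow> fspan M (\<lambda>x. p x + c * m x)"

lemma fspan_base: "m \<in> M \<Longrightarrow> fspan M m"
  using fspan_step[OF fspan_zero, of m M 1] by simp

lemma fspan_add: "fspan M q \<Longrightarrow> fspan M p \<Longrightarrow> fspan M (\<lambda>x. p x + q x)"
proof (induction rule: fspan.induct)
  case (fspan_step q m c)
  from fspan.fspan_step[OF fspan_step(3)[OF fspan_step(4)] fspan_step(2), of c]
  show ?case by (simp add: add.assoc)
qed simp

lemma fspan_cmult: "fspan M p \<Longrightarrow> fspan M (\<lambda>x. a * p x)"
proof (induction rule: fspan.induct)
  case (fspan_step p m c)
  from fspan.fspan_step[OF fspan_step(3,2), of "a * c"] show ?case by (simp add: algebra_simps)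
qed (simp add: fspan_zero)

lemma fspan_lincomb: "fspan M p \<Longrightarrow> fspan M q \<Longrightarrow> fspan M (\<lambda>x. a * p x + b * q x)"
  by (intro fspan_add fspan_cmult)

lemma fspan_sum: "(\<And>i. i \<in> I \<Longrightarrow> fspan M (p i)) \<Longrightarrow> fspan M (\<lambda>x. \<Sum>i\<in>I. p i x)"
  by (induction I rule: infinite_finite_induct) (auto intro: fspan_zero fspan_add)

lemma fspan_mono: "fspan M p \<Longrightarrow> M \<subseteq> N \<Longrightarrow> fspan N p"
  by (induction rule: fspan.induct) (auto intro: fspan.intros)

lemma fspan_insertE:
  assumes "fspan (insert m0 M) p"
  obtains p' c where "fspan M p'" "p = (\<lambda>x. p' x + c * m0 x)"
proof -
  from assms have "\<exists>p' c. fspan M p' \<and> p = (\<lambda>x. p' x + c * m0 x)"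
  proof (induction rule: fspan.induct)
    case fspan_zero
    show ?case by (intro exI[of _ "\<lambda>x. 0"] exI[of _ 0]) (simp add: fspan.fspan_zero)
  next
    case (fspan_step p m c)
    then obtain p' d where p': "fspan M p'" "p = (\<lambda>x. p' x + d * m0 x)" by blast
    show ?case
    proof (cases "m = m0")
      case True
      then have "(\<lambda>x. p x + c * m x) = (\<lambda>x. p' x + (d + c) * m0 x)"
        using p' by (simp add: algebra_simps)
      then show ?thesis using p'(1) by blast
    next
      case False
      then have "fspan M (\<lambda>x. p' x + c * m x)" using p' fspan_step by (auto intro: fspan.fspan_step)
      moreover have "(\<lambda>x. p x + c * m x) = (\<lambda>x. (p' x + c * m x) + d * m0 x)"
        using p' by (simp add: algebra_simps)
      ultimately show ?thesis by blast
    qed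
  qed
  then show thesis using that by blast
qed

text \<open>Coordinates on a finite-dimensional space of functions are given by evaluation at finitely many points,
  so the space is closed under pointwise limits.\<close>

lemma fspan_interpolation:
  fixes M :: "('x \<Rightarrow> complex) set"
  assumes "finite M"
  shows "\<exists>Z L. finite Z \<and> (\<forall>z\<in>Z. fspan M (L z)) \<and>
    (\<forall>p x. fspan M p \<longrightarrow> p x = (\<Sum>z\<in>Z. p z * L z x))"
  using assms
proof (induction M rule: finite_induct)
  case empty
  have "p = (\<lambda>x. 0)" if "fspan {} p" for p :: "'x \<Rightarrow> complex"
    using that by (induction rule: fspan.induct) auto
  then show ?case by (intro exI[of _ "{}"]) auto
next
  case (insert m0 M)
  from insert.IH obtain Z L where Z: "finite Z" "\<And>z. z \<in> Z \<Longrightarrow> fspan M (L z)"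
    and rep: "\<And>p x. fspan M p \<Longrightarrow> p x = (\<Sum>z\<in>Z. p z * L z x)"
    by blast
  have S_m0: "fspan (insert m0 M) m0" by (simp add: fspan_base)
  have S_mono: "fspan (insert m0 M) p" if "fspan M p" for p using fspan_mono[OF that] by blast
  have Zsum: "fspan (insert m0 M) (\<lambda>x. \<Sum>z\<in>Z. a z * L z x)" for a
    by (intro fspan_sum fspan_cmult S_mono Z(2))
  \<comment> \<open>The interpolation error of the new generator on the old nodes. If it vanishes
    identically, the old nodes suffice; otherwise a point \<open>w\<close> with
    \<open>e w \<noteq> 0\<close> detects the new direction.\<close>
  define e where "e x = m0 x - (\<Sum>z\<in>Z. m0 z * L z x)" for x
  have Se: "fspan (insert m0 M) e"
    using fspan_lincomb[OF S_m0 Zsum[of m0], of 1 "-1"] by (simp add: e_def[abs_def])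
  have I: ?case if "finite Z'" "\<And>z. z \<in> Z' \<Longrightarrow> fspan (insert m0 M) (L' z)"
    "\<And>p x. fspan (insert m0 M) p \<Longrightarrow> p x = (\<Sum>z\<in>Z'. p z * L' z x)" for Z' L'
    by (intro exI[of _ Z'] exI[of _ L'] conjI ballI allI impI that)
  show ?case
  proof (cases "\<forall>x. e x = 0")
    case True
    have "p x = (\<Sum>z\<in>Z. p z * L z x)" if p: "fspan (insert m0 M) p" for p x
    proof -
      from p obtain p' c where p': "fspan M p'" "p = (\<lambda>x. p' x + c * m0 x)" by (rule fspan_insertE)
      have "m0 x = (\<Sum>z\<in>Z. m0 z * L z x)" using True[rule_format, of x] unfolding e_def by simp
      with rep[OF p'(1), of x] have "p' x + c * m0 x = (\<Sum>z\<in>Z. p' z * L z x) + c * (\<Sum>z\<in>Z. m0 z * L z x)"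
        by metis
      then have "p x = (\<Sum>z\<in>Z. p' z * L z x) + c * (\<Sum>z\<in>Z. m0 z * L z x)"
        unfolding p'(2) .
      also have "\<dots> = (\<Sum>z\<in>Z. p z * L z x)" by (simp add: p'(2) sum_distrib_left sum.distrib algebra_simps)
      finally show ?thesis .
    qed
    then show ?thesis by (intro I[of Z L] Z(1) S_mono Z(2))
  next
    case False
    then obtain w where w: "e w \<noteq> 0" by blast
    \<comment> \<open>The error operator is zero on the old span, hence a multiple of
      \<open>e\<close> on the enlarged one, and evaluation at \<open>w\<close> determines the
      multiple.\<close>
    define R where "R p x = p x - (\<Sum>z\<in>Z. p z * L z x)" for p and x
    have R_e: "R p x = (R p w / e w) * e x" if p: "fspan (insert m0 M) p" for p x
    proof -
      from p obtain p' c where p': "fspan M p'" "p = (\<lambda>x. p' x + c * m0 x)" by (rule fspan_insertE)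
      have "R p y = c * e y" for y
      proof -
        have "(\<Sum>z\<in>Z. p z * L z y) = (\<Sum>z\<in>Z. p' z * L z y) + c * (\<Sum>z\<in>Z. m0 z * L z y)"
          by (simp add: p'(2) sum_distrib_left sum.distrib algebra_simps)
        then show ?thesis unfolding R_def e_def using rep[OF p'(1), of y] p'(2)
          by (simp add: algebra_simps)
      qed
      then show ?thesis using w by simp
    qed
    show ?thesis
    proof (cases "w \<in> Z")
      case True
      text \<open>Then evaluation at \<open>w\<close> already enters; its weight is corrected.\<close>
      define L' where "L' z x = L z x + (((if z = w then 1 else 0) - L z w) / e w) * e x" for z x
      have "p x = (\<Sum>z\<in>Z. p z * L' z x)" if p: "fspan (insert m0 M) p" for p x
      proof -
        have "(\<Sum>z\<in>Z. p z * (if z = w then 1 else 0)) = (\<Sum>z\<in>Z. if z = w then p z else 0)"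
          by (rule sum.cong) auto
        then have "(\<Sum>z\<in>Z. p z * (if z = w then 1 else 0)) = p w" using True Z(1) by simp
        then have "(\<Sum>z\<in>Z. p z * ((if z = w then 1 else 0) - L z w)) = R p w"
          by (simp only: right_diff_distrib sum_subtractf R_def)
        moreover have "(\<Sum>z\<in>Z. p z * L' z x) = (\<Sum>z\<in>Z. p z * L z x)
            + (\<Sum>z\<in>Z. p z * ((if z = w then 1 else 0) - L z w)) / e w * e x"
          unfolding L'_def
          by (simp only: distrib_left sum.distrib sum_divide_distrib sum_distrib_right times_divide_eq_right mult.assoc[symmetric])
        ultimately have "(\<Sum>z\<in>Z. p z * L' z x) = (\<Sum>z\<in>Z. p z * L z x) + R p x"
          using R_e[OF p, of x] by simp
        then show ?thesis by (simp add: R_def)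
      qed
      moreover have "fspan (insert m0 M) (L' z)" if "z \<in> Z" for z
        using fspan_lincomb[OF S_mono[OF Z(2)[OF that]] Se, of 1 "((if z = w then 1 else 0) - L z w) / e w"]
        unfolding L'_def[abs_def] by simp
      ultimately show ?thesis by (intro I[of Z L'] Z(1))
    next
      case False
      define L' where "L' z x = (if z = w then e x / e w else L z x - (L z w / e w) * e x)" for z x
      have "p x = (\<Sum>z\<in>insert w Z. p z * L' z x)" if p: "fspan (insert m0 M) p" for p x
      proof -
        have "(\<Sum>z\<in>insert w Z. p z * L' z x) = p w * (e x / e w) + (\<Sum>z\<in>Z. p z * (L z x - (L z w / e w) * e x))"
          using False Z(1) by (subst sum.insert) (auto simp: L'_def intro!: sum.cong)
        also have "(\<Sum>z\<in>Z. p z * (L z x - (L z w / e w) * e x))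
           = (\<Sum>z\<in>Z. p z * L z x) - (\<Sum>z\<in>Z. p z * L z w) / e w * e x"
          by (simp only: right_diff_distrib sum_subtractf sum_divide_distrib sum_distrib_right times_divide_eq_right mult.assoc[symmetric])
        finally have "(\<Sum>z\<in>insert w Z. p z * L' z x) = (\<Sum>z\<in>Z. p z * L z x) + (R p w / e w) * e x"
          by (simp add: R_def diff_divide_distrib algebra_simps)
        then have "(\<Sum>z\<in>insert w Z. p z * L' z x) = (\<Sum>z\<in>Z. p z * L z x) + R p x"
          using R_e[OF p, of x] by simp
        then show ?thesis by (simp add: R_def)
      qed
      moreover have "fspan (insert m0 M) (L' z)" if z: "z \<in> insert w Z" for z
      proof (cases "z = w")
        case True
        then show ?thesis using fspan_lincomb[OF Se Se, of "1 / e w" 0] unfolding L'_def[abs_def] by simp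
      next
        case False
        then have "z \<in> Z" using z by blast
        then show ?thesis
          using False fspan_lincomb[OF S_mono[OF Z(2)] Se, of z 1 "- (L z w / e w)"]
          unfolding L'_def[abs_def] by simp
      qed
      ultimately show ?thesis using Z(1) by (intro I[of "insert w Z" L']) simp_all
    qed
  qed
qed

text \<open>All ordered products of \<open>k\<close> coordinates: a finite spanning set, which makes
  \<open>hpoly k\<close> finite-dimensional.\<close>

fun monomials :: "nat \<Rightarrow> ('a::euclidean_space \<Rightarrow> complex) set" where
  "monomials 0 = {\<lambda>x. 1}"
| "monomials (Suc k) = (\<lambda>(b, m) x. of_real (x \<bullet> b) * m x) ` (Basis \<times> monomials k)"

lemma finite_monomials: "finite (monomials k)"
  by (induction k) auto

lemma hpoly_monomials: "m \<in> monomials k \<Longrightarrow> hpoly k m"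
  by (induction k arbitrary: m) (auto intro: hpoly.intros)

lemma fspan_monomials_hpoly: "fspan (monomials k) p \<Longrightarrow> hpoly k p"
proof (induction rule: fspan.induct)
  case (fspan_step p m c)
  from hpoly_add[OF fspan_step(3) hpoly_cmult[OF hpoly_monomials[OF fspan_step(2)]]] show ?case .
qed (rule hpoly_zero)

lemma hpoly_fspan_monomials: "hpoly k p \<Longrightarrow> fspan (monomials k) p"
proof (induction rule: hpoly.induct)
  case (hpoly_const c)
  show ?case using fspan_cmult[OF fspan_base[of "\<lambda>x::'a. 1" "monomials 0"], of c] by simp
next
  case (hpoly_coord_mult k p b)
  from hpoly_coord_mult(3) show ?case
  proof (induction rule: fspan.induct)
    case (fspan_step p m c)
    have "(\<lambda>x. of_real (x \<bullet> b) * m x) \<in> monomials (Suc k)" using fspan_step(2) hpoly_coord_mult(2) by auto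
    from fspan.fspan_step[OF fspan_step(3) this, of c] show ?case by (simp add: algebra_simps)
  qed (simp add: fspan_zero)
qed (rule fspan_add)

text \<open>The coefficients are values at fixed nodes, so they converge along with the functions.
  The Laplacian is linear in the coefficients and therefore vanishes in the limit, without any
  convergence of derivatives being assumed.\<close>

lemma hhpoly_limit:
  fixes P :: "'a::euclidean_space \<Rightarrow> complex"
  assumes p: "\<And>i. hhpoly k (p i)" and lim: "\<And>x. (\<lambda>i. p i x) \<longlonglongrightarrow> P x"
  shows "hhpoly k P"
proof -
  obtain Z and L :: "'a \<Rightarrow> 'a \<Rightarrow> complex"
    where Z: "finite Z" "\<And>z. z \<in> Z \<Longrightarrow> fspan (monomials k) (L z)"
    and rep: "\<And>p x. fspan (monomials k) p \<Longrightarrow> p x = (\<Sum>z\<in>Z. p z * L z x)"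
    using fspan_interpolation[OF finite_monomials[of k]] by metis
  have L: "hpoly k (L z)" if "z \<in> Z" for z
    using Z(2)[OF that] by (rule fspan_monomials_hpoly)
  have pe: "p i x = (\<Sum>z\<in>Z. p i z * L z x)" for i x
    using rep hpoly_fspan_monomials p unfolding hhpoly_def by blast
  have "(\<lambda>i. \<Sum>z\<in>Z. p i z * L z x) \<longlonglongrightarrow> (\<Sum>z\<in>Z. P z * L z x)" for x
    by (intro tendsto_sum tendsto_mult tendsto_const lim)
  from LIMSEQ_unique[OF lim this[unfolded pe[symmetric]]] have "P x = (\<Sum>z\<in>Z. P z * L z x)" for x .
  then have P: "P = (\<lambda>x. \<Sum>z\<in>Z. P z * L z x)" by (rule ext)
  have lapsum: "lap (\<lambda>x. \<Sum>z\<in>Z. a z * L z x) x = (\<Sum>z\<in>Z. a z * lap (L z) x)" for a x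
  proof -
    have cL: "cpoly (L z)" if "z \<in> Z" for z using L[OF that] by (rule hpoly_cpoly)
    then have "lap (\<lambda>x. \<Sum>z\<in>Z. a z * L z x) = (\<lambda>x. \<Sum>z\<in>Z. lap (\<lambda>x. a z * L z x) x)"
      by (intro lap_sum cpoly_cmult)
    then show ?thesis using cL by (auto simp: lap_cmult intro!: sum.cong)
  qed
  have z: "(\<Sum>z\<in>Z. p i z * lap (L z) x) = 0" for i x
  proof -
    have "p i = (\<lambda>x. \<Sum>z\<in>Z. p i z * L z x)" using pe by (rule ext)
    from arg_cong[OF this, of "\<lambda>q. lap q x"]
    have "lap (p i) x = (\<Sum>z\<in>Z. p i z * lap (L z) x)" unfolding lapsum .
    then show ?thesis using p[of i] unfolding hhpoly_def by simp
  qed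
  have "(\<lambda>i. \<Sum>z\<in>Z. p i z * lap (L z) x) \<longlonglongrightarrow> (\<Sum>z\<in>Z. P z * lap (L z) x)" for x
    by (intro tendsto_sum tendsto_mult tendsto_const lim)
  then have 0: "(\<Sum>z\<in>Z. P z * lap (L z) x) = 0" for x
    unfolding z by (simp add: LIMSEQ_const_iff)
  have "lap P x = 0" for x
    using arg_cong[OF P, of "\<lambda>q. lap q x"] unfolding lapsum 0 .
  moreover have "hpoly k (\<lambda>x. \<Sum>z\<in>Z. P z * L z x)" by (intro hpoly_sum hpoly_cmult L)
  then have "hpoly k P" by (subst P)
  ultimately show ?thesis unfolding hhpoly_def by blast
qed


text \<open>The bound amounts to |F_k(x)| \<le> C (|x| / r)^k for each r < 1, hence to geometric
  convergence, uniform on compact subsets of the unit ball. It is stated on the components because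
  in this form it survives multipliers of subexponential growth.\<close>

definition expansion :: "(nat \<Rightarrow> 'a::euclidean_space \<Rightarrow> complex) \<Rightarrow> bool" where
  "expansion F \<longleftrightarrow> (\<forall>k. hhpoly k (F k)) \<and>
     (\<forall>r. 0 < r \<and> r < 1 \<longrightarrow> (\<exists>C. \<forall>k x. norm (F k x) * r ^ k \<le> C * norm x ^ k))"

lemma expansion_hom: "expansion F \<Longrightarrow> F k (c *\<^sub>R x) = of_real (c ^ k) * F k x"
  unfolding expansion_def hhpoly_def using hpoly_homogeneous by blast

lemma expansion_bound:
  assumes "expansion F" "0 < r" "r < 1"
  obtains C where "C \<ge> 0" "\<And>k x. norm (F k x) \<le> C * (norm x / r) ^ k"
proof -
  from assms obtain C where C: "\<And>k x. norm (F k x) * r ^ k \<le> C * norm x ^ k"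
    unfolding expansion_def by blast
  have "norm (F k x) \<le> max C 0 * (norm x / r) ^ k" for k x
  proof -
    have "norm (F k x) * r ^ k \<le> C * norm x ^ k" by (rule C)
    also have "\<dots> \<le> max C 0 * norm x ^ k" by (intro mult_right_mono) auto
    finally show ?thesis using assms(2) by (simp add: power_divide field_simps)
  qed
  then show thesis using that[of "max C 0"] by simp
qed

text \<open>Radii below 1 leave room for a second radius: \<open>r = (\<surd>r)\<^sup>2\<close> splits the loss between approximation
  and component estimate.\<close>

lemma harmonic_expansion:
  fixes f :: "'a::euclidean_space \<Rightarrow> complex"
  assumes f: "harmonic_on f (ball 0 1)"
  shows "\<exists>F. expansion F \<and> (\<forall>x\<in>ball 0 1. (\<lambda>k. F k x) sums f x)"
proof -
  define R where "R m = 1 - 1 / real (m + 2)" for m :: nat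
  define e where "e m = 1 / real (Suc m)" for m :: nat
  have e0: "e m > 0" for m by (simp add: e_def)
  have elim: "e \<longlonglongrightarrow> 0" unfolding e_def[abs_def] using LIMSEQ_inverse_real_of_nat by (simp only: inverse_eq_divide)
  have "\<forall>m. \<exists>q h K. hhsum q h K \<and> (\<forall>x. norm x \<le> R m \<longrightarrow> norm (f x - q x) \<le> e m)"
    using harmonic_approx[OF f] e0 by (simp add: R_def)
  then obtain q h K where qh: "\<And>m. hhsum (q m) (h m) (K m)"
    and approx: "\<And>m x. norm x \<le> R m \<Longrightarrow> norm (f x - q m x) \<le> e m"
    by metis
  have hh: "hhpoly k (h m k)" for m k using qh[of m] unfolding hhsum_def by blast
  have ev: "\<exists>N. \<forall>m\<ge>N. r \<le> R m" if "r < 1" for r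
  proof -
    have "(\<lambda>m. 1 - e (Suc m)) \<longlonglongrightarrow> 1 - 0" by (intro tendsto_intros LIMSEQ_Suc elim)
    then have "\<forall>\<^sub>F m in sequentially. r < 1 - e (Suc m)" using that by (intro order_tendstoD(1)) auto
    then show ?thesis unfolding eventually_sequentially R_def e_def by (force simp: less_imp_le)
  qed
  \<comment> \<open>The component estimate is applied to \<open>q m - q l\<close>, which is at most
    \<open>e m + e l\<close> on radius \<open>s\<close>: every component is Cauchy, with a bound
    geometric in \<open>k\<close>.\<close>
  have diffs: "\<exists>C>0. \<exists>N. \<forall>m\<ge>N. \<forall>l\<ge>N. \<forall>k x. norm (h m k x - h l k x) * r ^ k \<le> C * (e m + e l) * norm x ^ k"
    if r: "0 < r" "r < 1" for r
  proof -
    define s where "s = sqrt r"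
    have s: "0 < s" "s < 1" "r = s * s" using r by (simp_all add: s_def)
    obtain C where C: "C > 0" "\<And>(q :: 'a \<Rightarrow> complex) h K r M k x.
      \<lbrakk>hhsum q h K; r > 0; M > 0; \<And>x. norm x \<le> r \<Longrightarrow> norm (q x) \<le> M\<rbrakk>
      \<Longrightarrow> norm (h k x) * (r * s) ^ k \<le> C * M * norm x ^ k"
      using hhsum_component_bound[OF s(1,2), where 'a='a] by blast
    obtain N where N: "\<And>m. m \<ge> N \<Longrightarrow> s \<le> R m" using ev[OF s(2)] by blast
    have "norm (h m k x - h l k x) * r ^ k \<le> C * (e m + e l) * norm x ^ k" if "m \<ge> N" "l \<ge> N" for m l k x
      unfolding s(3)
    proof (rule C(2)[OF hhsum_diff[OF qh qh] s(1)])
      show "e m + e l > 0" using e0[of m] e0[of l] by simp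
      fix x :: 'a assume "norm x \<le> s"
      then have "norm (f x - q m x) \<le> e m" "norm (f x - q l x) \<le> e l"
        using approx N that order_trans by blast+
      moreover have "q m x - q l x = (f x - q l x) - (f x - q m x)" by simp
      ultimately show "norm (q m x - q l x) \<le> e m + e l"
        using norm_triangle_ineq4[of "f x - q l x" "f x - q m x"] by simp
    qed
    then show ?thesis using C(1) by blast
  qed
  have "convergent (\<lambda>m. h m k x)" for k x
  proof -
    obtain C N where C: "C > 0" "\<And>m l k x. m \<ge> N \<Longrightarrow> l \<ge> N \<Longrightarrow>
      norm (h m k x - h l k x) * (1/2) ^ k \<le> C * (e m + e l) * norm x ^ k"
    proof -
      have "(0::real) < 1/2" "(1/2::real) < 1" by auto
      from diffs[OF this] show thesis using that by blast
    qed
    have "Cauchy (\<lambda>m. h m k x)"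
    proof (rule metric_CauchyI)
      fix d :: real assume d: "d > 0"
      define A where "A = C * 2 ^ k * norm x ^ k"
      have A: "A \<ge> 0" using C by (simp add: A_def)
      have "(\<lambda>m. A * (2 * e m)) \<longlonglongrightarrow> A * (2 * 0)" by (intro tendsto_intros elim)
      then have "\<forall>\<^sub>F m in sequentially. A * (2 * e m) < d" using d by (intro order_tendstoD(2)) auto
      then obtain N' where N': "\<And>m. m \<ge> N' \<Longrightarrow> A * (2 * e m) < d" unfolding eventually_sequentially by blast
      show "\<exists>M. \<forall>m\<ge>M. \<forall>n\<ge>M. dist (h m k x) (h n k x) < d"
      proof (intro exI allI impI)
        fix m l assume ml: "max N N' \<le> m" "max N N' \<le> l"
        have "norm (h m k x - h l k x) \<le> A * (e m + e l)"
          using C(2)[of m l k x] ml by (simp add: A_def power_divide field_simps)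
        also have "\<dots> < d" using N'[of m] N'[of l] ml by (simp add: algebra_simps)
        finally show "dist (h m k x) (h l k x) < d" by (simp add: dist_norm)
      qed
    qed
    then show ?thesis by (simp add: Cauchy_convergent_iff)
  qed
  then obtain F where F: "\<And>k x. (\<lambda>m. h m k x) \<longlonglongrightarrow> F k x" unfolding convergent_def by metis
  \<comment> \<open>Letting \<open>l\<close> tend to infinity in \<open>diffs\<close> gives one
    bound for all degrees, which can be summed over \<open>k\<close>.\<close>
  have bnd: "\<exists>C>0. \<exists>N. \<forall>m\<ge>N. \<forall>k x. norm (h m k x - F k x) * r ^ k \<le> C * e m * norm x ^ k"
    if r: "0 < r" "r < 1" for r
  proof -
    obtain C N where C: "C > 0" "\<And>m l k x. m \<ge> N \<Longrightarrow> l \<ge> N \<Longrightarrow>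
      norm (h m k x - h l k x) * r ^ k \<le> C * (e m + e l) * norm x ^ k"
      using diffs[OF r] by blast
    have "norm (h m k x - F k x) * r ^ k \<le> C * e m * norm x ^ k" if m: "m \<ge> N" for m k x
    proof (rule LIMSEQ_le)
      show "(\<lambda>l. norm (h m k x - h l k x) * r ^ k) \<longlonglongrightarrow> norm (h m k x - F k x) * r ^ k"
        by (intro tendsto_intros F)
      have "(\<lambda>l. C * (e m + e l) * norm x ^ k) \<longlonglongrightarrow> C * (e m + 0) * norm x ^ k"
        by (intro tendsto_intros elim)
      then show "(\<lambda>l. C * (e m + e l) * norm x ^ k) \<longlonglongrightarrow> C * e m * norm x ^ k" by simp
      show "\<exists>N. \<forall>l\<ge>N. norm (h m k x - h l k x) * r ^ k \<le> C * (e m + e l) * norm x ^ k"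
        using C(2) m by blast
    qed
    then show ?thesis using C(1) by blast
  qed
  have expF: "expansion F"
    unfolding expansion_def
  proof (intro conjI allI impI)
    show "hhpoly k (F k)" for k using hhpoly_limit[OF hh F] .
    fix r :: real assume r: "0 < r \<and> r < 1"
    obtain C N where C: "C > 0" "\<And>m k x. m \<ge> N \<Longrightarrow> norm (h m k x - F k x) * r ^ k \<le> C * e m * norm x ^ k"
      using bnd[OF conjunct1[OF r] conjunct2[OF r]] by blast
    define s where "s = sqrt r"
    have s: "0 < s" "s < 1" "r = s * s" using r by (simp_all add: s_def)
    obtain D where D: "D > 0" "\<And>(q :: 'a \<Rightarrow> complex) h K r M k x.
      \<lbrakk>hhsum q h K; r > 0; M > 0; \<And>x. norm x \<le> r \<Longrightarrow> norm (q x) \<le> M\<rbrakk>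
      \<Longrightarrow> norm (h k x) * (r * s) ^ k \<le> D * M * norm x ^ k"
      using hhsum_component_bound[OF s(1,2), where 'a='a] by blast
    have "compact (q N ` cball 0 s)"
      using cpoly_continuous_on[OF hhsum_cpoly[OF qh]] by (intro compact_continuous_image) auto
    then obtain M where M: "M > 0" "\<And>x. norm x \<le> s \<Longrightarrow> norm (q N x) \<le> M"
      using compact_imp_bounded bounded_pos by (metis (no_types, lifting) image_eqI mem_cball_0)
    have "norm (F k x) * r ^ k \<le> (C * e N + D * M) * norm x ^ k" for k x
    proof -
      have "norm (h N k x) * r ^ k \<le> D * M * norm x ^ k"
        unfolding s(3) by (rule D(2)[OF qh s(1) M(1)]) (use M(2) in auto)
      moreover have "norm (F k x) * r ^ k \<le> norm (h N k x - F k x) * r ^ k + norm (h N k x) * r ^ k"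
        unfolding distrib_right[symmetric] using norm_triangle_ineq4[of "h N k x" "h N k x - F k x"] r
        by (intro mult_right_mono) (auto simp: add.commute)
      ultimately show ?thesis using C(2)[of N k x] by (simp add: distrib_right)
    qed
    then show "\<exists>C. \<forall>k x. norm (F k x) * r ^ k \<le> C * norm x ^ k" by blast
  qed
  moreover have "(\<lambda>k. F k x) sums f x" if x: "x \<in> ball 0 1" for x
  proof -
    define r where "r = (norm x + 1) / 2"
    have r: "0 < r" "r < 1" "norm x < r" using x norm_ge_zero[of x] by (auto simp: r_def add_pos_nonneg simp del: norm_ge_zero)
    define t where "t = norm x / r"
    have t: "0 \<le> t" "t < 1" using r by (auto simp: t_def)
    obtain C N where C: "C > 0" "\<And>m k x. m \<ge> N \<Longrightarrow> norm (h m k x - F k x) * r ^ k \<le> C * e m * norm x ^ k"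
      using bnd[OF r(1,2)] by blast
    have C': "norm (h m k x - F k x) \<le> C * e m * t ^ k" if "m \<ge> N" for m k
      using C(2)[OF that, of k x] r by (simp add: t_def power_divide field_simps)
    have geo: "(\<lambda>k. C * e m * t ^ k) sums (C * e m * (1 / (1 - t)))" for m
      using t by (intro sums_mult geometric_sums) auto
    have hq: "(\<lambda>k. h m k x) sums q m x" for m
      using qh[of m] unfolding hhsum_def using sums_finite[of "{..<K m}" "\<lambda>k. h m k x"] by (auto simp: not_less)
    have sd: "summable (\<lambda>k. norm (h m k x - F k x))" if "m \<ge> N" for m
      by (rule summable_comparison_test'[OF sums_summable[OF geo[of m]], of 0]) (use C'[OF that] in simp)
    have sF: "summable (\<lambda>k. F k x)"
      using summable_diff[OF sums_summable[OF hq[of N]] summable_norm_cancel[OF sd[of N]]] by simp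
    have est: "norm (q m x - (\<Sum>k. F k x)) \<le> C * e m * (1 / (1 - t))" if "m \<ge> N" for m
    proof -
      have "(\<lambda>k. h m k x - F k x) sums (q m x - (\<Sum>k. F k x))"
        by (intro sums_diff hq summable_sums sF)
      then have "norm (q m x - (\<Sum>k. F k x)) = norm (\<Sum>k. h m k x - F k x)" by (simp add: sums_unique[symmetric])
      also have "\<dots> \<le> (\<Sum>k. norm (h m k x - F k x))" by (rule summable_norm[OF sd[OF that]])
      also have "\<dots> \<le> (\<Sum>k. C * e m * t ^ k)"
        by (rule suminf_le[OF C'[OF that] sd[OF that] sums_summable[OF geo]])
      also have "\<dots> = C * e m * (1 / (1 - t))" using geo by (simp add: sums_unique[symmetric])
      finally show ?thesis .
    qed
    have "(\<lambda>m. q m x) \<longlonglongrightarrow> (\<Sum>k. F k x)"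
    proof (rule LIM_zero_cancel, rule Lim_null_comparison)
      show "\<forall>\<^sub>F m in sequentially. norm (q m x - (\<Sum>k. F k x)) \<le> C * e m * (1 / (1 - t))"
        unfolding eventually_sequentially using est by blast
      have "(\<lambda>m. C * e m * (1 / (1 - t))) \<longlonglongrightarrow> C * 0 * (1 / (1 - t))" by (intro tendsto_intros elim)
      then show "(\<lambda>m. C * e m * (1 / (1 - t))) \<longlonglongrightarrow> 0" by simp
    qed
    moreover have "(\<lambda>m. q m x) \<longlonglongrightarrow> f x"
    proof (rule LIM_zero_cancel, rule Lim_null_comparison)
      obtain N' where "\<And>m. m \<ge> N' \<Longrightarrow> norm x \<le> R m" using ev[of "norm x"] x by auto
      then show "\<forall>\<^sub>F m in sequentially. norm (q m x - f x) \<le> e m"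
        unfolding eventually_sequentially using approx by (metis norm_minus_commute)
    qed (rule elim)
    ultimately have "(\<Sum>k. F k x) = f x" by (rule LIMSEQ_unique)
    then show ?thesis using sF summable_sums by metis
  qed
  ultimately show ?thesis by blast
qed

text \<open>\<open>homogeneous_part\<close> is a definite description, so uniqueness has to be
  shown: the difference of two candidates is a homogeneous series with sum zero.\<close>

lemma homogeneous_part_eq:
  fixes f :: "'a::euclidean_space \<Rightarrow> complex"
  assumes F: "expansion F" and sums: "\<And>x. x \<in> ball 0 1 \<Longrightarrow> (\<lambda>k. F k x) sums f x"
  shows "homogeneous_part f = F"
  unfolding homogeneous_part_def
proof (rule the_equality)
  show "(\<forall>k. homogeneous_harmonic_poly k (F k)) \<and> (\<forall>x\<in>ball 0 1. (\<lambda>k. F k x) sums f x)"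
    using F sums homogeneous_harmonic_poly_hhpoly unfolding expansion_def by blast
  fix G assume G: "(\<forall>k. homogeneous_harmonic_poly k (G k)) \<and> (\<forall>x\<in>ball 0 1. (\<lambda>k. G k x) sums f x)"
  have "G k x - F k x = 0" for k x
  proof (rule homogeneous_sums_zero[of "\<lambda>k x. G k x - F k x"])
    show "G k (c *\<^sub>R x) - F k (c *\<^sub>R x) = of_real (c ^ k) * (G k x - F k x)" for k c x
      using G expansion_hom[OF F] unfolding homogeneous_harmonic_poly_def by (simp add: right_diff_distrib)
    fix x :: 'a assume "norm x < 1"
    then have "(\<lambda>k. G k x - F k x) sums (f x - f x)" using G sums by (intro sums_diff) auto
    then show "(\<lambda>k. G k x - F k x) sums 0" by simp
  qed
  then show "G = F" by (intro ext) simp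
qed

section \<open>Mean values and gradients of expansions\<close>

text \<open>Cut off outside the ball so that it is a Borel function on the whole space.\<close>

definition esum :: "(nat \<Rightarrow> 'a::euclidean_space \<Rightarrow> complex) \<Rightarrow> 'a \<Rightarrow> complex" where
  "esum F x = (if norm x < 1 then (\<Sum>k. F k x) else 0)"

text \<open>A radius r strictly between \<open>s\<close> and 1 gives a ratio below 1; passing to the
  maximum of \<open>s\<close> and 0 covers negative \<open>s\<close>.\<close>

lemma expansion_geometric_bound:
  assumes F: "expansion F" and s: "s < 1"
  obtains C t where "C \<ge> 0" "0 \<le> t" "t < 1" "\<And>k x. norm x \<le> s \<Longrightarrow> norm (F k x) \<le> C * t ^ k"
proof -
  define s' where "s' = max s 0"
  define r where "r = (1 + s') / 2"
  have r: "0 < r" "r < 1" "s' < r" "0 \<le> s'" "s \<le> s'" using s by (auto simp: r_def s'_def)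
  from expansion_bound[OF F r(1,2)] obtain C where
    C: "C \<ge> 0" "\<And>k x. norm (F k x) \<le> C * (norm x / r) ^ k" by blast
  have "norm (F k x) \<le> C * (s' / r) ^ k" if "norm x \<le> s" for k x
  proof -
    have "(norm x / r) ^ k \<le> (s' / r) ^ k"
      using that r by (intro power_mono divide_right_mono) auto
    then show ?thesis using C(1) C(2)[of k x] mult_left_mono order_trans by blast
  qed
  moreover have "0 \<le> s' / r" "s' / r < 1" using r by auto
  ultimately show thesis using that C(1) by blast
qed

lemma expansion_summable_norm:
  assumes "expansion F" "norm x < 1" shows "summable (\<lambda>k. norm (F k x))"
proof -
  from expansion_geometric_bound[OF assms] obtain C t where
    C: "0 \<le> t" "t < 1" "\<And>k y. norm y \<le> norm x \<Longrightarrow> norm (F k y) \<le> C * t ^ k" by metis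
  have "summable (\<lambda>k. C * t ^ k)" using C by (intro summable_mult summable_geometric) auto
  then show ?thesis by (rule summable_comparison_test'[where N=0]) (use C(3) in auto)
qed

lemma expansion_summable: "expansion F \<Longrightarrow> norm x < 1 \<Longrightarrow> summable (\<lambda>k. F k x)"
  by (rule summable_norm_cancel[OF expansion_summable_norm])

lemma expansion_sums: "expansion F \<Longrightarrow> norm x < 1 \<Longrightarrow> (\<lambda>k. F k x) sums esum F x"
  using summable_sums[OF expansion_summable] by (simp add: esum_def)

lemma expansion_cpoly: "expansion F \<Longrightarrow> cpoly (F k)"
  unfolding expansion_def hhpoly_def using hpoly_cpoly by blast

lemma continuous_on_esum:
  assumes F: "expansion F" shows "continuous_on (ball 0 1) (esum F)"
proof -
  have cont: "continuous_on (ball 0 s) (\<lambda>x. \<Sum>k. F k x)" if "s < 1" for s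
  proof -
    from expansion_geometric_bound[OF F that] obtain C t where
      C: "0 \<le> t" "t < 1" "\<And>k y. norm y \<le> s \<Longrightarrow> norm (F k y) \<le> C * t ^ k" by metis
    have "uniform_limit (ball 0 s) (\<lambda>n x. \<Sum>i<n. F i x) (\<lambda>x. \<Sum>i. F i x) sequentially"
    proof (rule Weierstrass_m_test)
      show "summable (\<lambda>k. C * t ^ k)" using C by (intro summable_mult summable_geometric) auto
    qed (use C in auto)
    moreover have "\<forall>\<^sub>F n in sequentially. continuous_on (ball 0 s) (\<lambda>x. \<Sum>i<n. F i x)"
      by (intro always_eventually allI continuous_on_sum cpoly_continuous_on expansion_cpoly[OF F])
    ultimately show ?thesis by (intro uniform_limit_theorem) auto
  qed
  have "isCont (\<lambda>x. \<Sum>k. F k x) x" if x: "norm x < 1" for x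
  proof -
    obtain s where "norm x < s" "s < 1" using dense x by blast
    moreover from this have "x \<in> ball 0 s" by simp
    ultimately show ?thesis using cont[of s] unfolding continuous_on_eq_continuous_at[OF open_ball] by blast
  qed
  then have "continuous_on (ball 0 1) (\<lambda>x. \<Sum>k. F k x)"
    by (auto intro!: continuous_at_imp_continuous_on)
  then show ?thesis by (rule continuous_on_eq) (auto simp: esum_def)
qed

lemma esum_measurable [measurable]:
  assumes F: "expansion F" shows "esum F \<in> borel_measurable borel"
proof -
  have "(\<lambda>x. if x \<in> ball 0 1 then esum F x else 0) \<in> borel_measurable borel"
    by (intro borel_measurable_continuous_on_if continuous_on_esum F) auto
  moreover have "(\<lambda>x. if x \<in> ball 0 1 then esum F x else 0) = esum F"
    by (auto simp: esum_def)
  ultimately show ?thesis by simp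
qed

lemma expansion_diff: assumes "expansion F" "expansion G" shows "expansion (\<lambda>k x. F k x - G k x)"
  unfolding expansion_def
proof (intro conjI allI impI)
  show "hhpoly k (\<lambda>x. F k x - G k x)" for k using assms hhpoly_diff unfolding expansion_def by blast
  fix r :: real assume r: "0 < r \<and> r < 1"
  obtain C where C: "\<And>k x. norm (F k x) * r ^ k \<le> C * norm x ^ k" using assms(1) r unfolding expansion_def by blast
  obtain D where D: "\<And>k x. norm (G k x) * r ^ k \<le> D * norm x ^ k" using assms(2) r unfolding expansion_def by blast
  have "norm (F k x - G k x) * r ^ k \<le> (C + D) * norm x ^ k" for k x
  proof -
    have "norm (F k x - G k x) * r ^ k \<le> (norm (F k x) + norm (G k x)) * r ^ k"
      using r by (intro mult_right_mono norm_triangle_ineq4) auto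
    then show ?thesis using C[of k x] D[of k x] by (simp add: distrib_right)
  qed
  then show "\<exists>C. \<forall>k x. norm (F k x - G k x) * r ^ k \<le> C * norm x ^ k" by blast
qed

lemma esum_diff: "expansion F \<Longrightarrow> expansion G \<Longrightarrow> esum (\<lambda>k x. F k x - G k x) x = esum F x - esum G x"
  by (simp add: esum_def suminf_diff expansion_summable)

lemma expansion_scale:
  assumes F: "expansion F" and r: "0 \<le> r" "r \<le> 1"
  shows "expansion (\<lambda>k x. F k (r *\<^sub>R x))"
  unfolding expansion_def
proof (intro conjI allI impI)
  have eq: "(\<lambda>x. F k (r *\<^sub>R x)) = (\<lambda>x. of_real (r ^ k) * F k x)" for k
    using expansion_hom[OF F] by blast
  show "hhpoly k (\<lambda>x. F k (r *\<^sub>R x))" for k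
    unfolding eq using F hhpoly_cmult unfolding expansion_def by blast
  fix q :: real assume q: "0 < q \<and> q < 1"
  then obtain C where C: "\<And>k x. norm (F k x) * q ^ k \<le> C * norm x ^ k" using F unfolding expansion_def by blast
  have "norm (F k (r *\<^sub>R x)) * q ^ k \<le> C * norm x ^ k" for k x
  proof -
    have "norm (F k (r *\<^sub>R x)) = r ^ k * norm (F k x)" using r by (simp add: expansion_hom[OF F] norm_mult norm_power)
    also have "\<dots> \<le> 1 * norm (F k x)" using r by (intro mult_right_mono power_le_one) auto
    finally have "norm (F k (r *\<^sub>R x)) * q ^ k \<le> norm (F k x) * q ^ k" using q by (intro mult_right_mono) auto
    then show ?thesis using C order_trans by blast
  qed
  then show "\<exists>C. \<forall>k x. norm (F k (r *\<^sub>R x)) * q ^ k \<le> C * norm x ^ k" by blast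
qed

lemma esum_scale:
  assumes "expansion F" "0 \<le> r" "r \<le> 1" "norm x < 1"
  shows "esum (\<lambda>k x. F k (r *\<^sub>R x)) x = esum F (r *\<^sub>R x)"
proof -
  have "norm (r *\<^sub>R x) \<le> 1 * norm x" unfolding norm_scaleR using assms by (intro mult_right_mono) auto
  then show ?thesis using assms by (simp add: esum_def)
qed

text \<open>Dominated convergence of the partial sums, which are harmonic polynomials. The condition
  |x| + r < 1 keeps the averaging ball in a compact ball, where the geometric bound provides a
  constant majorant.\<close>

lemma esum_mean_value:
  fixes F :: "nat \<Rightarrow> 'a::euclidean_space \<Rightarrow> complex"
  assumes F: "expansion F" and r: "0 \<le> r" "norm x + r < 1"
  shows "integrable lborel (\<lambda>y. of_real (bump y) * esum F (x + r *\<^sub>R y))"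
    "(\<integral>y. of_real (bump y) * esum F (x + r *\<^sub>R y) \<partial>lborel) = of_real (bump_mass TYPE('a)) * esum F x"
proof -
  from expansion_geometric_bound[OF F r(2)] obtain C t where
    C: "C \<ge> 0" "0 \<le> t" "t < 1" "\<And>k y. norm y \<le> norm x + r \<Longrightarrow> norm (F k y) \<le> C * t ^ k" by metis
  define q where "q N y = (\<Sum>k<N. F k y)" for N y
  have hq: "hhsum (q N) (\<lambda>j. if j < N then F j else (\<lambda>x. 0)) N" for N
    using F unfolding hhsum_def expansion_def q_def by (auto simp: hhpoly_zero)
  have inball: "norm (x + r *\<^sub>R y) \<le> norm x + r" if "norm y < 1" for y
  proof -
    have "norm (x + r *\<^sub>R y) \<le> norm x + r * norm y" using norm_triangle_ineq[of x "r *\<^sub>R y"] r by simp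
    also have "r * norm y \<le> r * 1" using that r by (intro mult_left_mono) auto
    finally show ?thesis by simp
  qed
  have geo: "summable (\<lambda>k. C * t ^ k)" using C by (intro summable_mult summable_geometric) auto
  define B where "B = (\<Sum>k. C * t ^ k)"
  have qb: "norm (q N y) \<le> B" if "norm y \<le> norm x + r" for N y
  proof -
    have "norm (q N y) \<le> (\<Sum>k<N. C * t ^ k)" unfolding q_def using C(4)[OF that] by (intro sum_norm_le) auto
    also have "\<dots> \<le> B" unfolding B_def using geo C by (intro sum_le_suminf) auto
    finally show ?thesis .
  qed
  have qlim: "(\<lambda>N. q N y) \<longlonglongrightarrow> esum F y" if "norm y < 1" for y
    unfolding q_def using expansion_sums[OF F that] unfolding sums_def .
  have M[measurable]: "esum F \<in> borel_measurable borel" by (rule esum_measurable[OF F])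
  have "q N \<in> borel_measurable borel" for N
    using cpoly_continuous_on[OF hhsum_cpoly[OF hq]] by (rule borel_measurable_continuous_onI)
  then have [measurable]: "\<And>N. q N \<in> borel_measurable borel" .
  have lim: "AE y in lborel. (\<lambda>N. of_real (bump y) * q N (x + r *\<^sub>R y)) \<longlonglongrightarrow> of_real (bump y) * esum F (x + r *\<^sub>R y)"
  proof (intro AE_I2)
    fix y :: 'a
    show "(\<lambda>N. of_real (bump y) * q N (x + r *\<^sub>R y)) \<longlonglongrightarrow> of_real (bump y) * esum F (x + r *\<^sub>R y)"
    proof (cases "norm y < 1")
      case True
      then have "norm (x + r *\<^sub>R y) < 1" using inball[of y] r by simp
      then show ?thesis by (intro tendsto_intros qlim)
    next
      case False
      then show ?thesis by (simp add: bump_zero)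
    qed
  qed
  have bound: "AE y in lborel. norm (of_real (bump y) * q N (x + r *\<^sub>R y)) \<le> bump y * B" for N
  proof (intro AE_I2)
    fix y :: 'a
    show "norm (of_real (bump y) * q N (x + r *\<^sub>R y)) \<le> bump y * B"
      using qb[OF inball, of y N] by (cases "norm y < 1") (auto simp: norm_mult bump_nonneg bump_zero intro!: mult_left_mono)
  qed
  have int: "integrable lborel (\<lambda>y::'a. bump y * B)" using integrable_bump[where 'a='a] by simp
  have m1: "(\<lambda>y. of_real (bump y) * esum F (x + r *\<^sub>R y)) \<in> borel_measurable lborel" by measurable
  have m2: "(\<lambda>y. of_real (bump y) * q N (x + r *\<^sub>R y)) \<in> borel_measurable lborel" for N by measurable
  show "integrable lborel (\<lambda>y. of_real (bump y) * esum F (x + r *\<^sub>R y))"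
    using integrable_dominated_convergence[OF m1 m2 int lim bound] .
  have "(\<lambda>N. \<integral>y. of_real (bump y) * q N (x + r *\<^sub>R y) \<partial>lborel)
      \<longlonglongrightarrow> (\<integral>y. of_real (bump y) * esum F (x + r *\<^sub>R y) \<partial>lborel)"
    using integral_dominated_convergence[OF m1 m2 int lim bound] .
  moreover have "(\<lambda>N. of_real (bump_mass TYPE('a)) * q N x) \<longlonglongrightarrow> of_real (bump_mass TYPE('a)) * esum F x"
    using r by (intro tendsto_intros qlim) auto
  ultimately show "(\<integral>y. of_real (bump y) * esum F (x + r *\<^sub>R y) \<partial>lborel) = of_real (bump_mass TYPE('a)) * esum F x"
    unfolding hhsum_mean_value[OF hq] by (rule LIMSEQ_unique)
qed

text \<open>The factor 2 is the Lipschitz constant of \<open>bump\<close>; 2^n times the unit ball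
  volume comes from the ball of radius 2r that contains both supports, its r^n cancelling against
  the mean; the mass normalizes the mean.\<close>

definition grad_const :: "'a::euclidean_space itself \<Rightarrow> real" where
  "grad_const _ = 2 * 2 ^ DIM('a) * unit_ball_vol (real DIM('a)) / bump_mass TYPE('a)"

lemma grad_const_pos: "grad_const TYPE('a::euclidean_space) > 0"
  unfolding grad_const_def using bump_mass_pos[where 'a='a] by (intro divide_pos_pos mult_pos_pos) auto

text \<open>Differences of means over translated bumps only see the Lipschitz constant of the bump.\<close>

lemma esum_lipschitz:
  fixes F :: "nat \<Rightarrow> 'a::euclidean_space \<Rightarrow> complex"
  assumes F: "expansion F" and r: "0 < r" "norm x + 2 * r < 1"
    and M: "\<And>z. norm (z - x) \<le> 2 * r \<Longrightarrow> norm (esum F z) \<le> M" and x': "norm (x' - x) \<le> r"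
  shows "norm (esum F x' - esum F x) \<le> grad_const TYPE('a) * M * norm (x' - x) / r"
proof -
  have "norm (x - x) \<le> 2 * r" using r by simp
  then have M0: "M \<ge> 0" using order_trans[OF norm_ge_zero M] by blast
  note [measurable] = esum_measurable[OF F]
  define K where "K u z = of_real (bump ((1 / r) *\<^sub>R (z - u))) * esum F z" for u z
  have Km[measurable]: "K u \<in> borel_measurable borel" for u unfolding K_def[abs_def] by measurable
  have rep: "integrable lborel (K u)" "(\<integral>z. K u z \<partial>lborel) = r ^ DIM('a) *\<^sub>R (of_real (bump_mass TYPE('a)) * esum F u)"
    if u: "norm u + r < 1" for u
  proof -
    have eq: "K u (u + r *\<^sub>R y) = of_real (bump y) * esum F (u + r *\<^sub>R y)" for y
      using r by (simp add: K_def)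
    have "(\<integral>z. K u z \<partial>lborel) = \<bar>r\<bar> ^ DIM('a) *\<^sub>R (\<integral>y. K u (u + r *\<^sub>R y) \<partial>lborel)"
      using r by (intro integral_affine) auto
    then show "(\<integral>z. K u z \<partial>lborel) = r ^ DIM('a) *\<^sub>R (of_real (bump_mass TYPE('a)) * esum F u)"
      using esum_mean_value[OF F, of r u] u r by (simp add: eq)
    have i: "integrable lborel (\<lambda>y. K u (u + r *\<^sub>R y))"
      using esum_mean_value[OF F, of r u] u r by (simp add: eq)
    have "integrable (density (distr lborel borel (\<lambda>x. u + r *\<^sub>R x)) (\<lambda>_. ennreal (\<bar>r\<bar> ^ DIM('a)))) (K u)"
      using i by (subst integrable_density) (auto simp: integrable_distr_eq)
    then show "integrable lborel (K u)" using lborel_affine[of r u] r by (simp add: ennreal_power)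
  qed
  have nx: "norm x' + r < 1" "norm x + r < 1"
    using x' r norm_triangle_ineq2[of x' x] by (auto simp: norm_minus_commute)
  let ?V = "measure lborel (cball x (2 * r))"
  have "r ^ DIM('a) *\<^sub>R (of_real (bump_mass TYPE('a)) * (esum F x' - esum F x)) = (\<integral>z. K x' z - K x z \<partial>lborel)"
    using rep[OF nx(1)] rep[OF nx(2)] by (simp add: algebra_simps)
  then have "r ^ DIM('a) * (bump_mass TYPE('a) * norm (esum F x' - esum F x)) = norm (\<integral>z. K x' z - K x z \<partial>lborel)"
    using r bump_mass_pos[where 'a='a] by (metis abs_of_pos norm_mult norm_of_real norm_scaleR zero_less_power)
  also have "\<dots> \<le> (\<integral>z. norm (K x' z - K x z) \<partial>lborel)" by (rule integral_norm_bound)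
  also have "\<dots> \<le> (\<integral>z. (2 * norm (x' - x) / r * M) * indicator (cball x (2 * r)) z \<partial>lborel)"
  proof (rule Bochner_Integration.integral_mono)
    show "integrable lborel (\<lambda>z. norm (K x' z - K x z))"
      using rep(1)[OF nx(1)] rep(1)[OF nx(2)] by (intro integrable_norm Bochner_Integration.integrable_diff)
    show "integrable lborel (\<lambda>z. (2 * norm (x' - x) / r * M) * indicator (cball x (2 * r)) z)"
      using borel_integrable_compact[of "cball x (2 * r)" "\<lambda>_. 2 * norm (x' - x) / r * M"] by (simp add: mult.commute)
    fix z :: 'a
    show "norm (K x' z - K x z) \<le> (2 * norm (x' - x) / r * M) * indicator (cball x (2 * r)) z"
    proof (cases "norm (z - x) \<le> 2 * r")
      case True
      have "norm (K x' z - K x z) = \<bar>bump ((1 / r) *\<^sub>R (z - x')) - bump ((1 / r) *\<^sub>R (z - x))\<bar> * norm (esum F z)"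
        unfolding K_def left_diff_distrib[symmetric] of_real_diff[symmetric] norm_mult norm_of_real ..
      also have "\<dots> \<le> (2 * norm ((1 / r) *\<^sub>R (z - x') - (1 / r) *\<^sub>R (z - x))) * M"
        using M[OF True] M0 by (intro mult_mono bump_lipschitz) auto
      also have "norm ((1 / r) *\<^sub>R (z - x') - (1 / r) *\<^sub>R (z - x)) = norm (x' - x) / r"
      proof -
        have "(1 / r) *\<^sub>R (z - x') - (1 / r) *\<^sub>R (z - x) = (1 / r) *\<^sub>R (x - x')" by (simp add: algebra_simps)
        then show ?thesis using r by (simp only: norm_scaleR) (simp add: norm_minus_commute)
      qed
      finally show ?thesis using True by (simp add: indicator_def dist_norm norm_minus_commute)
    next
      case False
      have far: "bump ((1 / r) *\<^sub>R v) = 0" if "norm v \<ge> r" for v :: 'a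
        using that r by (intro bump_zero) (simp only: norm_scaleR, simp add: field_simps)
      have "norm (z - x') \<ge> r" using False x' norm_triangle_ineq2[of "z - x" "x' - x"] by simp
      then have "K x' z = 0" "K x z = 0" using False r by (auto simp: K_def far)
      then show ?thesis using False by (simp add: indicator_def dist_norm norm_minus_commute)
    qed
  qed
  also have "\<dots> = (2 * norm (x' - x) / r * M) * ?V" by simp
  also have "?V = unit_ball_vol (real DIM('a)) * (2 * r) ^ DIM('a)" using r by (intro content_cball) auto
  finally have "r ^ DIM('a) * (bump_mass TYPE('a) * norm (esum F x' - esum F x))
     \<le> r ^ DIM('a) * ((2 * norm (x' - x) / r * M) * (unit_ball_vol (real DIM('a)) * 2 ^ DIM('a)))"
    by (simp add: power_mult_distrib algebra_simps)
  then have "bump_mass TYPE('a) * norm (esum F x' - esum F x)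
     \<le> (2 * norm (x' - x) / r * M) * (unit_ball_vol (real DIM('a)) * 2 ^ DIM('a))"
    using r by (simp only: mult_le_cancel_left_pos zero_less_power)
  then have "norm (esum F x' - esum F x)
     \<le> (2 * norm (x' - x) / r * M) * (unit_ball_vol (real DIM('a)) * 2 ^ DIM('a)) / bump_mass TYPE('a)"
    using bump_mass_pos[where 'a='a] by (simp only: pos_le_divide_eq mult.commute[of "norm (esum F x' - esum F x)"])
  then show ?thesis by (simp add: grad_const_def algebra_simps)
qed

text \<open>The series with factor \<open>k\<close> is the derivative at z = 1 of the power series
  along the ray through \<open>x\<close>. Its difference quotients are bounded by
  \<open>esum_lipschitz\<close>, and so is their limit.\<close>

lemma esum_radial_derivative:
  fixes F :: "nat \<Rightarrow> 'a::euclidean_space \<Rightarrow> complex"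
  assumes F: "expansion F" and r: "0 < r" "norm x + 2 * r < 1"
    and M: "\<And>z. norm (z - x) \<le> 2 * r \<Longrightarrow> norm (esum F z) \<le> M"
  shows "norm (esum (\<lambda>k x. of_nat k * F k x) x) \<le> grad_const TYPE('a) * M / r"
proof -
  have "norm (x - x) \<le> 2 * r" using r by simp
  then have M0: "M \<ge> 0" using order_trans[OF norm_ge_zero M] by blast
  have nx: "norm x < 1" using r by simp
  \<comment> \<open>The point \<open>K *\<^sub>R x\<close> still lies in the unit ball, so the
    series in z converges at K > 1 and may be differentiated termwise at 1.\<close>
  define K where "K = 1 + r"
  have K: "K > 1" "norm (K *\<^sub>R x) < 1"
  proof -
    have "norm (K *\<^sub>R x) = norm x + r * norm x" using r by (simp add: K_def distrib_right)
    also have "r * norm x \<le> r * 1" using r nx by (intro mult_left_mono) auto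
    finally show "norm (K *\<^sub>R x) < 1" using r by simp
  qed (use r in \<open>simp add: K_def\<close>)
  define g where "g z = (\<Sum>n. F n x * z ^ n)" for z :: complex
  have "summable (\<lambda>n. F n (K *\<^sub>R x))" using expansion_summable[OF F K(2)] .
  then have sK: "summable (\<lambda>n. F n x * of_real K ^ n)" unfolding expansion_hom[OF F] by (simp add: mult.commute)
  have D: "(g has_field_derivative (\<Sum>n. diffs (\<lambda>n. F n x) n * 1 ^ n)) (at 1)"
    unfolding g_def[abs_def] using sK by (rule termdiffs_strong) (use K in auto)
  have sder: "summable (\<lambda>n. diffs (\<lambda>n. F n x) n * 1 ^ n)"
  proof (rule termdiff_converges)
    show "norm (1::complex) < K" using K by simp
    show "summable (\<lambda>n. F n x * z ^ n)" if "norm z < K" for z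
      using powser_inside[OF sK, of z] that K by simp
  qed
  have "(\<Sum>n. diffs (\<lambda>n. F n x) n * 1 ^ n) = (\<Sum>n. of_nat n * F n x)"
  proof -
    have s: "summable (\<lambda>n. of_nat (Suc n) * F (Suc n) x)" using sder by (simp add: diffs_def)
    then have "summable (\<lambda>n. of_nat n * F n x)" using summable_Suc_iff[of "\<lambda>n. of_nat n * F n x"] by simp
    from suminf_split_head[OF this] show ?thesis by (simp add: diffs_def)
  qed
  with D have D': "(g has_field_derivative esum (\<lambda>k x. of_nat k * F k x) x) (at 1)"
    using nx by (simp add: esum_def)
  have geq: "g (of_real t) = esum F (t *\<^sub>R x)" if "norm (t *\<^sub>R x) < 1" for t
    using that unfolding g_def esum_def expansion_hom[OF F] by (simp add: mult.commute)
  define h where "h n = r / real (Suc n)" for n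
  have h: "h n > 0" "h n \<le> r" for n using r by (auto simp: h_def field_simps)
  have hlim: "h \<longlonglongrightarrow> 0"
    unfolding h_def[abs_def] using tendsto_mult[OF tendsto_const[of r] LIMSEQ_inverse_real_of_nat]
    by (simp add: divide_inverse)
  have "((\<lambda>z. (g (1 + z) - g 1) / z) \<longlongrightarrow> esum (\<lambda>k x. of_nat k * F k x) x) (at 0)"
    using D' by (simp add: DERIV_def)
  moreover have "filterlim (\<lambda>n. complex_of_real (h n)) (at 0) sequentially"
    unfolding filterlim_at using h(1) tendsto_of_real[OF hlim, where 'a=complex] by (auto simp: less_imp_neq[symmetric])
  ultimately have "(\<lambda>n. (g (1 + of_real (h n)) - g 1) / of_real (h n)) \<longlonglongrightarrow> esum (\<lambda>k x. of_nat k * F k x) x"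
    by (rule filterlim_compose)
  then have "(\<lambda>n. norm ((g (1 + of_real (h n)) - g 1) / of_real (h n))) \<longlonglongrightarrow> norm (esum (\<lambda>k x. of_nat k * F k x) x)"
    by (rule tendsto_norm)
  moreover have "norm ((g (1 + of_real (h n)) - g 1) / of_real (h n)) \<le> grad_const TYPE('a) * M / r" for n
  proof -
    have d: "(1 + h n) *\<^sub>R x - x = h n *\<^sub>R x" by (simp add: algebra_simps)
    have "norm ((1 + h n) *\<^sub>R x) \<le> norm (K *\<^sub>R x)"
      unfolding norm_scaleR using h[of n] K by (intro mult_right_mono) (auto simp: K_def)
    then have "g (of_real (1 + h n)) = esum F ((1 + h n) *\<^sub>R x)" "g (of_real 1) = esum F (1 *\<^sub>R x)"
      using K nx by (intro geq; simp)+
    then have "norm (g (1 + of_real (h n)) - g 1) = norm (esum F ((1 + h n) *\<^sub>R x) - esum F x)" by simp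
    also have "\<dots> \<le> grad_const TYPE('a) * M * norm ((1 + h n) *\<^sub>R x - x) / r"
    proof (rule esum_lipschitz[OF F r M])
      show "norm ((1 + h n) *\<^sub>R x - x) \<le> r"
        unfolding d norm_scaleR using h[of n] nx mult_mono[of "\<bar>h n\<bar>" r "norm x" 1] r by simp
    qed
    also have "\<dots> = grad_const TYPE('a) * M * (h n * norm x) / r" unfolding d using h[of n] by simp
    also have "\<dots> \<le> grad_const TYPE('a) * M * (h n * 1) / r"
      using grad_const_pos[where 'a='a] M0 h[of n] nx r
      by (intro divide_right_mono mult_left_mono) auto
    finally show ?thesis using h[of n] by (simp add: norm_divide field_simps)
  qed
  ultimately show ?thesis by (intro LIMSEQ_le_const2) auto
qed

section \<open>Multipliers\<close>

definition growth :: "real \<Rightarrow> real \<Rightarrow> (nat \<Rightarrow> 'a::euclidean_space \<Rightarrow> complex) \<Rightarrow> bool" where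
  "growth A K F \<longleftrightarrow> (\<forall>x. norm x < 1 \<longrightarrow> norm (esum F x) \<le> K * (1 - norm x) powr (- A))"

definition emul :: "(nat \<Rightarrow> real) \<Rightarrow> (nat \<Rightarrow> 'a \<Rightarrow> complex) \<Rightarrow> nat \<Rightarrow> 'a \<Rightarrow> complex" where
  "emul m F = (\<lambda>k x. of_real (m k) * F k x)"

text \<open>The constant is uniform in \<open>F\<close> and \<open>K\<close>, so a small growth
  bound for a difference becomes a small bound for its image; the transfer of boundary decay rests
  on this.\<close>

definition multiplier :: "'a::euclidean_space itself \<Rightarrow> (nat \<Rightarrow> real) \<Rightarrow> real \<Rightarrow> bool" where
  "multiplier _ m u \<longleftrightarrow>
     (\<forall>F :: nat \<Rightarrow> 'a \<Rightarrow> complex. expansion F \<longrightarrow> expansion (emul m F)) \<and>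
     (\<forall>A>0. A + u > 0 \<longrightarrow> (\<exists>C\<ge>0. \<forall>(F :: nat \<Rightarrow> 'a \<Rightarrow> complex) K.
        expansion F \<longrightarrow> K \<ge> 0 \<longrightarrow> growth A K F \<longrightarrow> growth (A + u) (C * K) (emul m F)))"

lemma multiplier_expansion:
  fixes F :: "nat \<Rightarrow> 'a::euclidean_space \<Rightarrow> complex"
  shows "multiplier TYPE('a) m u \<Longrightarrow> expansion F \<Longrightarrow> expansion (emul m F)"
  unfolding multiplier_def by blast

lemma multiplierE:
  assumes "multiplier TYPE('a::euclidean_space) m u" "A > 0" "A + u > 0"
  obtains C where "C \<ge> 0" "\<And>(F :: nat \<Rightarrow> 'a \<Rightarrow> complex) K.
    expansion F \<Longrightarrow> K \<ge> 0 \<Longrightarrow> growth A K F \<Longrightarrow> growth (A + u) (C * K) (emul m F)"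
  using assms unfolding multiplier_def by blast

lemma emul_emul: "emul m (emul m' F) = emul (\<lambda>k. m k * m' k) F"
  unfolding emul_def by (simp add: mult.assoc)

text \<open>The order of composition is chosen so that the intermediate exponent stays positive.\<close>

lemma multiplier_mult:
  assumes m: "multiplier TYPE('a::euclidean_space) m u" and m': "multiplier TYPE('a) m' u'"
  shows "multiplier TYPE('a) (\<lambda>k. m k * m' k) (u + u')"
proof -
  have one: "\<exists>C\<ge>0. \<forall>(F :: nat \<Rightarrow> 'a \<Rightarrow> complex) K.
        expansion F \<longrightarrow> K \<ge> 0 \<longrightarrow> growth A K F \<longrightarrow> growth (A + u + u') (C * K) (emul (\<lambda>k. m' k * m k) F)"
    if m: "multiplier TYPE('a) m u" and m': "multiplier TYPE('a) m' u'"
      and A: "A > 0" "A + u > 0" "A + u + u' > 0" for m u m' u' A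
  proof -
    obtain C where C: "C \<ge> 0" "\<And>(F :: nat \<Rightarrow> 'a \<Rightarrow> complex) K.
      expansion F \<Longrightarrow> K \<ge> 0 \<Longrightarrow> growth A K F \<Longrightarrow> growth (A + u) (C * K) (emul m F)"
      using multiplierE[OF m A(1,2)] by blast
    obtain D where D: "D \<ge> 0" "\<And>(F :: nat \<Rightarrow> 'a \<Rightarrow> complex) K.
      expansion F \<Longrightarrow> K \<ge> 0 \<Longrightarrow> growth (A + u) K F \<Longrightarrow> growth (A + u + u') (D * K) (emul m' F)"
      using multiplierE[OF m' A(2,3)] by blast
    have "growth (A + u + u') (D * C * K) (emul (\<lambda>k. m' k * m k) F)"
      if "expansion F" "K \<ge> 0" "growth A K F" for F :: "nat \<Rightarrow> 'a \<Rightarrow> complex" and K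
      using D(2)[OF multiplier_expansion[OF m that(1)] _ C(2)[OF that]] C(1) that(2)
      by (simp add: emul_emul mult.assoc)
    moreover have "D * C \<ge> 0" using C(1) D(1) by simp
    ultimately show ?thesis by blast
  qed
  have comm: "(\<lambda>k. m' k * m k) = (\<lambda>k. m k * m' k)" by (simp add: mult.commute)
  show ?thesis
    unfolding multiplier_def
  proof (intro conjI allI impI)
    fix F :: "nat \<Rightarrow> 'a \<Rightarrow> complex" assume "expansion F"
    then show "expansion (emul (\<lambda>k. m k * m' k) F)"
      unfolding emul_emul[symmetric] using m m' multiplier_expansion by blast
  next
    fix A :: real assume A: "A > 0" "A + (u + u') > 0"
    show "\<exists>C\<ge>0. \<forall>(F :: nat \<Rightarrow> 'a \<Rightarrow> complex) K.
        expansion F \<longrightarrow> K \<ge> 0 \<longrightarrow> growth A K F \<longrightarrow> growth (A + (u + u')) (C * K) (emul (\<lambda>k. m k * m' k) F)"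
    proof (cases "A + u > 0")
      case True
      then show ?thesis using one[OF m m' A(1)] A by (simp add: comm add.assoc)
    next
      case False
      then have "A + u' > 0" using A by linarith
      then show ?thesis using one[OF m' m A(1)] A by (simp add: comm add_ac)
    qed
  qed
qed

text \<open>One factor sqrt r of the radius pays for the multiplier, the other for the
  expansion.\<close>

lemma expansion_emul:
  assumes F: "expansion F" and m: "\<And>q. 0 < q \<Longrightarrow> q < 1 \<Longrightarrow> \<exists>B. \<forall>k. \<bar>m k\<bar> * q ^ k \<le> B"
  shows "expansion (emul m F)"
  unfolding expansion_def
proof (intro conjI allI impI)
  show "hhpoly k (emul m F k)" for k
    unfolding emul_def using F hhpoly_cmult unfolding expansion_def by blast
  fix r :: real assume r: "0 < r \<and> r < 1"
  define s where "s = sqrt r"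
  have s: "0 < s" "s < 1" "r = s * s" using r by (simp_all add: s_def)
  obtain C where C: "\<And>k x. norm (F k x) * s ^ k \<le> C * norm x ^ k" using F s unfolding expansion_def by blast
  obtain B where B: "\<And>k. \<bar>m k\<bar> * s ^ k \<le> B" using m s by blast
  have B0: "B \<ge> 0" using B[of 0] by (meson abs_ge_zero mult_nonneg_nonneg order_trans s(1) zero_le_power less_imp_le)
  have "norm (emul m F k x) * r ^ k \<le> B * C * norm x ^ k" for k x
  proof -
    have "norm (emul m F k x) * r ^ k = (\<bar>m k\<bar> * s ^ k) * (norm (F k x) * s ^ k)"
      by (simp add: emul_def norm_mult s(3) power_mult_distrib mult_ac)
    also have "\<dots> \<le> B * (C * norm x ^ k)"
      using s by (intro mult_mono[OF B C] B0 mult_nonneg_nonneg) auto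
    finally show ?thesis by (simp add: mult.assoc)
  qed
  then show "\<exists>C. \<forall>k x. norm (emul m F k x) * r ^ k \<le> C * norm x ^ k" by blast
qed

lemma expansion_emul_linear:
  assumes F: "expansion F" shows "expansion (emul (\<lambda>k. real k + b) F)"
proof (rule expansion_emul[OF F])
  fix q :: real assume q: "0 < q" "q < 1"
  have "(\<lambda>k. real k * q ^ k + b * q ^ k) \<longlonglongrightarrow> 0 + b * 0"
    using q by (intro tendsto_intros powser_times_n_limit_0 LIMSEQ_realpow_zero) auto
  then have "Bseq (\<lambda>k. real k * q ^ k + b * q ^ k)" by (intro convergent_imp_Bseq convergentI)
  then obtain B where "\<And>k. norm (real k * q ^ k + b * q ^ k) \<le> B" by (auto simp: Bseq_def)
  moreover have "norm (real k * q ^ k + b * q ^ k) = \<bar>real k + b\<bar> * q ^ k" for k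
    using q by (simp add: distrib_right[symmetric] abs_mult)
  ultimately show "\<exists>B. \<forall>k. \<bar>real k + b\<bar> * q ^ k \<le> B" by metis
qed

lemma expansion_emul_bounded:
  assumes F: "expansion F" and m: "\<And>k. \<bar>m k\<bar> \<le> B" shows "expansion (emul m F)"
proof (rule expansion_emul[OF F])
  fix q :: real assume q: "0 < q" "q < 1"
  have "\<bar>m k\<bar> * q ^ k \<le> B * 1" for k
    using q order_trans[OF abs_ge_zero m] by (intro mult_mono m power_le_one) auto
  then show "\<exists>B. \<forall>k. \<bar>m k\<bar> * q ^ k \<le> B" by blast
qed

lemma multiplier_const: "multiplier TYPE('a::euclidean_space) (\<lambda>k. c) 0"
  unfolding multiplier_def
proof (intro conjI allI impI)
  fix F :: "nat \<Rightarrow> 'a \<Rightarrow> complex" assume "expansion F"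
  then show "expansion (emul (\<lambda>k. c) F)" by (rule expansion_emul_bounded) (rule order_refl)
next
  fix A :: real assume "A > 0"
  show "\<exists>C\<ge>0. \<forall>(F :: nat \<Rightarrow> 'a \<Rightarrow> complex) K.
        expansion F \<longrightarrow> K \<ge> 0 \<longrightarrow> growth A K F \<longrightarrow> growth (A + 0) (C * K) (emul (\<lambda>k. c) F)"
  proof (rule exI[of _ "\<bar>c\<bar>"], intro conjI allI impI)
    fix F :: "nat \<Rightarrow> 'a \<Rightarrow> complex" and K :: real
    assume F: "expansion F" and K: "K \<ge> 0" and g: "growth A K F"
    have "esum (emul (\<lambda>k. c) F) x = of_real c * esum F x" if "norm x < 1" for x
      using that suminf_mult[OF expansion_summable[OF F that]] by (simp add: esum_def emul_def)
    then show "growth (A + 0) (\<bar>c\<bar> * K) (emul (\<lambda>k. c) F)"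
      using g unfolding growth_def by (auto simp: norm_mult mult.assoc intro!: mult_left_mono)
  qed simp
qed

text \<open>A gradient estimate at the scale of the distance d to the sphere. On |z - x| \<le> d/2
  the distance is still at least d/2, which costs 2^A; the radius d/4 in
  \<open>esum_radial_derivative\<close> costs 4/d. The term with \<open>b\<close> is absorbed
  because d \<le> 1.\<close>

lemma multiplier_linear:
  assumes b: "b \<ge> 0"
  shows "multiplier TYPE('a::euclidean_space) (\<lambda>k. real k + b) 1"
  unfolding multiplier_def
proof (intro conjI allI impI)
  fix F :: "nat \<Rightarrow> 'a \<Rightarrow> complex" assume "expansion F"
  then show "expansion (emul (\<lambda>k. real k + b) F)" by (rule expansion_emul_linear)
next
  fix A :: real assume A: "A > 0"
  define C where "C = 4 * grad_const TYPE('a) * 2 powr A + b"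
  have gc: "grad_const TYPE('a) > 0" by (rule grad_const_pos)
  show "\<exists>C\<ge>0. \<forall>(F :: nat \<Rightarrow> 'a \<Rightarrow> complex) K.
        expansion F \<longrightarrow> K \<ge> 0 \<longrightarrow> growth A K F \<longrightarrow> growth (A + 1) (C * K) (emul (\<lambda>k. real k + b) F)"
  proof (rule exI[of _ C], intro conjI allI impI)
    show "C \<ge> 0" unfolding C_def using gc b by (intro add_nonneg_nonneg mult_nonneg_nonneg) auto
    fix F :: "nat \<Rightarrow> 'a \<Rightarrow> complex" and K :: real
    assume F: "expansion F" and K: "K \<ge> 0" and g: "growth A K F"
    show "growth (A + 1) (C * K) (emul (\<lambda>k. real k + b) F)"
      unfolding growth_def
    proof (intro allI impI)
      fix x :: 'a assume x: "norm x < 1"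
      define d where "d = 1 - norm x"
      have d: "0 < d" "d \<le> 1" using x by (auto simp: d_def)
      define M where "M = K * (2 powr A * d powr (- A))"
      have M: "norm (esum F z) \<le> M" if "norm (z - x) \<le> 2 * (d / 4)" for z
      proof -
        have "norm z \<le> norm x + d / 2" using that norm_triangle_ineq2[of z x] by simp
        then have nz2: "d / 2 \<le> 1 - norm z" unfolding d_def by (simp add: field_simps)
        then have "norm z < 1" using d by simp
        note nz = this nz2
        have "norm (esum F z) \<le> K * (1 - norm z) powr (- A)" using g nz unfolding growth_def by blast
        also have "\<dots> \<le> K * (d / 2) powr (- A)"
          using nz d A K by (intro mult_left_mono powr_mono2') auto
        also have "(d / 2) powr (- A) = 2 powr A * d powr (- A)"
          using d by (simp add: powr_divide powr_minus field_simps)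
        finally show ?thesis by (simp add: M_def)
      qed
      have 1: "norm (esum (\<lambda>k x. of_nat k * F k x) x) \<le> grad_const TYPE('a) * M / (d / 4)"
      proof (rule esum_radial_derivative[OF F])
        have "norm x = 1 - d" by (simp add: d_def)
        then show "norm x + 2 * (d / 4) < 1" using d(1) by (simp add: field_simps)
      qed (use d M in auto)
      have dd: "d powr (- A) / d = d powr (- (A + 1))"
        using d powr_diff[of d "- A" 1] by simp
      have 2: "norm (esum F x) \<le> K * d powr (- (A + 1))"
      proof -
        have "norm (esum F x) \<le> K * d powr (- A)" using g x unfolding growth_def d_def by blast
        also have "\<dots> \<le> K * d powr (- (A + 1))"
          using d K by (intro mult_left_mono powr_mono') auto
        finally show ?thesis .
      qed
      have eF: "expansion (\<lambda>k x. of_nat k * F k x)"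
      proof -
        have "expansion (emul (\<lambda>k. real k + 0) F)" by (rule expansion_emul_linear[OF F])
        then show ?thesis by (simp add: emul_def)
      qed
      have "esum (emul (\<lambda>k. real k + b) F) x = (\<Sum>k. of_nat k * F k x + of_real b * F k x)"
        using x by (simp add: esum_def emul_def distrib_right)
      also have "\<dots> = esum (\<lambda>k x. of_nat k * F k x) x + of_real b * esum F x"
        using x suminf_add[OF expansion_summable[OF eF x] summable_mult[OF expansion_summable[OF F x], of "of_real b"]]
          suminf_mult[OF expansion_summable[OF F x], of "of_real b"]
        by (simp add: esum_def)
      finally have "norm (esum (emul (\<lambda>k. real k + b) F) x)
          \<le> norm (esum (\<lambda>k x. of_nat k * F k x) x) + b * norm (esum F x)"
        using norm_triangle_ineq[of "esum (\<lambda>k x. of_nat k * F k x) x" "of_real b * esum F x"] b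
        by (simp add: norm_mult)
      also have "\<dots> \<le> grad_const TYPE('a) * M / (d / 4) + b * (K * d powr (- (A + 1)))"
        using 1 2 b by (intro add_mono mult_left_mono) auto
      also have "grad_const TYPE('a) * M / (d / 4) = 4 * grad_const TYPE('a) * K * 2 powr A * (d powr (- A) / d)"
        by (simp add: M_def field_simps)
      also have "\<dots> + b * (K * d powr (- (A + 1))) = C * K * d powr (- (A + 1))"
        unfolding dd C_def by (simp add: algebra_simps)
      finally show "norm (esum (emul (\<lambda>k. real k + b) F) x) \<le> C * K * (1 - norm x) powr (- (A + 1))"
        by (simp add: d_def)
    qed
  qed
qed

section \<open>Pochhammer quotients as multipliers\<close>

definition poch_ratio :: "real \<Rightarrow> real \<Rightarrow> nat \<Rightarrow> real" where
  "poch_ratio a b k = pochhammer a k / pochhammer b k"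

lemma poch_ratio_step:
  assumes "b > 0" shows "poch_ratio (b + 1) b k = (1 / b) * (real k + b)"
proof -
  have "b * pochhammer (b + 1) k = pochhammer b k * (b + real k)"
    using pochhammer_rec[of b k] pochhammer_rec'[of b k] by (simp add: mult.commute)
  moreover have "pochhammer b k > 0" using assms by (rule pochhammer_pos)
  ultimately show ?thesis using assms by (simp add: poch_ratio_def field_simps)
qed

lemma multiplier_poch_ratio_step:
  assumes "b > 0" shows "multiplier TYPE('a::euclidean_space) (poch_ratio (b + 1) b) 1"
proof -
  have "multiplier TYPE('a) (\<lambda>k. (1 / b) * (real k + b)) (0 + 1)"
    using assms by (intro multiplier_mult multiplier_const multiplier_linear) auto
  moreover have "poch_ratio (b + 1) b = (\<lambda>k. (1 / b) * (real k + b))" using poch_ratio_step[OF assms] by (rule ext)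
  ultimately show ?thesis by simp
qed

lemma negative_binomial_sums:
  fixes A t :: real
  assumes "\<bar>t\<bar> < 1"
  shows "(\<lambda>j. pochhammer A j / fact j * t ^ j) sums (1 - t) powr (- A)"
proof -
  have "(\<lambda>n. ((- A) gchoose n) * (- t) ^ n) sums (1 + - t) powr (- A)"
    using assms by (intro gen_binomial_real) simp
  moreover have "((- A) gchoose n) * (- t) ^ n = pochhammer A n / fact n * t ^ n" for n
    by (simp add: gbinomial_pochhammer power_minus[of t] mult_ac)
  ultimately show ?thesis by simp
qed

text \<open>By Euler's limit for the Gamma function the quotient of the two products converges to a
  quotient of Gamma values; the powers of n in that limit cancel because a + b = c + d.\<close>

lemma pochhammer_quotient_bounded:
  fixes a b c d :: real
  assumes pos: "a > 0" "b > 0" "c > 0" "d > 0" and eq: "a + b = c + d"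
  shows "\<exists>D>0. \<forall>j. pochhammer a j * pochhammer b j \<le> D * (pochhammer c j * pochhammer d j)"
proof -
  define q where "q j = pochhammer a j * pochhammer b j / (pochhammer c j * pochhammer d j)" for j
  have G: "Gamma x > 0" if "x > 0" for x :: real using that by (rule Gamma_real_pos)
  have "(\<lambda>n. Gamma_series c n * Gamma_series d n / (Gamma_series a n * Gamma_series b n))
      \<longlonglongrightarrow> Gamma c * Gamma d / (Gamma a * Gamma b)"
    using G[OF pos(1)] G[OF pos(2)] by (intro tendsto_intros Gamma_series_LIMSEQ) auto
  \<comment> \<open>\<open>Gamma_series\<close> at \<open>n\<close> contains the Pochhammer symbol
    of length n + 1, hence the index \<open>Suc n\<close>.\<close>
  moreover have "Gamma_series c n * Gamma_series d n / (Gamma_series a n * Gamma_series b n) = q (Suc n)" for n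
  proof -
    have P: "pochhammer x (n + 1) > 0" if "x > 0" for x :: real using that by (rule pochhammer_pos)
    define L where "L = ln (real n)"
    have e: "exp (a * L) * exp (b * L) = exp (c * L) * exp (d * L)"
      using eq by (simp add: exp_add[symmetric] distrib_right[symmetric])
    show ?thesis
      using P[OF pos(1)] P[OF pos(2)] P[OF pos(3)] P[OF pos(4)] e
      unfolding Gamma_series_def q_def by (simp add: L_def field_simps)
  qed
  ultimately have "(\<lambda>n. q (Suc n)) \<longlonglongrightarrow> Gamma c * Gamma d / (Gamma a * Gamma b)" by simp
  then have "q \<longlonglongrightarrow> Gamma c * Gamma d / (Gamma a * Gamma b)" by (rule LIMSEQ_imp_Suc)
  then have "Bseq q" by (intro convergent_imp_Bseq convergentI)
  then obtain D where D: "D > 0" "\<And>j. norm (q j) \<le> D" by (auto simp: Bseq_def)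
  have "pochhammer a j * pochhammer b j \<le> D * (pochhammer c j * pochhammer d j)" for j
  proof -
    have "pochhammer c j * pochhammer d j > 0" using pos by (intro mult_pos_pos pochhammer_pos)
    moreover have "q j \<le> D" using D(2)[of j] by simp
    ultimately show ?thesis by (simp add: q_def pos_divide_le_eq)
  qed
  then show ?thesis using D(1) by blast
qed


lemma poch_ratio_le_1:
  assumes "0 < a" "a \<le> b" shows "0 < poch_ratio a b k" "poch_ratio a b k \<le> 1"
proof -
  have "pochhammer a k > 0" "pochhammer b k > 0" using assms by (auto intro: pochhammer_pos)
  moreover have "pochhammer a k \<le> pochhammer b k"
    unfolding pochhammer_prod using assms by (intro prod_mono) auto
  ultimately show "0 < poch_ratio a b k" "poch_ratio a b k \<le> 1" by (auto simp: poch_ratio_def)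
qed

lemma has_integral_Beta_moment:
  assumes "a > 0" "v > (0::real)"
  shows "((\<lambda>r. r ^ k * (r powr (a - 1) * (1 - r) powr (v - 1))) has_integral
     (Beta a v * poch_ratio a (a + v) k)) {0..1}"
proof -
  have "((\<lambda>r. r powr (a + real k - 1) * (1 - r) powr (v - 1)) has_integral Beta (a + real k) v) {0..1}"
    using assms by (intro has_integral_Beta_real) auto
  moreover have "r powr (a + real k - 1) * (1 - r) powr (v - 1) = r ^ k * (r powr (a - 1) * (1 - r) powr (v - 1))"
    if "r \<in> {0..1}" for r
  proof (cases "r = 0")
    case False
    then have "r powr (a + real k - 1) = r powr (a - 1) * r powr real k" by (simp add: powr_add[symmetric] algebra_simps)
    then show ?thesis using False that by (simp add: powr_realpow mult_ac)
  qed simp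
  ultimately have "((\<lambda>r. r ^ k * (r powr (a - 1) * (1 - r) powr (v - 1))) has_integral Beta (a + real k) v) {0..1}"
    by (rule has_integral_eq[rotated]) auto
  moreover have "Beta (a + real k) v = Beta a v * poch_ratio a (a + v) k"
  proof -
    have "a \<notin> \<int>\<^sub>\<le>\<^sub>0" "a + v \<notin> \<int>\<^sub>\<le>\<^sub>0" using assms by (auto elim!: nonpos_Ints_cases)
    then have "pochhammer a k = Gamma (a + real k) / Gamma a" "pochhammer (a + v) k = Gamma (a + v + real k) / Gamma (a + v)"
      by (simp_all add: pochhammer_Gamma)
    moreover have "Gamma a > 0" "Gamma (a + v) > 0" "Gamma (a + v + real k) > 0"
      using assms by (auto intro!: Gamma_real_pos add_pos_nonneg)
    ultimately show ?thesis by (simp add: Beta_def poch_ratio_def field_simps)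
  qed
  ultimately show ?thesis by simp
qed

lemma Beta_real_pos: "a > 0 \<Longrightarrow> v > 0 \<Longrightarrow> Beta a v > (0::real)"
  unfolding Beta_def by (intro divide_pos_pos mult_pos_pos Gamma_real_pos) auto

text \<open>The ratio is a moment sequence of a Beta distribution, so the multiplier averages over the radius;
  expanding the bound \<open>(1 - r\<bar>x\<bar>)\<^sup>-\<^sup>A\<close> in a binomial series evaluates the average.\<close>

lemma multiplier_poch_ratio_less:
  assumes a: "a > 0" and v: "v > 0"
  shows "multiplier TYPE('a::euclidean_space) (poch_ratio a (a + v)) (- v)"
proof -
  have bd: "\<bar>poch_ratio a (a + v) k\<bar> \<le> 1" for k
    using poch_ratio_le_1[of a "a + v" k] a v by simp
  show ?thesis
    unfolding multiplier_def
  proof (intro conjI allI impI)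
    fix F :: "nat \<Rightarrow> 'a \<Rightarrow> complex" assume "expansion F"
    then show "expansion (emul (poch_ratio a (a + v)) F)" by (rule expansion_emul_bounded) (rule bd)
  next
    fix A :: real assume A: "A > 0" "A + - v > 0"
    define m where "m = poch_ratio a (a + v)"
    \<comment> \<open>The balance A + a = (A - v) + (a + v) makes this applicable: the averaged
      binomial coefficients of exponent A are bounded by those of exponent A - v, which is positive
      by assumption.\<close>
    obtain D where D: "D > 0" "\<And>j. pochhammer A j * pochhammer a j \<le> D * (pochhammer (A - v) j * pochhammer (a + v) j)"
      using pochhammer_quotient_bounded[of A a "A - v" "a + v"] A a v by auto
    show "\<exists>C\<ge>0. \<forall>(F :: nat \<Rightarrow> 'a \<Rightarrow> complex) K.
          expansion F \<longrightarrow> K \<ge> 0 \<longrightarrow> growth A K F \<longrightarrow> growth (A + - v) (C * K) (emul (poch_ratio a (a + v)) F)"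
    proof (rule exI[of _ D], intro conjI allI impI)
      show "D \<ge> 0" using D by simp
      fix F :: "nat \<Rightarrow> 'a \<Rightarrow> complex" and K :: real
      assume F: "expansion F" and K: "K \<ge> 0" and g: "growth A K F"
      show "growth (A + - v) (D * K) (emul (poch_ratio a (a + v)) F)"
        unfolding growth_def
      proof (intro allI impI)
        fix x :: 'a assume x: "norm x < 1"
        define p where "p = norm x"
        have p: "0 \<le> p" "p < 1" using x by (auto simp: p_def)
        define w where "w r = r powr (a - 1) * (1 - r) powr (v - 1)" for r :: real
        define t where "t j = pochhammer A j / fact j * p ^ j" for j
        have t0: "t j \<ge> 0" for j unfolding t_def using A p by (intro mult_nonneg_nonneg divide_nonneg_nonneg pochhammer_nonneg) auto
        have t: "t sums (1 - p) powr (- A)" unfolding t_def[abs_def] using p by (intro negative_binomial_sums) auto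
        define eta where "eta N = (\<Sum>j. t (j + N))" for N
        define eps where "eps N = (\<Sum>j. norm (F (j + N) x))" for N
        define B where "B = Beta a v"
        have B: "B > 0" unfolding B_def using a v by (rule Beta_real_pos)
        have sF: "summable (\<lambda>k. norm (F k x))" using expansion_summable_norm[OF F x] .
        have moment: "((\<lambda>r. r ^ k * w r) has_integral (B * m k)) {0..1}" for k
          unfolding w_def B_def m_def using has_integral_Beta_moment[OF a v] .
        have w0: "w r \<ge> 0" for r by (simp add: w_def)
        have scale: "norm (r *\<^sub>R x) \<le> p" "norm (r *\<^sub>R x) < 1" "norm (r *\<^sub>R x) = r * p" if "r \<in> {0..1}" for r
          using that p mult_right_mono[of r 1 p] by (auto simp: p_def)
        \<comment> \<open>Truncating at \<open>N\<close> reduces the integration over the radius to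
          finite sums; the tails \<open>eta N\<close> and \<open>eps N\<close> do not depend on the
          radius and vanish as \<open>N\<close> grows.\<close>
        have point: "norm (\<Sum>k<N. r ^ k *\<^sub>R F k x) \<le> K * (\<Sum>j<N. t j * r ^ j) + (K * eta N + eps N)"
          if r: "r \<in> {0..1}" for r N
        proof -
          have hom: "F k (r *\<^sub>R x) = r ^ k *\<^sub>R F k x" for k
            using expansion_hom[OF F, of k r x] by (simp add: scaleR_conv_of_real)
          have tail: "norm (F k (r *\<^sub>R x)) \<le> norm (F k x)" for k
            unfolding hom norm_scaleR using r by (auto intro!: mult_left_le_one_le power_le_one)
          have s1: "summable (\<lambda>k. F k (r *\<^sub>R x))" by (rule expansion_summable[OF F scale(2)[OF r]])
          have s2: "summable (\<lambda>k. norm (F (k + N) (r *\<^sub>R x)))"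
            using summable_ignore_initial_segment[OF expansion_summable_norm[OF F scale(2)[OF r]]] .
          have "esum F (r *\<^sub>R x) = (\<Sum>k. F (k + N) (r *\<^sub>R x)) + (\<Sum>k<N. F k (r *\<^sub>R x))"
            using suminf_split_initial_segment[OF s1, of N] scale(2)[OF r] by (simp add: esum_def)
          then have "norm (\<Sum>k<N. F k (r *\<^sub>R x)) \<le> norm (esum F (r *\<^sub>R x)) + norm (\<Sum>k. F (k + N) (r *\<^sub>R x))"
            by (metis add_diff_cancel_left' norm_triangle_ineq4)
          also have "norm (\<Sum>k. F (k + N) (r *\<^sub>R x)) \<le> eps N"
            unfolding eps_def using summable_norm[OF s2] suminf_le[OF tail s2 summable_ignore_initial_segment[OF sF]]
            by (rule order_trans)
          also have "norm (esum F (r *\<^sub>R x)) \<le> K * (1 - r * p) powr (- A)"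
            using g scale(2,3)[OF r] unfolding growth_def by metis
          also have "(1 - r * p) powr (- A) \<le> (\<Sum>j<N. t j * r ^ j) + eta N"
          proof -
            have "(\<lambda>j. pochhammer A j / fact j * (r * p) ^ j) sums (1 - r * p) powr (- A)"
              using scale(2,3)[OF r] r p by (intro negative_binomial_sums) auto
            then have s: "(\<lambda>j. t j * r ^ j) sums (1 - r * p) powr (- A)"
              by (simp add: t_def power_mult_distrib mult_ac)
            have "(1 - r * p) powr (- A) = (\<Sum>j. t (j + N) * r ^ (j + N)) + (\<Sum>j<N. t j * r ^ j)"
              using suminf_split_initial_segment[OF sums_summable[OF s], of N] sums_unique[OF s] by simp
            also have "(\<Sum>j. t (j + N) * r ^ (j + N)) \<le> eta N"
              unfolding eta_def
            proof (rule suminf_le)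
              show "t (j + N) * r ^ (j + N) \<le> t (j + N)" for j
                using r t0 by (auto intro!: mult_left_le power_le_one)
            qed (use sums_summable[OF s] sums_summable[OF t] in \<open>auto intro: summable_ignore_initial_segment\<close>)
            finally show ?thesis by simp
          qed
          finally have "norm (\<Sum>k<N. F k (r *\<^sub>R x)) \<le> K * ((\<Sum>j<N. t j * r ^ j) + eta N) + eps N"
            using K by (simp add: mult_left_mono)
          then show ?thesis unfolding hom by (simp add: algebra_simps)
        qed
        \<comment> \<open>Integration of \<open>point\<close> against the unnormalized Beta density
          \<open>w\<close>, whose k-th moment is \<open>B * m k\<close>; the factor \<open>B\<close>
          is divided out at the end.\<close>
        have part: "norm (\<Sum>k<N. of_real (m k) * F k x) \<le> K * (\<Sum>j<N. t j * m j) + (K * eta N + eps N)" for N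
        proof -
          have I: "((\<lambda>r. \<Sum>k<N. (r ^ k * w r) *\<^sub>R F k x) has_integral (\<Sum>k<N. (B * m k) *\<^sub>R F k x)) {0..1}"
            by (intro has_integral_sum has_integral_scaleR_left moment) auto
          have J: "((\<lambda>r. (\<Sum>j<N. (K * t j) * (r ^ j * w r)) + (K * eta N + eps N) * (r ^ 0 * w r)) has_integral
              ((\<Sum>j<N. (K * t j) * (B * m j)) + (K * eta N + eps N) * (B * m 0))) {0..1}"
            by (intro has_integral_add has_integral_sum has_integral_mult_right moment) auto
          have "norm (\<Sum>k<N. (B * m k) *\<^sub>R F k x) \<le> (\<Sum>j<N. (K * t j) * (B * m j)) + (K * eta N + eps N) * (B * m 0)"
          proof -
            have "norm (\<Sum>k<N. (r ^ k * w r) *\<^sub>R F k x)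
                \<le> (\<Sum>j<N. (K * t j) * (r ^ j * w r)) + (K * eta N + eps N) * (r ^ 0 * w r)" if r: "r \<in> {0..1}" for r
            proof -
              have "(\<Sum>k<N. (r ^ k * w r) *\<^sub>R F k x) = w r *\<^sub>R (\<Sum>k<N. r ^ k *\<^sub>R F k x)"
                by (simp add: scaleR_sum_right mult.commute)
              then have "norm (\<Sum>k<N. (r ^ k * w r) *\<^sub>R F k x) = w r * norm (\<Sum>k<N. r ^ k *\<^sub>R F k x)"
                using w0[of r] by simp
              also have "\<dots> \<le> w r * (K * (\<Sum>j<N. t j * r ^ j) + (K * eta N + eps N))"
                using w0 point[OF r] by (intro mult_left_mono) auto
              also have "\<dots> = (\<Sum>j<N. (K * t j) * (r ^ j * w r)) + (K * eta N + eps N) * (r ^ 0 * w r)"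
                by (simp add: distrib_left sum_distrib_left mult_ac)
              finally show ?thesis .
            qed
            from has_integral_norm_bound_integral_component[OF I J, of 1] this show ?thesis by simp
          qed
          then have "B * norm (\<Sum>k<N. of_real (m k) * F k x) \<le> B * (K * (\<Sum>j<N. t j * m j) + (K * eta N + eps N))"
          proof -
            have "(\<Sum>k<N. (B * m k) *\<^sub>R F k x) = of_real B * (\<Sum>k<N. of_real (m k) * F k x)"
              by (simp add: sum_distrib_left scaleR_conv_of_real mult.assoc)
            then have 1: "norm (\<Sum>k<N. (B * m k) *\<^sub>R F k x) = B * norm (\<Sum>k<N. of_real (m k) * F k x)"
              using B by (simp add: norm_mult)
            have 2: "(\<Sum>j<N. (K * t j) * (B * m j)) + (K * eta N + eps N) * (B * m 0)
                = B * (K * (\<Sum>j<N. t j * m j) + (K * eta N + eps N))"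
              by (simp add: m_def poch_ratio_def distrib_left sum_distrib_left mult_ac)
            assume "norm (\<Sum>k<N. (B * m k) *\<^sub>R F k x) \<le> (\<Sum>j<N. (K * t j) * (B * m j)) + (K * eta N + eps N) * (B * m 0)"
            then show ?thesis unfolding 1 2 .
          qed
          then show ?thesis using B by (simp only: mult_le_cancel_left_pos)
        qed
        define u where "u j = pochhammer (A - v) j / fact j * p ^ j" for j
        have u0: "u j \<ge> 0" for j unfolding u_def using A p by (intro mult_nonneg_nonneg divide_nonneg_nonneg pochhammer_nonneg) auto
        have u: "u sums (1 - p) powr (- (A - v))" unfolding u_def[abs_def] using p by (intro negative_binomial_sums) auto
        have tm: "t j * m j \<le> D * u j" for j
        proof -
          have pp: "pochhammer (a + v) j > 0" using a v by (intro pochhammer_pos) simp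
          have "t j * m j = (pochhammer A j * pochhammer a j) / pochhammer (a + v) j * (p ^ j / fact j)"
            by (simp add: t_def m_def poch_ratio_def mult_ac)
          also have "\<dots> \<le> (D * (pochhammer (A - v) j * pochhammer (a + v) j)) / pochhammer (a + v) j * (p ^ j / fact j)"
            using D(2)[of j] pp p by (intro mult_right_mono divide_right_mono) auto
          also have "\<dots> = D * u j" using pp by (simp add: u_def)
          finally show ?thesis .
        qed
        have est: "norm (\<Sum>k<N. of_real (m k) * F k x) \<le> D * K * (1 - p) powr (- (A - v)) + (K * eta N + eps N)" for N
        proof -
          have "(\<Sum>j<N. t j * m j) \<le> (\<Sum>j<N. D * u j)" using tm by (intro sum_mono) auto
          also have "\<dots> = D * (\<Sum>j<N. u j)" by (simp add: sum_distrib_left)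
          also have "\<dots> \<le> D * (1 - p) powr (- (A - v))"
            using D(1) u0 u sum_le_suminf[OF sums_summable[OF u], of "{..<N}"] sums_unique[OF u]
            by (intro mult_left_mono) auto
          finally have "K * (\<Sum>j<N. t j * m j) \<le> K * (D * (1 - p) powr (- (A - v)))" using K by (intro mult_left_mono)
          then show ?thesis using part[of N] by (simp add: mult_ac)
        qed
        have tailz: "(\<lambda>N. \<Sum>j. c (j + N)) \<longlonglongrightarrow> 0" if "summable c" for c :: "nat \<Rightarrow> real"
        proof -
          have "(\<lambda>N. suminf c - (\<Sum>j<N. c j)) \<longlonglongrightarrow> suminf c - suminf c"
            using summable_LIMSEQ[OF that] by (intro tendsto_intros)
          then show ?thesis using suminf_minus_initial_segment[OF that] by simp
        qed
        have lim: "(\<lambda>N. D * K * (1 - p) powr (- (A - v)) + (K * eta N + eps N)) \<longlonglongrightarrow>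
            D * K * (1 - p) powr (- (A - v)) + (K * 0 + 0)"
          unfolding eta_def eps_def using sums_summable[OF t] sF by (intro tendsto_intros tailz)
        have expm: "expansion (emul m F)" unfolding m_def by (rule expansion_emul_bounded[OF F bd])
        have "(\<lambda>N. \<Sum>k<N. of_real (m k) * F k x) \<longlonglongrightarrow> esum (emul m F) x"
          using expansion_sums[OF expm x] unfolding sums_def emul_def .
        from tendsto_norm[OF this] have "norm (esum (emul m F) x) \<le> D * K * (1 - p) powr (- (A - v)) + (K * 0 + 0)"
          by (rule LIMSEQ_le[OF _ lim]) (use est in blast)
        then show "norm (esum (emul (poch_ratio a (a + v)) F) x) \<le> D * K * (1 - norm x) powr (- (A + - v))"
          by (simp add: m_def p_def)
      qed
    qed
qed
qed

text \<open>Raising \<open>b\<close> by unit steps, each compensated by a linear multiplier of order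
  1, reaches a base no smaller than \<open>a\<close>, where the averaging case or the constant 1
  applies. \<open>N\<close> bounds the number of steps.\<close>

lemma multiplier_poch_ratio:
  assumes "a > 0" "b > 0"
  shows "multiplier TYPE('a::euclidean_space) (poch_ratio a b) (a - b)"
proof -
  have "multiplier TYPE('a) (poch_ratio a b) (a - b)" if "a \<le> b + real N" "b > 0" for N b
    using that
  proof (induction N arbitrary: b)
    case 0
    show ?case
    proof (cases "a = b")
      case True
      have "poch_ratio a b = (\<lambda>k. 1)"
        using True pochhammer_pos[OF assms(1)] by (auto simp: poch_ratio_def fun_eq_iff less_imp_neq[symmetric])
      then show ?thesis using True multiplier_const[of 1, where 'a='a] by simp
    next
      case False
      then have "b - a > 0" using 0 by simp
      from multiplier_poch_ratio_less[OF assms(1) this, where 'a='a] show ?thesis by simp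
    qed
  next
    case (Suc N)
    have "multiplier TYPE('a) (\<lambda>k. poch_ratio a (b + 1) k * poch_ratio (b + 1) b k) ((a - (b + 1)) + 1)"
      using Suc by (intro multiplier_mult Suc.IH multiplier_poch_ratio_step) auto
    moreover have "(\<lambda>k. poch_ratio a (b + 1) k * poch_ratio (b + 1) b k) = poch_ratio a b"
    proof
      fix k
      have "pochhammer (b + 1) k > 0" using Suc.prems by (intro pochhammer_pos) simp
      then show "poch_ratio a (b + 1) k * poch_ratio (b + 1) b k = poch_ratio a b k" by (simp add: poch_ratio_def)
    qed
    ultimately show ?case by simp
  qed
  moreover obtain N where "a \<le> real N" using real_arch_simple by blast
  ultimately show ?thesis using assms(2) by (metis add.commute add_increasing2 less_imp_le)
qed

text \<open>One branch has b = 1, the other a = 1; both give positive bases with the same difference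
  n/2 + s and the same remaining factor.\<close>

lemma gamma_coeff_poch_ratio:
  obtains a b where "a > 0" "b > 0" "a - b = real n / 2 + s"
    "\<And>k. gamma_coeff n s k = poch_ratio a b k * (pochhammer 1 k / pochhammer (real n / 2) k)"
proof (cases "s > - (1 + real n / 2)")
  case True
  have "pochhammer (1::real) k > 0" for k by (rule pochhammer_pos) simp
  then have "gamma_coeff n s k = poch_ratio (1 + real n / 2 + s) 1 k * (pochhammer 1 k / pochhammer (real n / 2) k)" for k
    using True by (simp add: gamma_coeff_def poch_ratio_def less_imp_neq[symmetric])
  then show thesis using True by (intro that[of "1 + real n / 2 + s" 1]) auto
next
  case False
  have "gamma_coeff n s k = poch_ratio 1 (1 - (real n / 2 + s)) k * (pochhammer 1 k / pochhammer (real n / 2) k)" for k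
    using False by (simp add: gamma_coeff_def poch_ratio_def power2_eq_square)
  then show thesis using False by (intro that[of 1 "1 - (real n / 2 + s)"]) auto
qed

lemma gamma_coeff_pos:
  assumes "n > 0" shows "gamma_coeff n s k > 0"
proof -
  obtain a b where ab: "a > 0" "b > 0" "a - b = real n / 2 + s"
    "\<And>k. gamma_coeff n s k = poch_ratio a b k * (pochhammer 1 k / pochhammer (real n / 2) k)"
    by (rule gamma_coeff_poch_ratio[of n s]) blast
  show ?thesis unfolding ab(4) poch_ratio_def using assms ab(1,2)
    by (intro mult_pos_pos divide_pos_pos pochhammer_pos) auto
qed

text \<open>The common factor cancels, leaving \<open>poch_ratio a' b'\<close> times
  \<open>poch_ratio b a\<close>, of total order (a' - b') - (a - b) = s' - s.\<close>

lemma multiplier_gamma_quotient: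
  assumes "n > 0"
  shows "multiplier TYPE('a::euclidean_space) (\<lambda>k. gamma_coeff n s' k / gamma_coeff n s k) (s' - s)"
proof -
  obtain a b where ab: "a > 0" "b > 0" "a - b = real n / 2 + s"
    "\<And>k. gamma_coeff n s k = poch_ratio a b k * (pochhammer 1 k / pochhammer (real n / 2) k)"
    by (rule gamma_coeff_poch_ratio[of n s]) blast
  obtain a' b' where ab': "a' > 0" "b' > 0" "a' - b' = real n / 2 + s'"
    "\<And>k. gamma_coeff n s' k = poch_ratio a' b' k * (pochhammer 1 k / pochhammer (real n / 2) k)"
    by (rule gamma_coeff_poch_ratio[of n s']) blast
  have "gamma_coeff n s' k / gamma_coeff n s k = poch_ratio a' b' k * poch_ratio b a k" for k
  proof -
    define c where "c = pochhammer (1::real) k / pochhammer (real n / 2) k"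
    have "c > 0" unfolding c_def using assms by (intro divide_pos_pos pochhammer_pos) auto
    then have "gamma_coeff n s' k / gamma_coeff n s k = poch_ratio a' b' k / poch_ratio a b k"
      unfolding ab(4) ab'(4) c_def[symmetric] by simp
    then show ?thesis by (simp add: poch_ratio_def)
  qed
  moreover have "multiplier TYPE('a) (\<lambda>k. poch_ratio a' b' k * poch_ratio b a k) ((a' - b') + (b - a))"
    using ab ab' by (intro multiplier_mult multiplier_poch_ratio)
  moreover have "(a' - b') + (b - a) = s' - s" using ab(3) ab'(3) by simp
  ultimately show ?thesis by simp
qed

section \<open>Little-o growth and dilations\<close>

definition vanishing :: "real \<Rightarrow> (nat \<Rightarrow> 'a::euclidean_space \<Rightarrow> complex) \<Rightarrow> bool" where
  "vanishing A F \<longleftrightarrow>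
     (\<forall>e>0. \<exists>r<1. \<forall>x. r < norm x \<and> norm x < 1 \<longrightarrow> norm (esum F x) < e * (1 - norm x) powr (- A))"

text \<open>On |x| \<le> T uniform continuity bounds F(x) - F(r x), and (1 - |x|)^-A is at least 1.
  For |x| > T both points lie beyond the radius R from which F is small relative to the weight, and
  the weight at r x does not exceed that at x.\<close>

lemma vanishing_dilation:
  fixes F :: "nat \<Rightarrow> 'a::euclidean_space \<Rightarrow> complex"
  assumes F: "expansion F" and A: "A > 0" and van: "vanishing A F" and e: "e > 0"
  obtains r where "0 < r" "r < 1" "growth A e (\<lambda>k x. F k x - F k (r *\<^sub>R x))"
proof -
  from van e obtain R0 where R0: "R0 < 1" "\<And>x. R0 < norm x \<Longrightarrow> norm x < 1 \<Longrightarrow>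
      norm (esum F x) < (e / 2) * (1 - norm x) powr (- A)"
    unfolding vanishing_def by (meson half_gt_zero)
  define R where "R = max R0 0"
  have R: "0 \<le> R" "R < 1" "\<And>x. R < norm x \<Longrightarrow> norm x < 1 \<Longrightarrow> norm (esum F x) < (e / 2) * (1 - norm x) powr (- A)"
    using R0 by (auto simp: R_def)
  define T where "T = (1 + R) / 2"
  have T: "R < T" "T < 1" "0 < T" using R by (auto simp: T_def)
  have "uniformly_continuous_on (cball 0 T) (esum F)"
  proof (rule compact_uniformly_continuous)
    show "continuous_on (cball 0 T) (esum F)"
      by (rule continuous_on_subset[OF continuous_on_esum[OF F]]) (use T in auto)
  qed simp
  then obtain d where d: "d > 0" "\<And>x y. norm x \<le> T \<Longrightarrow> norm y \<le> T \<Longrightarrow> dist y x < d \<Longrightarrow> dist (esum F y) (esum F x) < e"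
    unfolding uniformly_continuous_on_def using e by (metis mem_cball_0)
  \<comment> \<open>The three terms force |x - r x| < d, keep r x beyond \<open>R\<close> when |x| >
    \<open>T\<close>, and make \<open>r\<close> positive.\<close>
  define r where "r = max (1 - d / 2) (max (R / T) (1 / 2))"
  have r: "0 < r" "r < 1" "r * T \<ge> R" "1 - r < d"
  proof -
    have "1 / 2 \<le> r" "1 - d / 2 \<le> r" unfolding r_def le_max_iff_disj by simp_all
    then show "0 < r" "1 - r < d" using d by simp_all
    show "r < 1" using d T R by (auto simp: r_def)
    have "R / T \<le> r" by (simp add: r_def)
    then show "r * T \<ge> R" using T by (simp add: pos_divide_le_eq)
  qed
  have small: "norm (r *\<^sub>R x) \<le> norm x" for x :: 'a using r by (simp add: mult_left_le_one_le)
  have "norm (esum F x - esum F (r *\<^sub>R x)) \<le> e * (1 - norm x) powr (- A)" if x: "norm x < 1" for x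
  proof (cases "norm x \<le> T")
    case True
    have "dist (r *\<^sub>R x) x = (1 - r) * norm x"
    proof -
      have "r *\<^sub>R x - x = (r - 1) *\<^sub>R x" by (simp add: algebra_simps)
      then show ?thesis using r by (simp add: dist_norm)
    qed
    also have "\<dots> \<le> (1 - r) * 1" using r x by (intro mult_left_mono) auto
    finally have "dist (r *\<^sub>R x) x < d" using r by simp
    then have "norm (esum F x - esum F (r *\<^sub>R x)) < e"
      using d(2)[of x "r *\<^sub>R x"] True small[of x] by (simp add: dist_norm norm_minus_commute)
    also have "e * 1 \<le> e * (1 - norm x) powr (- A)"
      using e A x by (intro mult_left_mono) (auto simp: powr_minus_divide powr_le1)
    finally show ?thesis by simp
  next
    case False
    have "r * T < r * norm x" using False r by (intro mult_strict_left_mono) auto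
    then have rx: "R < norm (r *\<^sub>R x)" using r by (simp only: norm_scaleR abs_of_pos)
    have "norm (esum F (r *\<^sub>R x)) < (e / 2) * (1 - norm (r *\<^sub>R x)) powr (- A)"
      using rx small[of x] x by (intro R(3)) auto
    also have "\<dots> \<le> (e / 2) * (1 - norm x) powr (- A)"
      using e A x small[of x] by (intro mult_left_mono powr_mono2') auto
    finally have 1: "norm (esum F (r *\<^sub>R x)) < (e / 2) * (1 - norm x) powr (- A)" .
    have "norm (esum F x) < (e / 2) * (1 - norm x) powr (- A)"
      using False T x by (intro R(3)) auto
    then have "norm (esum F x - esum F (r *\<^sub>R x)) \<le> (e / 2) * (1 - norm x) powr (- A) + (e / 2) * (1 - norm x) powr (- A)"
      using 1 norm_triangle_ineq4[of "esum F x" "esum F (r *\<^sub>R x)"] by linarith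
    then show ?thesis by (simp add: algebra_simps)
  qed
  then have "growth A e (\<lambda>k x. F k x - F k (r *\<^sub>R x))"
    unfolding growth_def using r expansion_scale[OF F, of r]
    by (simp add: esum_diff[OF F] esum_scale[OF F])
  then show thesis using that r by blast
qed

text \<open>Dilates extend past the sphere, so their multiplier images are bounded.\<close>

lemma vanishing_emul:
  fixes F :: "nat \<Rightarrow> 'a::euclidean_space \<Rightarrow> complex"
  assumes m: "multiplier TYPE('a) m u" and A: "A > 0" "A + u > 0"
    and F: "expansion F" and van: "vanishing A F"
  shows "vanishing (A + u) (emul m F)"
  unfolding vanishing_def
proof (intro allI impI)
  fix e :: real assume e: "e > 0"
  obtain C where C: "C \<ge> 0" "\<And>(F :: nat \<Rightarrow> 'a \<Rightarrow> complex) K.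
    expansion F \<Longrightarrow> K \<ge> 0 \<Longrightarrow> growth A K F \<Longrightarrow> growth (A + u) (C * K) (emul m F)"
    using multiplierE[OF m A] by blast
  \<comment> \<open>Keeps the image of the difference below 3/4 e relative to the weight; with e/8
    from the dilate the total stays below e. The summand 1 covers C = 0.\<close>
  define e' where "e' = e / (2 * (C + 1))"
  have e': "e' > 0" "C * e' < e / 2 + e / 4"
  proof -
    show e0: "e' > 0" using e C by (simp add: e'_def)
    have "(C + 1) * e' = e / 2" using C by (simp add: e'_def field_simps add_nonneg_eq_0_iff)
    then show "C * e' < e / 2 + e / 4" using e0 e by (simp add: algebra_simps)
  qed
  from vanishing_dilation[OF F A(1) van e'(1)] obtain r where
    r: "0 < r" "r < 1" "growth A e' (\<lambda>k x. F k x - F k (r *\<^sub>R x))" .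
  have Fr: "expansion (\<lambda>k x. F k (r *\<^sub>R x))" using expansion_scale[OF F] r by simp
  have mF: "expansion (emul m F)" using multiplier_expansion[OF m F] .
  have mFr: "expansion (emul m (\<lambda>k x. F k (r *\<^sub>R x)))" using multiplier_expansion[OF m Fr] .
  have gd: "growth (A + u) (C * e') (emul m (\<lambda>k x. F k x - F k (r *\<^sub>R x)))"
    using C(2)[OF expansion_diff[OF F Fr] _ r(3)] e' by simp
  have emd: "esum (emul m (\<lambda>k x. F k x - F k (r *\<^sub>R x))) x = esum (emul m F) x - esum (emul m F) (r *\<^sub>R x)"
    if "norm x < 1" for x
  proof -
    have "emul m (\<lambda>k x. F k x - F k (r *\<^sub>R x)) = (\<lambda>k x. emul m F k x - emul m F k (r *\<^sub>R x))"
      by (simp add: emul_def right_diff_distrib)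
    then show ?thesis
      using esum_diff[OF mF expansion_scale[OF mF, of r], of x] esum_scale[OF mF, of r x] r that by simp
  qed
  have "compact (esum (emul m F) ` cball 0 r)"
    using r by (intro compact_continuous_image continuous_on_subset[OF continuous_on_esum[OF mF]]) auto
  then obtain M where M: "M > 0" "\<And>x. norm x \<le> r \<Longrightarrow> norm (esum (emul m F) x) \<le> M"
    using compact_imp_bounded bounded_pos by (metis (no_types, lifting) image_eqI mem_cball_0)
  \<comment> \<open>Within distance \<open>d\<close> of the sphere the bound \<open>M\<close> is at
    most e/8 times (1 - |x|)^-(A + u), because A + u > 0.\<close>
  define d where "d = (e / (8 * M)) powr (1 / (A + u))"
  have d: "d > 0" using e M by (simp add: d_def)
  show "\<exists>r<1. \<forall>x. r < norm x \<and> norm x < 1 \<longrightarrow>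
      norm (esum (emul m F) x) < e * (1 - norm x) powr (- (A + u))"
  proof (rule exI[of _ "1 - d"], intro conjI allI impI)
    fix x :: 'a assume x: "1 - d < norm x \<and> norm x < 1"
    define P where "P = (1 - norm x) powr (- (A + u))"
    have P: "P > 0" using x by (simp add: P_def)
    have "(1 - norm x) powr (A + u) \<le> d powr (A + u)" using x A by (intro powr_mono2) auto
    also have "\<dots> = e / (8 * M)" using A e M by (simp add: d_def powr_powr)
    finally have "(1 - norm x) powr (A + u) \<le> e / (8 * M)" .
    moreover have "(1 - norm x) powr (A + u) * P = 1"
      unfolding P_def powr_minus by (rule right_inverse) (use x in simp)
    ultimately have "1 \<le> e / (8 * M) * P" using P by (metis mult_right_mono less_imp_le)
    then have "M \<le> e / 8 * P" using M by (simp add: field_simps)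
    moreover have "norm (esum (emul m F) (r *\<^sub>R x)) \<le> M"
    proof (rule M(2))
      show "norm (r *\<^sub>R x) \<le> r" using r x by (simp add: mult_left_le)
    qed
    moreover have "norm (esum (emul m F) x - esum (emul m F) (r *\<^sub>R x)) \<le> C * e' * P"
      using gd[unfolded growth_def, rule_format, of x] emd[of x] x unfolding P_def by simp
    moreover have "C * e' * P \<le> (e / 2 + e / 4) * P" using e' P by (intro mult_right_mono) auto
    moreover have "norm (esum (emul m F) x) \<le> norm (esum (emul m F) x - esum (emul m F) (r *\<^sub>R x)) + norm (esum (emul m F) (r *\<^sub>R x))"
      using norm_triangle_sub[of "esum (emul m F) x" "esum (emul m F) (r *\<^sub>R x)"] by simp
    ultimately have "norm (esum (emul m F) x) \<le> (e / 2 + e / 4) * P + e / 8 * P" by linarith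
    also have "\<dots> < e * P" using e P by (simp add: algebra_simps)
    finally show "norm (esum (emul m F) x) < e * (1 - norm x) powr (- (A + u))" by (simp add: P_def)
  qed (use d in simp)
qed

section \<open>Boundary decay from integrable errors\<close>

lemma nn_integral_affine:
  fixes f :: "'a::euclidean_space \<Rightarrow> ennreal"
  assumes [measurable]: "f \<in> borel_measurable borel" and c: "c \<noteq> 0"
  shows "(\<integral>\<^sup>+z. f z \<partial>lborel) = ennreal (\<bar>c\<bar> ^ DIM('a)) * (\<integral>\<^sup>+y. f (t + c *\<^sub>R y) \<partial>lborel)"
proof -
  have "(\<integral>\<^sup>+z. f z \<partial>lborel) = (\<integral>\<^sup>+z. f z \<partial>density (distr lborel borel (\<lambda>x. t + c *\<^sub>R x)) (\<lambda>_. ennreal (\<bar>c\<bar> ^ DIM('a))))"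
    using lborel_affine[OF c, of t] by (simp add: ennreal_power)
  also have "\<dots> = (\<integral>\<^sup>+z. ennreal (\<bar>c\<bar> ^ DIM('a)) * f z \<partial>distr lborel borel (\<lambda>x. t + c *\<^sub>R x))"
    by (rule nn_integral_density) auto
  also have "\<dots> = ennreal (\<bar>c\<bar> ^ DIM('a)) * (\<integral>\<^sup>+z. f z \<partial>distr lborel borel (\<lambda>x. t + c *\<^sub>R x))"
    by (rule nn_integral_cmult) auto
  also have "(\<integral>\<^sup>+z. f z \<partial>distr lborel borel (\<lambda>x. t + c *\<^sub>R x)) = (\<integral>\<^sup>+y. f (t + c *\<^sub>R y) \<partial>lborel)"
    by (rule nn_integral_distr) auto
  finally show ?thesis .
qed

text \<open>Continuity from above of the measure with density \<open>h\<close>, on shells decreasing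
  to the empty set.\<close>

lemma nn_integral_tail:
  fixes h :: "'a::euclidean_space \<Rightarrow> ennreal"
  assumes [measurable]: "h \<in> borel_measurable borel"
    and fin: "(\<integral>\<^sup>+z. h z * indicator (ball 0 1) z \<partial>lborel) < \<infinity>" and e: "(e::ennreal) > 0"
  obtains r where "r < 1" "(\<integral>\<^sup>+z. h z * indicator {z. r < norm z \<and> norm z < 1} z \<partial>lborel) < e"
proof -
  define A where "A i = {z::'a. 1 - 1 / real (Suc i) < norm z \<and> norm z < 1}" for i
  have A[measurable]: "A i \<in> sets borel" for i unfolding A_def by measurable
  define M where "M = density lborel h"
  have eM: "emeasure M S = (\<integral>\<^sup>+z. h z * indicator S z \<partial>lborel)" if "S \<in> sets borel" for S
    unfolding M_def using that by (simp add: emeasure_density)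
  have finA: "emeasure M (A i) \<noteq> \<infinity>" for i
  proof -
    have "emeasure M (A i) \<le> emeasure M (ball 0 1)"
      by (rule emeasure_mono) (auto simp: A_def M_def)
    also have "\<dots> < \<infinity>" using fin eM[of "ball 0 1"] by simp
    finally show ?thesis by simp
  qed
  have "(\<lambda>i. emeasure M (A i)) \<longlonglongrightarrow> emeasure M (\<Inter>i. A i)"
  proof (rule Lim_emeasure_decseq)
    show "range A \<subseteq> sets M" using A by (auto simp: M_def)
    have "A j \<subseteq> A i" if "i \<le> j" for i j
    proof -
      have "1 / real (Suc j) \<le> 1 / real (Suc i)" using that by (intro divide_left_mono) auto
      then show ?thesis by (auto simp: A_def)
    qed
    then show "decseq A" by (auto simp: decseq_def)
  qed (rule finA)
  moreover have "(\<Inter>i. A i) = {}"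
  proof -
    have False if z: "z \<in> (\<Inter>i. A i)" for z
    proof -
      have "norm z < 1" using z by (auto simp: A_def)
      then obtain i where "1 / real (Suc i) < 1 - norm z" using nat_approx_posE[of "1 - norm z"] by auto
      moreover have "1 - 1 / real (Suc i) < norm z" using z by (auto simp: A_def)
      ultimately show False by linarith
    qed
    then show ?thesis by blast
  qed
  ultimately have "(\<lambda>i. emeasure M (A i)) \<longlonglongrightarrow> 0" by simp
  then have "\<forall>\<^sub>F i in sequentially. emeasure M (A i) < e" using e by (rule order_tendstoD)
  then obtain i where "emeasure M (A i) < e" unfolding eventually_sequentially by blast
  then show thesis using that[of "1 - 1 / real (Suc i)"] eM[OF A[of i]] by (simp add: A_def)
qed

text \<open>The mean value property on the balls \<open>B(x, (1 - \<bar>x\<bar>) / 2)\<close>, whose size makes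
  \<open>(1 - \<bar>z\<bar>)\<^sup>-\<^sup>n dz\<close> comparable to normalized Lebesgue measure.\<close>

lemma vanishing_if_integrable_error:
  fixes F :: "nat \<Rightarrow> 'a::euclidean_space \<Rightarrow> complex"
  assumes F: "expansion F" and A: "A > 0"
    and H: "\<And>eta. eta > 0 \<Longrightarrow> \<exists>H. H \<in> borel_measurable borel \<and> (\<forall>z. 0 \<le> H z) \<and>
      (\<integral>\<^sup>+z. ennreal (H z * (1 - norm z) powr (- real DIM('a))) * indicator (ball 0 1) z \<partial>lborel) < \<infinity> \<and>
      (\<forall>z. norm z < 1 \<longrightarrow> norm (esum F z) * (1 - norm z) powr A \<le> eta + H z)"
  shows "vanishing A F"
  unfolding vanishing_def
proof (intro allI impI)
  fix e :: real assume e: "e > 0"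
  define n where "n = DIM('a)"
  define c where "c = bump_mass TYPE('a)"
  have c: "c > 0" unfolding c_def by (rule bump_mass_pos)
  define \<kappa> where "\<kappa> = (2::real) powr A"
  have \<kappa>: "\<kappa> > 0" by (simp add: \<kappa>_def)
  \<comment> \<open>Sized so that, after division by the mass \<open>c\<close>, the two terms of the
    final estimate contribute e/4 each: \<open>\<kappa>\<close> = 2^A compares the weights on the
    averaging ball, and 3^n enters since 1 - |z| \<le> 3 rho there.\<close>
  define eta where "eta = e / (4 * \<kappa>)"
  define del where "del = e * c / (4 * \<kappa> * 3 ^ n)"
  have eta: "eta > 0" and del: "del > 0" using e \<kappa> c by (simp_all add: eta_def del_def)
  from H[OF eta] obtain H where Hm[measurable]: "H \<in> borel_measurable borel" and H0: "\<And>z. 0 \<le> H z"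
    and Hfin: "(\<integral>\<^sup>+z. ennreal (H z * (1 - norm z) powr (- real n)) * indicator (ball 0 1) z \<partial>lborel) < \<infinity>"
    and Hle: "\<And>z. norm z < 1 \<Longrightarrow> norm (esum F z) * (1 - norm z) powr A \<le> eta + H z"
    unfolding n_def by blast
  define h where "h z = ennreal (H z * (1 - norm z) powr (- real n))" for z :: 'a
  have hm[measurable]: "h \<in> borel_measurable borel" unfolding h_def[abs_def] by measurable
  from nn_integral_tail[OF hm Hfin[folded h_def], of "ennreal del"] del obtain R where
    R: "R < 1" "(\<integral>\<^sup>+z. h z * indicator {z. R < norm z \<and> norm z < 1} z \<partial>lborel) < ennreal del" by auto
  note [measurable] = esum_measurable[OF F]
  show "\<exists>r<1. \<forall>x. r < norm x \<and> norm x < 1 \<longrightarrow> norm (esum F x) < e * (1 - norm x) powr (- A)"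
  proof (rule exI[of _ "1 - (1 - R) / 2"], intro conjI allI impI)
    show "1 - (1 - R) / 2 < 1" using R by simp
    fix x :: 'a assume x: "1 - (1 - R) / 2 < norm x \<and> norm x < 1"
    define d where "d = 1 - norm x"
    define rho where "rho = d / 2"
    \<comment> \<open>Consequently 3d/2 < 1 - R, and the ball of radius d/2 about \<open>x\<close>
      lies in the shell beyond \<open>R\<close> on which the integral is small.\<close>
    have "d < (1 - R) / 2" using x by (simp add: d_def field_simps)
    then have d: "d > 0" "3 / 2 * d < 1 - R" using x R(1) by (auto simp: d_def)
    have rho: "rho > 0" "norm x + rho < 1" using d by (auto simp: rho_def d_def field_simps)
    define P where "P = d powr (- A)"
    have P: "P > 0" using d by (simp add: P_def)
    define f where "f y = of_real (bump y) * esum F (x + rho *\<^sub>R y)" for y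
    have fi: "integrable lborel f" and fe: "(\<integral>y. f y \<partial>lborel) = of_real c * esum F x"
      using esum_mean_value[OF F, of rho x] rho unfolding f_def[abs_def] c_def by auto
    have "ennreal (c * norm (esum F x)) = ennreal (norm (\<integral>y. f y \<partial>lborel))"
      using c by (simp add: fe norm_mult)
    also have "\<dots> \<le> (\<integral>\<^sup>+y. ennreal (norm (f y)) \<partial>lborel)"
      by (rule integral_norm_bound_ennreal[OF fi])
    also have "\<dots> \<le> (\<integral>\<^sup>+y. ennreal (\<kappa> * P * eta) * ennreal (bump y) +
        ennreal (\<kappa> * P) * (ennreal (H (x + rho *\<^sub>R y)) * indicator (ball 0 1) y) \<partial>lborel)"
    proof (rule nn_integral_mono)
      fix y :: 'a
      show "ennreal (norm (f y)) \<le> ennreal (\<kappa> * P * eta) * ennreal (bump y) +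
        ennreal (\<kappa> * P) * (ennreal (H (x + rho *\<^sub>R y)) * indicator (ball 0 1) y)"
      proof (cases "norm y < 1")
        case False
        then show ?thesis by (simp add: f_def bump_zero)
      next
        case True
        define z where "z = x + rho *\<^sub>R y"
        have "norm z \<le> norm x + rho * norm y" unfolding z_def using norm_triangle_ineq[of x "rho *\<^sub>R y"] rho by simp
        also have "rho * norm y \<le> rho * 1" using rho True by (intro mult_left_mono) auto
        finally have nz: "norm z \<le> norm x + rho" by simp
        have dz: "d / 2 \<le> 1 - norm z" using nz by (simp add: rho_def d_def field_simps)
        have z1: "norm z < 1" using nz rho by simp
        have "norm (esum F z) * (1 - norm z) powr A * (1 - norm z) powr (- A) \<le> (eta + H z) * (1 - norm z) powr (- A)"
          using Hle[OF z1] by (intro mult_right_mono) auto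
        moreover have "(1 - norm z) powr A * (1 - norm z) powr (- A) = 1"
          using z1 by (simp add: powr_add[symmetric])
        ultimately have "norm (esum F z) \<le> (eta + H z) * (1 - norm z) powr (- A)"
          by (simp add: mult.assoc)
        also have "\<dots> \<le> (eta + H z) * (d / 2) powr (- A)"
          using eta H0[of z] d dz A by (intro mult_left_mono powr_mono2') auto
        also have "(d / 2) powr (- A) = \<kappa> * P"
          using d by (simp add: P_def \<kappa>_def powr_divide powr_minus field_simps)
        finally have 1: "norm (esum F z) \<le> (eta + H z) * (\<kappa> * P)" .
        have "norm (f y) = bump y * norm (esum F z)" by (simp add: f_def z_def norm_mult bump_nonneg)
        also have "\<dots> \<le> bump y * ((eta + H z) * (\<kappa> * P))" using 1 by (intro mult_left_mono bump_nonneg)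
        also have "\<dots> = \<kappa> * P * eta * bump y + (\<kappa> * P * H z) * bump y" by (simp add: algebra_simps)
        also have "\<dots> \<le> \<kappa> * P * eta * bump y + \<kappa> * P * H z * 1"
          using \<kappa> P H0[of z] by (intro add_left_mono mult_left_mono bump_le_1) auto
        finally have "ennreal (norm (f y)) \<le> ennreal (\<kappa> * P * eta * bump y + \<kappa> * P * H z)"
          by (intro ennreal_leI) simp
        also have "\<dots> = ennreal (\<kappa> * P * eta) * ennreal (bump y) + ennreal (\<kappa> * P) * ennreal (H z)"
          using \<kappa> P eta H0[of z] by (simp add: ennreal_mult bump_nonneg)
        finally show ?thesis using True by (simp add: z_def)
      qed
    qed
    also have "\<dots> = ennreal (\<kappa> * P * eta) * (\<integral>\<^sup>+y. ennreal (bump (y::'a)) \<partial>lborel) +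
        ennreal (\<kappa> * P) * (\<integral>\<^sup>+y. ennreal (H (x + rho *\<^sub>R y)) * indicator (ball 0 1) y \<partial>lborel)"
    proof -
      have "(\<lambda>y. H (x + rho *\<^sub>R y)) \<in> borel_measurable borel" by measurable
      then have m: "(\<lambda>y. ennreal (H (x + rho *\<^sub>R y)) * indicator (ball 0 1) y) \<in> borel_measurable lborel"
        by (intro borel_measurable_times_ennreal borel_measurable_indicator) auto
      have m': "(\<lambda>y::'a. ennreal (bump y)) \<in> borel_measurable lborel" by measurable
      show ?thesis
        by (subst nn_integral_add)
          (use m m' in \<open>simp_all only: nn_integral_cmult borel_measurable_times_ennreal borel_measurable_const\<close>)
    qed
    also have "(\<integral>\<^sup>+y. ennreal (bump (y::'a)) \<partial>lborel) = ennreal c"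
      unfolding c_def bump_mass_def
      by (rule nn_integral_eq_integral[OF integrable_bump]) (simp add: bump_nonneg)
    also have "(\<integral>\<^sup>+y. ennreal (H (x + rho *\<^sub>R y)) * indicator (ball 0 1) y \<partial>lborel) \<le> ennreal (3 ^ n * del)"
    proof -
      define g where "g z = ennreal (H z) * indicator (ball x rho) z" for z
      have [measurable]: "g \<in> borel_measurable borel" unfolding g_def[abs_def]
        by (intro borel_measurable_times_ennreal borel_measurable_indicator) auto
      have gy: "g (x + rho *\<^sub>R y) = ennreal (H (x + rho *\<^sub>R y)) * indicator (ball 0 1) y" for y
        using rho by (auto simp: g_def indicator_def dist_norm)
      \<comment> \<open>On this ball (1 - |z|)^-n is at least (3 rho)^-n, so Lebesgue measure is at
        most (3 rho)^n times the weighted one; rescaling by rho then leaves 3^n.\<close>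
      have pt: "g z \<le> ennreal ((3 * rho) ^ n) * (h z * indicator {z. R < norm z \<and> norm z < 1} z)" for z
      proof (cases "z \<in> ball x rho")
        case False
        then show ?thesis by (simp add: g_def)
      next
        case True
        then have nxz: "norm (z - x) < rho" by (simp add: dist_norm norm_minus_commute)
        have z1: "norm z < 1" using nxz norm_triangle_ineq2[of z x] rho by simp
        have zl: "norm z > norm x - rho" using nxz norm_triangle_ineq2[of x z] by (simp add: norm_minus_commute)
        then have zd: "1 - norm z \<le> 3 * rho" by (simp add: rho_def d_def field_simps)
        have zR: "R < norm z" using zl d by (simp add: rho_def d_def field_simps)
        have "(1 - norm z) powr real n \<le> (3 * rho) powr real n" using z1 zd by (intro powr_mono2) auto
        then have "(1 - norm z) powr real n \<le> (3 * rho) ^ n" using rho by (simp add: powr_realpow)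
        then have "(1 - norm z) powr real n * (1 - norm z) powr (- real n) \<le> (3 * rho) ^ n * (1 - norm z) powr (- real n)"
          by (intro mult_right_mono) auto
        moreover have "(1 - norm z) powr real n * (1 - norm z) powr (- real n) = 1"
          using z1 by (simp add: powr_add[symmetric])
        ultimately have "H z * 1 \<le> H z * ((3 * rho) ^ n * (1 - norm z) powr (- real n))"
          by (intro mult_left_mono H0) simp
        then have "ennreal (H z) \<le> ennreal ((3 * rho) ^ n * (H z * (1 - norm z) powr (- real n)))"
          by (intro ennreal_leI) (simp add: mult_ac)
        also have "\<dots> = ennreal ((3 * rho) ^ n) * h z"
          unfolding h_def using rho by (intro ennreal_mult) (auto simp: H0)
        finally show ?thesis using True z1 zR by (simp add: g_def)
      qed
      have "ennreal (rho ^ n) * (\<integral>\<^sup>+y. g (x + rho *\<^sub>R y) \<partial>lborel) = (\<integral>\<^sup>+z. g z \<partial>lborel)"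
        using nn_integral_affine[of g rho x] rho by (simp add: n_def)
      also have "\<dots> \<le> (\<integral>\<^sup>+z. ennreal ((3 * rho) ^ n) * (h z * indicator {z. R < norm z \<and> norm z < 1} z) \<partial>lborel)"
        by (intro nn_integral_mono pt)
      also have "\<dots> = ennreal ((3 * rho) ^ n) * (\<integral>\<^sup>+z. h z * indicator {z. R < norm z \<and> norm z < 1} z \<partial>lborel)"
        by (intro nn_integral_cmult) measurable
      also have "\<dots> \<le> ennreal ((3 * rho) ^ n) * ennreal del" using R(2) by (intro mult_left_mono) auto
      also have "\<dots> = ennreal (rho ^ n) * ennreal (3 ^ n * del)"
        using rho del by (simp add: ennreal_mult[symmetric] power_mult_distrib mult_ac)
      finally have "(\<integral>\<^sup>+y. g (x + rho *\<^sub>R y) \<partial>lborel) \<le> ennreal (3 ^ n * del)"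
        using rho by (subst (asm) ennreal_mult_le_mult_iff) (auto simp: ennreal_eq_0_iff not_le)
      then show ?thesis by (simp add: gy)
    qed
    finally have "ennreal (c * norm (esum F x)) \<le> ennreal (\<kappa> * P * eta) * ennreal c + ennreal (\<kappa> * P) * ennreal (3 ^ n * del)"
      by (simp add: add_left_mono mult_left_mono)
    also have "\<dots> = ennreal (\<kappa> * P * eta * c + \<kappa> * P * (3 ^ n * del))"
      using \<kappa> P eta c del by (simp add: ennreal_mult)
    finally have "c * norm (esum F x) \<le> \<kappa> * P * eta * c + \<kappa> * P * (3 ^ n * del)"
      using \<kappa> P eta c del by (subst (asm) ennreal_le_iff) auto
    also have "\<dots> = c * (e / 2 * P)"
      using \<kappa> by (simp add: eta_def del_def field_simps)
    finally have "norm (esum F x) \<le> e / 2 * P" using c by (simp only: mult_le_cancel_left_pos)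
    also have "\<dots> < e * P" using e P by simp
    finally show "norm (esum F x) < e * (1 - norm x) powr (- A)" by (simp add: P_def d_def)
  qed
qed

section \<open>Measures and weights on the ball\<close>

lemma space_ball_measure [simp]: "space (ball_measure :: 'a::euclidean_space measure) = ball 0 1"
  unfolding ball_measure_def by simp

lemma measurable_ball_measure:
  "g \<in> borel_measurable (ball_measure :: 'a::euclidean_space measure) \<longleftrightarrow> g \<in> borel_measurable (lebesgue_on (ball 0 1))"
  unfolding ball_measure_def by (intro arg_cong2[where f="(\<in>)"] refl measurable_cong_sets) auto

lemma measurable_ball_measure_borel:
  assumes "g \<in> borel_measurable borel" shows "g \<in> borel_measurable (ball_measure :: 'a::euclidean_space measure)"
  unfolding measurable_ball_measure using assms
  by (intro measurable_restrict_space1 measurable_completion) simp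

lemma measurable_ball_measure_continuous:
  fixes g :: "'a::euclidean_space \<Rightarrow> 'b::topological_space"
  assumes "continuous_on (ball 0 1) g" shows "g \<in> borel_measurable ball_measure"
  unfolding measurable_ball_measure using assms by (intro continuous_imp_measurable_on_sets_lebesgue) auto

lemma unit_ball_vol_nz: "unit_ball_vol (real n) \<noteq> 0"
  by (metis less_irrefl of_nat_0_le_iff unit_ball_vol_pos)

lemma emeasure_lebesgue_ball:
  "emeasure (lebesgue_on (ball (0::'a::euclidean_space) 1)) (ball 0 1) = ennreal (unit_ball_vol (real DIM('a)))"
  by (simp add: emeasure_restrict_space emeasure_ball)

lemma AE_ball_measure:
  "(AE x in (ball_measure :: 'a::euclidean_space measure). P x) \<longleftrightarrow> (AE x in lborel. x \<in> ball 0 1 \<longrightarrow> P x)"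
proof -
  have "(AE x in (ball_measure :: 'a measure). P x) \<longleftrightarrow> (AE x in lebesgue_on (ball 0 1). x \<in> ball 0 1 \<longrightarrow> P x)"
    unfolding ball_measure_def
    by (intro AE_uniform_measure)
      (simp_all add: emeasure_lebesgue_ball unit_ball_vol_nz)
  also have "\<dots> \<longleftrightarrow> (AE x in lebesgue. x \<in> ball 0 1 \<longrightarrow> P x)"
    by (subst AE_restrict_space_iff) auto
  also have "\<dots> \<longleftrightarrow> (AE x in lborel. x \<in> ball 0 1 \<longrightarrow> P x)" by (rule AE_completion_iff)
  finally show ?thesis .
qed

lemma nn_integral_ball_measure:
  assumes "g \<in> borel_measurable (ball_measure :: 'a::euclidean_space measure)"
  shows "(\<integral>\<^sup>+x. g x \<partial>ball_measure) = (\<integral>\<^sup>+x. g x * indicator (ball 0 1) x \<partial>lborel) / ennreal (unit_ball_vol (real DIM('a)))"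
proof -
  have "(\<integral>\<^sup>+x. g x \<partial>ball_measure) = (\<integral>\<^sup>+x. g x * indicator (ball 0 1) x \<partial>lebesgue_on (ball 0 1)) / ennreal (unit_ball_vol (real DIM('a)))"
    unfolding ball_measure_def emeasure_lebesgue_ball[symmetric]
    using assms unfolding measurable_ball_measure by (intro nn_integral_uniform_measure) auto
  also have "(\<integral>\<^sup>+x. g x * indicator (ball 0 1) x \<partial>lebesgue_on (ball 0 1)) = (\<integral>\<^sup>+x. g x * indicator (ball 0 1) x \<partial>lborel)"
  proof -
    have "(\<integral>\<^sup>+x. g x * indicator (ball 0 1) x \<partial>lebesgue_on (ball 0 1))
        = (\<integral>\<^sup>+x. (g x * indicator (ball 0 1) x) * indicator (ball 0 1) x \<partial>lebesgue)"
      by (rule nn_integral_restrict_space) simp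
    also have "\<dots> = (\<integral>\<^sup>+x. g x * indicator (ball 0 1) x \<partial>lebesgue)"
      by (intro nn_integral_cong) (simp split: split_indicator)
    finally show ?thesis by (simp only: nn_integral_completion)
  qed
  finally show ?thesis .
qed

lemma emeasure_ball_measure: "emeasure (ball_measure :: 'a::euclidean_space measure) (ball 0 1) = 1"
  unfolding ball_measure_def
  by (intro emeasure_uniform_measure_1)
    (simp_all add: emeasure_lebesgue_ball unit_ball_vol_nz)

text \<open>The set where the function exceeds \<open>c\<close> is open, hence of positive measure
  once it is nonempty.\<close>

lemma AE_ball_measure_continuous:
  fixes \<phi> :: "'a::euclidean_space \<Rightarrow> real"
  assumes cont: "continuous_on (ball 0 1) \<phi>" and AE: "AE x in ball_measure. \<phi> x \<le> c" and x: "norm x < 1"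
  shows "\<phi> x \<le> c"
proof (rule ccontr)
  assume not: "\<not> \<phi> x \<le> c"
  define U where "U = \<phi> -` {c<..} \<inter> ball 0 1"
  have "open U" unfolding U_def
    by (rule continuous_on_open_vimage[OF open_ball, THEN iffD1, OF cont, rule_format, OF open_greaterThan])
  moreover have "x \<in> U" using not x by (auto simp: U_def)
  ultimately obtain d where d: "d > 0" "ball x d \<subseteq> U" using open_contains_ball by blast
  have "AE z in lborel. z \<notin> ball x d"
    using AE unfolding AE_ball_measure by (rule AE_mp) (use d in \<open>auto simp: U_def intro!: AE_I2\<close>)
  then have "emeasure lborel (ball x d) = 0"
    by (subst (asm) AE_iff_measurable[where N="ball x d"]) auto
  then show False using content_ball_pos[OF d(1), of x] by (simp add: measure_def)
qed

text \<open>In 1 - |x|^2 = (1 + |x|)(1 - |x|) the first factor lies between 1 and 2. This passes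
  between the weight of the definitions and the distance to the sphere.\<close>

lemma weight_bounds:
  assumes x: "norm x < 1" and A: "A \<ge> 0"
  shows "(1 - norm x) powr A \<le> weight A x" "weight A x \<le> 2 powr A * (1 - norm x) powr A"
proof -
  have e: "1 - (norm x)\<^sup>2 = (1 + norm x) * (1 - norm x)" by (simp add: power2_eq_square algebra_simps)
  have "weight A x = (1 + norm x) powr A * (1 - norm x) powr A"
    unfolding weight_def e by (rule powr_mult)
  moreover have "1 \<le> (1 + norm x) powr A" using A by (intro ge_one_powr_ge_zero) auto
  moreover have "(1 + norm x) powr A \<le> 2 powr A" using x A by (intro powr_mono2) auto
  ultimately show "(1 - norm x) powr A \<le> weight A x" "weight A x \<le> 2 powr A * (1 - norm x) powr A"
    using mult_right_mono[of 1 "(1 + norm x) powr A" "(1 - norm x) powr A"] by (auto intro: mult_right_mono)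
qed

lemma weight_nonneg: "weight A x \<ge> 0" unfolding weight_def by simp

lemma ball_square: "norm x < 1 \<Longrightarrow> 0 < 1 - (norm x)\<^sup>2" "1 - (norm x)\<^sup>2 \<le> 1"
  using abs_square_less_1[of "norm x"] by auto

lemma weight_pos: "norm x < 1 \<Longrightarrow> weight A x > 0"
  unfolding weight_def using ball_square(1)[of x] by simp

lemma weight_add: "weight A x * weight B x = weight (A + B) x"
  unfolding weight_def by (simp add: powr_add)

lemma weight_antimono: "norm x < 1 \<Longrightarrow> A \<le> B \<Longrightarrow> weight B x \<le> weight A x"
  unfolding weight_def using ball_square[of x] by (intro powr_mono') auto

lemma weight_le_1: "norm x < 1 \<Longrightarrow> 0 \<le> A \<Longrightarrow> weight A x \<le> 1"
  using weight_antimono[of x 0 A] ball_square[of x] by (simp add: weight_def)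

lemma continuous_on_weight: "continuous_on (ball 0 1) (weight A)"
  unfolding weight_def[abs_def] using ball_square(1)
  by (intro continuous_intros) fastforce

lemma weight_measurable [measurable]: "weight A \<in> borel_measurable borel"
  unfolding weight_def[abs_def] by measurable

lemma weight_inverse_power:
  assumes x: "norm x < 1" shows "(1 - norm x) powr (- real n) \<le> 2 ^ n * weight (- real n) x"
proof -
  have "weight (real n) x \<le> 2 powr real n * (1 - norm x) powr real n" using weight_bounds(2)[OF x] by simp
  then have "weight (real n) x * (weight (- real n) x * (1 - norm x) powr (- real n))
     \<le> (2 ^ n * (1 - norm x) powr real n) * (weight (- real n) x * (1 - norm x) powr (- real n))"
    by (intro mult_right_mono) (auto simp: weight_nonneg powr_realpow)
  moreover have "weight (real n) x * weight (- real n) x = 1" "(1 - norm x) powr real n * (1 - norm x) powr (- real n) = 1"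
    using x ball_square(1)[OF x] unfolding weight_def by (simp_all add: powr_add[symmetric])
  ultimately show ?thesis by (simp add: mult_ac) (metis (no_types, lifting) mult.assoc mult.commute mult.right_neutral)
qed

text \<open>For a continuous function the essential supremum is the supremum over the ball.\<close>

lemma weighted_Linf_norm_le_iff:
  fixes \<phi> :: "'a::euclidean_space \<Rightarrow> complex"
  assumes cont: "continuous_on (ball 0 1) \<phi>" and K: "K \<ge> 0"
  shows "weighted_Linf_norm \<alpha> \<phi> \<le> ennreal K \<longleftrightarrow> (\<forall>x. norm x < 1 \<longrightarrow> weight \<alpha> x * norm (\<phi> x) \<le> K)"
proof
  have cw: "continuous_on (ball 0 1) (\<lambda>x. weight \<alpha> x * norm (\<phi> x))"
    by (intro continuous_intros continuous_on_weight cont)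
  {
    assume le: "weighted_Linf_norm \<alpha> \<phi> \<le> ennreal K"
    have "AE x in ball_measure. ennreal (weight \<alpha> x * norm (\<phi> x)) \<le> weighted_Linf_norm \<alpha> \<phi>"
      unfolding weighted_Linf_norm_def by (rule esssup_AE)
    then have "AE x in ball_measure. weight \<alpha> x * norm (\<phi> x) \<le> K"
      by (rule AE_mp) (use le K in \<open>auto intro!: AE_I2 dest: order_trans\<close>)
    then show "\<forall>x. norm x < 1 \<longrightarrow> weight \<alpha> x * norm (\<phi> x) \<le> K"
      using AE_ball_measure_continuous[OF cw] by blast
  }
  assume le: "\<forall>x. norm x < 1 \<longrightarrow> weight \<alpha> x * norm (\<phi> x) \<le> K"
  have "(\<lambda>x. weight \<alpha> x * norm (\<phi> x)) \<in> borel_measurable (ball_measure :: 'a measure)"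
    by (rule measurable_ball_measure_continuous[OF cw])
  then show "weighted_Linf_norm \<alpha> \<phi> \<le> ennreal K"
    unfolding weighted_Linf_norm_def using le
    by (intro esssup_I) (auto intro!: AE_I2 ennreal_leI)
qed

section \<open>Bloch and Bergman--Besov spaces\<close>

definition gmul :: "'a::euclidean_space itself \<Rightarrow> real \<Rightarrow> real \<Rightarrow> nat \<Rightarrow> real" where
  "gmul _ s t k = gamma_coeff DIM('a) (s + t) k / gamma_coeff DIM('a) s k"

abbreviation D_parts :: "real \<Rightarrow> real \<Rightarrow> ('a::euclidean_space \<Rightarrow> complex) \<Rightarrow> nat \<Rightarrow> 'a \<Rightarrow> complex" where
  "D_parts s t f \<equiv> emul (gmul TYPE('a) s t) (homogeneous_part f)"

lemma harmonic_homogeneous_part: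
  fixes f :: "'a::euclidean_space \<Rightarrow> complex"
  assumes "harmonic_on f (ball 0 1)"
  shows "expansion (homogeneous_part f)" "\<And>x. norm x < 1 \<Longrightarrow> (\<lambda>k. homogeneous_part f k x) sums f x"
proof -
  obtain F where F: "expansion F" "\<And>x. x \<in> ball 0 1 \<Longrightarrow> (\<lambda>k. F k x) sums f x"
    using harmonic_expansion[OF assms] by blast
  have "homogeneous_part f = F" by (rule homogeneous_part_eq[OF F])
  then show "expansion (homogeneous_part f)" "\<And>x. norm x < 1 \<Longrightarrow> (\<lambda>k. homogeneous_part f k x) sums f x"
    using F by auto
qed

lemma D_op_eq: "norm x < 1 \<Longrightarrow> D_op s t f x = esum (D_parts s t f) x"
  by (simp add: D_op_def esum_def emul_def gmul_def)

lemma multiplier_gmul: "multiplier TYPE('a::euclidean_space) (gmul TYPE('a) s t) t"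
proof -
  have "multiplier TYPE('a) (\<lambda>k. gamma_coeff DIM('a) (s + t) k / gamma_coeff DIM('a) s k) ((s + t) - s)"
    by (rule multiplier_gamma_quotient) simp
  then show ?thesis by (simp add: gmul_def[abs_def])
qed

lemma expansion_D_parts: "harmonic_on f (ball 0 1) \<Longrightarrow> expansion (D_parts s t f)"
  by (intro multiplier_expansion[OF multiplier_gmul] harmonic_homogeneous_part(1))

text \<open>The two coefficient quotients have orders (s' + t') - (s + t) and s - s', which add up
  to t' - t, so \<open>s\<close> and \<open>s'\<close> do not affect the order.\<close>

lemma D_parts_change:
  fixes f :: "'a::euclidean_space \<Rightarrow> complex"
  obtains m where "multiplier TYPE('a) m (t' - t)" "D_parts s' t' f = emul m (D_parts s t f)"
proof -
  let ?g = "gamma_coeff DIM('a)"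
  define m where "m k = (?g (s' + t') k / ?g (s + t) k) * (?g s k / ?g s' k)" for k
  have "multiplier TYPE('a) m (((s' + t') - (s + t)) + (s - s'))"
    unfolding m_def[abs_def] by (intro multiplier_mult multiplier_gamma_quotient) auto
  moreover have "gmul TYPE('a) s' t' k = m k * gmul TYPE('a) s t k" for k
    using gamma_coeff_pos[of "DIM('a)" "s + t" k] gamma_coeff_pos[of "DIM('a)" s k]
    by (simp add: m_def gmul_def)
  then have "gmul TYPE('a) s' t' = (\<lambda>k. m k * gmul TYPE('a) s t k)" by (rule ext)
  then have "D_parts s' t' f = emul m (D_parts s t f)" by (simp add: emul_emul)
  ultimately show thesis using that by simp
qed

lemma weight_I_op: "weight \<alpha> x * norm (I_op s t f x) = weight (\<alpha> + t) x * norm (D_op s t f x)"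
  by (simp add: I_op_def norm_mult weight_nonneg weight_add[symmetric] mult.assoc)

lemma continuous_on_D_op: "harmonic_on f (ball 0 1) \<Longrightarrow> continuous_on (ball 0 1) (D_op s t f)"
  using continuous_on_esum[OF expansion_D_parts[of f s t]] by (rule continuous_on_eq) (simp_all add: D_op_eq)

lemma continuous_on_I_op: "harmonic_on f (ball 0 1) \<Longrightarrow> continuous_on (ball 0 1) (I_op s t f)"
  unfolding I_op_def[abs_def] by (intro continuous_intros continuous_on_weight continuous_on_D_op)

lemma bloch_harmonic: "f \<in> bloch \<alpha> \<Longrightarrow> harmonic_on f (ball 0 1)"
  unfolding bloch_def by blast

text \<open>Membership provides some pair \<open>s0\<close>, \<open>t0\<close>; its finite norm is a
  growth bound, which the multiplier between the two pairs carries to \<open>s\<close>,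
  \<open>t\<close>.\<close>

lemma bloch_growth:
  fixes f :: "'a::euclidean_space \<Rightarrow> complex"
  assumes f: "f \<in> bloch \<alpha>" and t: "\<alpha> + t > 0"
  obtains K where "K \<ge> 0" "growth (\<alpha> + t) K (D_parts s t f)"
proof -
  have h: "harmonic_on f (ball 0 1)" using f by (rule bloch_harmonic)
  from f obtain s0 t0 where t0: "\<alpha> + t0 > 0" and I: "I_op s0 t0 f \<in> weighted_Linf \<alpha>" unfolding bloch_def by blast
  have "weighted_Linf_norm \<alpha> (I_op s0 t0 f) < top" using I unfolding weighted_Linf_def by simp
  then obtain K where K: "K \<ge> 0" "weighted_Linf_norm \<alpha> (I_op s0 t0 f) \<le> ennreal K"
    unfolding less_top_ennreal by (metis order_refl)
  have "growth (\<alpha> + t0) K (D_parts s0 t0 f)"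
    unfolding growth_def
  proof (intro allI impI)
    fix x :: 'a assume x: "norm x < 1"
    have "weight (\<alpha> + t0) x * norm (D_op s0 t0 f x) \<le> K"
      using K weighted_Linf_norm_le_iff[OF continuous_on_I_op[OF h] K(1)] x unfolding weight_I_op by blast
    moreover have "(1 - norm x) powr (\<alpha> + t0) * norm (D_op s0 t0 f x) \<le> weight (\<alpha> + t0) x * norm (D_op s0 t0 f x)"
      using weight_bounds(1)[OF x] t0 by (intro mult_right_mono) auto
    ultimately have "(1 - norm x) powr (\<alpha> + t0) * norm (D_op s0 t0 f x) \<le> K" by linarith
    then have "(1 - norm x) powr (- (\<alpha> + t0)) * ((1 - norm x) powr (\<alpha> + t0) * norm (D_op s0 t0 f x)) \<le> (1 - norm x) powr (- (\<alpha> + t0)) * K"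
      by (intro mult_left_mono) auto
    moreover have "(1 - norm x) powr (- (\<alpha> + t0)) * (1 - norm x) powr (\<alpha> + t0) = 1"
      using x by (simp only: powr_add[symmetric]) simp
    ultimately show "norm (esum (D_parts s0 t0 f) x) \<le> K * (1 - norm x) powr - (\<alpha> + t0)"
      unfolding D_op_eq[OF x] mult.assoc[symmetric] by (simp add: mult.commute)
  qed
  moreover obtain m where m: "multiplier TYPE('a) m (t - t0)" "D_parts s t f = emul m (D_parts s0 t0 f)"
    by (rule D_parts_change)
  moreover have "\<alpha> + t0 + (t - t0) > 0" using t by simp
  ultimately obtain C where "C \<ge> 0" "growth (\<alpha> + t0 + (t - t0)) (C * K) (D_parts s t f)"
    using multiplierE[OF m(1) t0] expansion_D_parts[OF h] K(1) by metis
  then show thesis using that[of "C * K"] K(1) by simp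
qed

lemma vanishing_change:
  fixes f :: "'a::euclidean_space \<Rightarrow> complex"
  assumes h: "harmonic_on f (ball 0 1)" and t: "\<alpha> + t > 0" "\<alpha> + t' > 0"
    and van: "vanishing (\<alpha> + t) (D_parts s t f)"
  shows "vanishing (\<alpha> + t') (D_parts s' t' f)"
proof -
  obtain m where m: "multiplier TYPE('a) m (t' - t)" "D_parts s' t' f = emul m (D_parts s t f)"
    by (rule D_parts_change)
  have "vanishing (\<alpha> + t + (t' - t)) (emul m (D_parts s t f))"
    using t by (intro vanishing_emul[OF m(1)] expansion_D_parts h van) auto
  then show ?thesis by (simp add: m(2))
qed

lemma vanishing_iff_weight:
  assumes A: "A > 0"
  shows "vanishing A F \<longleftrightarrow> (\<forall>e>0. \<exists>r<1. \<forall>x. r < norm x \<and> norm x < 1 \<longrightarrow> weight A x * norm (esum F x) < e)"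
proof -
  have q: "norm (esum F x) < e * (1 - norm x) powr (- A) \<longleftrightarrow> (1 - norm x) powr A * norm (esum F x) < e"
    if x: "norm x < 1" for x e
    using x by (simp add: powr_minus field_simps)
  have up: "weight A x * norm (esum F x) \<le> 2 powr A * ((1 - norm x) powr A * norm (esum F x))"
    and low: "(1 - norm x) powr A * norm (esum F x) \<le> weight A x * norm (esum F x)" if "norm x < 1" for x
    unfolding mult.assoc[symmetric] using weight_bounds[OF that] A by (auto intro: mult_right_mono)
  show ?thesis
  proof
    assume van: "vanishing A F"
    show "\<forall>e>0. \<exists>r<1. \<forall>x. r < norm x \<and> norm x < 1 \<longrightarrow> weight A x * norm (esum F x) < e"
    proof (intro allI impI)
      fix e :: real assume "e > 0"
      then have "e / 2 powr A > 0" by simp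
      then obtain r where r: "r < 1" "\<And>x. r < norm x \<Longrightarrow> norm x < 1 \<Longrightarrow> norm (esum F x) < e / 2 powr A * (1 - norm x) powr (- A)"
        using van unfolding vanishing_def by metis
      have "weight A x * norm (esum F x) < e" if x: "r < norm x" "norm x < 1" for x
      proof -
        have "(1 - norm x) powr A * norm (esum F x) < e / 2 powr A" using r(2)[OF x] q[OF x(2)] by blast
        then have "2 powr A * ((1 - norm x) powr A * norm (esum F x)) < e" by (simp add: field_simps)
        then show ?thesis using up[OF x(2)] by linarith
      qed
      then show "\<exists>r<1. \<forall>x. r < norm x \<and> norm x < 1 \<longrightarrow> weight A x * norm (esum F x) < e" using r(1) by blast
    qed
  next
    assume *: "\<forall>e>0. \<exists>r<1. \<forall>x. r < norm x \<and> norm x < 1 \<longrightarrow> weight A x * norm (esum F x) < e"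
    show "vanishing A F"
      unfolding vanishing_def
    proof (intro allI impI)
      fix e :: real assume "e > 0"
      then obtain r where r: "r < 1" "\<And>x. r < norm x \<Longrightarrow> norm x < 1 \<Longrightarrow> weight A x * norm (esum F x) < e"
        using * by blast
      have "norm (esum F x) < e * (1 - norm x) powr (- A)" if x: "r < norm x" "norm x < 1" for x
        using r(2)[OF x] low[OF x(2)] q[OF x(2), of e] by linarith
      then show "\<exists>r<1. \<forall>x. r < norm x \<and> norm x < 1 \<longrightarrow> norm (esum F x) < e * (1 - norm x) powr (- A)"
        using r(1) by blast
    qed
  qed
qed

lemma tendsto_boundary_iff:
  fixes g :: "'a::real_normed_vector \<Rightarrow> real"
  assumes "\<And>x. g x \<ge> 0"
  shows "(g \<longlongrightarrow> 0) (filtercomap norm (at_left 1)) \<longleftrightarrow>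
    (\<forall>e>0. \<exists>r<1. \<forall>x. r < norm x \<and> norm x < 1 \<longrightarrow> g x < e)"
proof -
  have "(\<forall>\<^sub>F x in filtercomap norm (at_left 1). g x < e) \<longleftrightarrow>
      (\<exists>r<1. \<forall>x. r < norm x \<and> norm x < 1 \<longrightarrow> g x < e)" for e
  proof
    assume "\<forall>\<^sub>F x in filtercomap norm (at_left 1). g x < e"
    then obtain Q where Q: "\<forall>\<^sub>F y in at_left (1::real). Q y" "\<And>x. Q (norm x) \<Longrightarrow> g x < e"
      unfolding eventually_filtercomap by blast
    obtain b where "b < 1" "\<And>y. b < y \<Longrightarrow> y < 1 \<Longrightarrow> Q y"
      using Q(1) eventually_at_left[of 0 "1::real"] by auto
    then show "\<exists>r<1. \<forall>x. r < norm x \<and> norm x < 1 \<longrightarrow> g x < e" using Q(2) by blast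
  next
    assume "\<exists>r<1. \<forall>x. r < norm x \<and> norm x < 1 \<longrightarrow> g x < e"
    then obtain r where r: "r < 1" "\<And>x. r < norm x \<Longrightarrow> norm x < 1 \<Longrightarrow> g x < e" by blast
    have "\<forall>\<^sub>F y in at_left (1::real). r < y \<and> y < 1"
      using r(1) by (auto simp: eventually_at_left[of r] intro!: exI[of _ r])
    then show "\<forall>\<^sub>F x in filtercomap norm (at_left 1). g x < e"
      unfolding eventually_filtercomap using r(2) by blast
  qed
  then show ?thesis unfolding tendsto_iff using assms by (simp add: dist_real_def)
qed

lemma tendsto_iff_vanishing:
  assumes t: "\<alpha> + t > 0"
  shows "((\<lambda>x. weight \<alpha> x * norm (I_op s t f x)) \<longlongrightarrow> 0) (filtercomap norm (at_left 1)) \<longleftrightarrow>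
    vanishing (\<alpha> + t) (D_parts s t f)"
proof -
  have "((\<lambda>x. weight \<alpha> x * norm (I_op s t f x)) \<longlongrightarrow> 0) (filtercomap norm (at_left 1)) \<longleftrightarrow>
    (\<forall>e>0. \<exists>r<1. \<forall>x. r < norm x \<and> norm x < 1 \<longrightarrow> weight \<alpha> x * norm (I_op s t f x) < e)"
    by (rule tendsto_boundary_iff) (simp add: weight_nonneg)
  also have "\<dots> \<longleftrightarrow> (\<forall>e>0. \<exists>r<1. \<forall>x. r < norm x \<and> norm x < 1 \<longrightarrow>
      weight (\<alpha> + t) x * norm (esum (D_parts s t f) x) < e)"
    unfolding weight_I_op using D_op_eq[of _ s t f] by (metis (no_types, lifting))
  finally show ?thesis unfolding vanishing_iff_weight[OF t] .
qed

text \<open>The pair provided by the definition is exchanged for the given one by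
  \<open>vanishing_change\<close>.\<close>

lemma little_bloch_iff:
  assumes f: "f \<in> bloch \<alpha>" and t: "\<alpha> + t > 0"
  shows "f \<in> little_bloch \<alpha> \<longleftrightarrow> vanishing (\<alpha> + t) (D_parts s t f)"
proof
  assume "f \<in> little_bloch \<alpha>"
  then obtain s0 t0 where t0: "\<alpha> + t0 > 0" and
    lim: "((\<lambda>x. weight \<alpha> x * norm (I_op s0 t0 f x)) \<longlongrightarrow> 0) (filtercomap norm (at_left 1))"
    unfolding little_bloch_def by blast
  then have "vanishing (\<alpha> + t0) (D_parts s0 t0 f)" using tendsto_iff_vanishing by blast
  then show "vanishing (\<alpha> + t) (D_parts s t f)" by (rule vanishing_change[OF bloch_harmonic[OF f] t0 t])
next
  assume "vanishing (\<alpha> + t) (D_parts s t f)"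
  then show "f \<in> little_bloch \<alpha>" unfolding little_bloch_def using f t tendsto_iff_vanishing[OF t] by blast
qed


text \<open>Guards the normalization: the Bochner integral of a non-integrable weight would be 0.
  For \<beta> < 0 the region 1 - |x| \<le> 2^-j has measure at most a multiple of 2^-j, the weight
  where 1 - |x| \<ge> 2^-(j + 1) is at most 2^(-(j + 1) \<beta>), and the products form a geometric
  series of ratio 2^-(\<beta> + 1) < 1.\<close>

lemma nn_integral_weight_finite:
  assumes b: "\<beta> > -1"
  shows "(\<integral>\<^sup>+x. ennreal (weight \<beta> x) \<partial>(ball_measure :: 'a::euclidean_space measure)) < \<infinity>"
proof (cases "\<beta> \<ge> 0")
  case True
  have "(\<integral>\<^sup>+x. ennreal (weight \<beta> x) \<partial>(ball_measure :: 'a measure)) \<le> (\<integral>\<^sup>+x. 1 \<partial>(ball_measure :: 'a measure))"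
    using weight_le_1[OF _ True] by (intro nn_integral_mono) auto
  also have "\<dots> = 1" by (simp add: emeasure_ball_measure)
  finally show ?thesis by (simp add: le_less_trans)
next
  case False
  define n where "n = DIM('a)"
  define V where "V = unit_ball_vol (real n)"
  have V: "V \<ge> 0" unfolding V_def by (rule less_imp_le[OF unit_ball_vol_pos]) (simp add: n_def)
  define A where "A j = {x::'a. norm x < 1 \<and> 1 - norm x \<le> (1/2) ^ j}" for j
  have A[measurable]: "A j \<in> sets borel" for j unfolding A_def by measurable
  define c where "c j = ((1/2::real) ^ Suc j) powr \<beta>" for j
  have c0: "c j \<ge> 0" for j by (simp add: c_def)
  have mA: "emeasure lborel (A j) \<le> ennreal (V * (real n * (1/2) ^ j))" for j
  proof -
    let ?r = "1 - (1/2::real) ^ j"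
    have r: "0 \<le> ?r" "?r \<le> 1" by (simp_all add: power_le_one)
    have "A j \<subseteq> ball 0 1 - ball 0 ?r" by (auto simp: A_def)
    then have "emeasure lborel (A j) \<le> emeasure lborel (ball 0 1 - ball (0::'a) ?r)" by (intro emeasure_mono) auto
    also have "\<dots> = emeasure lborel (ball (0::'a) 1) - emeasure lborel (ball (0::'a) ?r)"
      by (intro emeasure_Diff) (use emeasure_lborel_ball_finite[of "0::'a" ?r] r in \<open>auto simp: subset_ball\<close>)
    also have "\<dots> = ennreal (V * 1 ^ n) - ennreal (V * ?r ^ n)"
      using r by (simp add: emeasure_ball V_def n_def)
    also have "\<dots> = ennreal (V * 1 ^ n - V * ?r ^ n)" using V r by (intro ennreal_minus) auto
    also have "\<dots> \<le> ennreal (V * (real n * (1/2) ^ j))"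
    proof (intro ennreal_leI)
      \<comment> \<open>Bernoulli's inequality bounds the relative volume of the outer region by n
        2^-j.\<close>
      have "1 + real n * (- ((1/2) ^ j)) \<le> (1 + - ((1/2::real) ^ j)) ^ n"
        by (intro Bernoulli_inequality) (simp add: power_le_one)
      then have "1 - ?r ^ n \<le> real n * (1/2) ^ j" by simp
      then have "V * (1 - ?r ^ n) \<le> V * (real n * (1/2) ^ j)" using V by (intro mult_left_mono)
      then show "V * 1 ^ n - V * ?r ^ n \<le> V * (real n * (1/2) ^ j)" by (simp add: algebra_simps)
    qed
    finally show ?thesis .
  qed
  have pt: "ennreal (weight \<beta> x) * indicator (ball 0 1) x \<le> (\<Sum>j. ennreal (c j) * indicator (A j) x)" for x :: 'a
  proof (cases "norm x < 1")
    case False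
    then show ?thesis by simp
  next
    case True
    define d where "d = 1 - norm x"
    have d: "0 < d" "d \<le> 1" using True by (auto simp: d_def)
    obtain m where "(1/2::real) ^ m < d" using real_arch_pow_inv[of d "1/2"] d by auto
    then have ex: "\<exists>m. (1/2::real) ^ m \<le> d" using less_imp_le by blast
    define k where "k = (LEAST m. (1/2::real) ^ m \<le> d)"
    have k: "(1/2::real) ^ k \<le> d" unfolding k_def using ex by (rule LeastI_ex)
    \<comment> \<open>The dyadic index of \<open>d\<close>. Truncated subtraction gives j = 0 at the
      centre, where k = 0 and d = 1.\<close>
    define j where "j = k - 1"
    have j: "(1/2::real) ^ Suc j \<le> d" "d \<le> (1/2) ^ j"
    proof -
      show "(1/2::real) ^ Suc j \<le> d"
      proof (cases k)
        case 0
        then have "d = 1" using k d by simp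
        then show ?thesis by (simp add: j_def 0)
      qed (use k in \<open>simp add: j_def\<close>)
      show "d \<le> (1/2) ^ j"
      proof (cases k)
        case (Suc i)
        then have "\<not> (1/2::real) ^ i \<le> d" using not_less_Least[of i "\<lambda>m. (1/2::real) ^ m \<le> d"] by (simp add: k_def)
        then show ?thesis using Suc by (simp add: j_def)
      qed (use d in \<open>simp add: j_def\<close>)
    qed
    have "d \<le> 1 - (norm x)\<^sup>2"
      using True mult_left_le[of "norm x" "norm x"] by (simp add: d_def power2_eq_square)
    then have "weight \<beta> x \<le> c j"
      unfolding weight_def c_def using False j d by (intro powr_mono2') auto
    then have "ennreal (weight \<beta> x) * indicator (ball 0 1) x \<le> ennreal (c j) * indicator (A j) x"
      using True j by (simp add: A_def d_def ennreal_leI)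
    also have "\<dots> \<le> (\<Sum>j. ennreal (c j) * indicator (A j) x)"
    proof -
      have "T i \<le> suminf T" for T :: "nat \<Rightarrow> ennreal" and i
        using sum_le_suminf[OF summableI, of "{i}" T] by simp
      then show ?thesis .
    qed
    finally show ?thesis .
  qed
  define q where "q = (1/2::real) powr (\<beta> + 1)"
  have q: "0 \<le> q" "q < 1" unfolding q_def using b powr_less_mono2[of "\<beta> + 1" "1/2" 1] by auto
  have cq: "c j * (V * (real n * (1/2) ^ j)) = ((1/2) powr \<beta> * V * real n) * q ^ j" for j
  proof -
    have "c j = (1/2) powr \<beta> * ((1/2) powr \<beta>) ^ j"
      by (simp add: c_def powr_mult powr_realpow[symmetric] powr_powr mult.commute power_divide powr_divide)
    moreover have "q ^ j = ((1/2) powr \<beta>) ^ j * (1/2) ^ j"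
      by (simp add: q_def powr_add power_mult_distrib power_divide)
    ultimately show ?thesis by simp
  qed
  have "(\<integral>\<^sup>+x. ennreal (weight \<beta> (x::'a)) * indicator (ball 0 1) x \<partial>lborel)
      \<le> (\<integral>\<^sup>+x. (\<Sum>j. ennreal (c j) * indicator (A j) x) \<partial>lborel)"
    by (intro nn_integral_mono pt)
  also have "\<dots> = (\<Sum>j. \<integral>\<^sup>+x. ennreal (c j) * indicator (A j) x \<partial>lborel)"
    by (intro nn_integral_suminf) measurable
  also have "\<dots> = (\<Sum>j. ennreal (c j) * emeasure lborel (A j))"
    by (simp add: nn_integral_cmult_indicator)
  also have "\<dots> \<le> (\<Sum>j. ennreal (c j * (V * (real n * (1/2) ^ j))))"
  proof (intro suminf_le)
    show "ennreal (c j) * emeasure lborel (A j) \<le> ennreal (c j * (V * (real n * (1/2) ^ j)))" for j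
      using mult_left_mono[OF mA[of j], of "ennreal (c j)"] c0[of j] V by (simp add: ennreal_mult)
  qed auto
  also have "\<dots> = (\<Sum>j. ennreal (((1/2) powr \<beta> * V * real n) * q ^ j))" unfolding cq ..
  also have "\<dots> = ennreal (\<Sum>j. ((1/2) powr \<beta> * V * real n) * q ^ j)"
    using q V by (intro suminf_ennreal2 summable_mult summable_geometric) auto
  also have "\<dots> < \<infinity>" by simp
  finally have fin: "(\<integral>\<^sup>+x. ennreal (weight \<beta> (x::'a)) * indicator (ball 0 1) x \<partial>lborel) < \<infinity>" .
  have "(\<integral>\<^sup>+x. ennreal (weight \<beta> x) \<partial>(ball_measure :: 'a measure))
      = (\<integral>\<^sup>+x. ennreal (weight \<beta> (x::'a)) * indicator (ball 0 1) x \<partial>lborel) / ennreal (unit_ball_vol (real DIM('a)))"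
    by (intro nn_integral_ball_measure measurable_ball_measure_borel) measurable
  then show ?thesis using fin V unit_ball_vol_nz[of n] by (simp add: ennreal_divide_eq_top_iff less_top[symmetric] V_def n_def)
qed

definition weight_mass :: "'a::euclidean_space itself \<Rightarrow> real \<Rightarrow> real" where
  "weight_mass _ \<beta> = (if \<beta> > -1 then \<integral>x. weight \<beta> x \<partial>(ball_measure :: 'a measure) else 1)"

lemma weight_mass_pos: "weight_mass TYPE('a::euclidean_space) \<beta> > 0"
proof (cases "\<beta> > -1")
  case True
  have m: "weight \<beta> \<in> borel_measurable (ball_measure :: 'a measure)"
    by (intro measurable_ball_measure_borel) measurable
  then have int: "integrable (ball_measure :: 'a measure) (weight \<beta>)"
    using nn_integral_weight_finite[OF True, where 'a='a]
    by (intro integrableI_bounded) (simp_all add: weight_nonneg)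
  have "(\<integral>x. weight \<beta> x \<partial>(ball_measure :: 'a measure)) \<noteq> 0"
  proof
    assume "(\<integral>x. weight \<beta> x \<partial>(ball_measure :: 'a measure)) = 0"
    then have "AE x in (ball_measure :: 'a measure). weight \<beta> x = 0"
      using integral_nonneg_eq_0_iff_AE[OF int] weight_nonneg by (simp add: weight_nonneg)
    then have "AE x in (ball_measure :: 'a measure). weight \<beta> x \<le> 0" by (rule AE_mp) simp
    from AE_ball_measure_continuous[OF continuous_on_weight this, of 0] weight_pos[of "0::'a" \<beta>] show False by simp
  qed
  moreover have "(\<integral>x. weight \<beta> x \<partial>(ball_measure :: 'a measure)) \<ge> 0" by (simp add: weight_nonneg)
  ultimately show ?thesis using True by (simp add: weight_mass_def)
qed (simp add: weight_mass_def)

lemma weighted_ball_measure_eq: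
  "weighted_ball_measure \<beta> = density (ball_measure :: 'a::euclidean_space measure) (\<lambda>x. ennreal (weight \<beta> x / weight_mass TYPE('a) \<beta>))"
  unfolding weighted_ball_measure_def weight_mass_def Let_def ..

lemma nn_integral_weighted_ball_measure:
  fixes g :: "'a::euclidean_space \<Rightarrow> ennreal"
  assumes "g \<in> borel_measurable ball_measure"
  shows "(\<integral>\<^sup>+x. g x \<partial>weighted_ball_measure \<beta>) =
     (\<integral>\<^sup>+x. ennreal (weight \<beta> x / weight_mass TYPE('a) \<beta>) * g x \<partial>ball_measure)"
  unfolding weighted_ball_measure_eq
  by (intro nn_integral_density assms measurable_ball_measure_borel) measurable

lemma measurable_weighted_ball_measure:
  "g \<in> borel_measurable (weighted_ball_measure \<beta>) \<longleftrightarrow> g \<in> borel_measurable (ball_measure :: 'a::euclidean_space measure)"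
  unfolding weighted_ball_measure_eq by simp

lemma nn_integral_ball_measure_finite_iff:
  assumes "g \<in> borel_measurable (ball_measure :: 'a::euclidean_space measure)"
  shows "(\<integral>\<^sup>+x. g x \<partial>ball_measure) < \<infinity> \<longleftrightarrow> (\<integral>\<^sup>+x. g x * indicator (ball 0 1) x \<partial>lborel) < \<infinity>"
  unfolding nn_integral_ball_measure[OF assms] using unit_ball_vol_nz[of "DIM('a)"] unit_ball_vol_pos[of "real DIM('a)"]
  by (simp add: ennreal_divide_eq_top_iff less_top[symmetric] ennreal_eq_0_iff not_le)

text \<open>The parameters returned are those of the integrability condition itself; any other pair
  is reached afterwards by \<open>vanishing_change\<close>.\<close>

lemma besov_vanishing:
  fixes g :: "'a::euclidean_space \<Rightarrow> complex"
  assumes g: "g \<in> bergman_besov p \<beta>" and p: "1 \<le> p" and \<beta>: "\<beta> \<le> p * \<alpha> - real DIM('a)"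
  obtains s t where "\<alpha> + t > 0" "vanishing (\<alpha> + t) (D_parts s t g)"
proof -
  define n where "n = DIM('a)"
  have n1: "real n \<ge> 1" unfolding n_def using DIM_positive[where 'a='a] by linarith
  from g obtain s t where h: "harmonic_on g (ball 0 1)" and t: "\<beta> + p * t > -1" and I: "I_op s t g \<in> weighted_Lp p \<beta>"
    unfolding bergman_besov_def by blast
  \<comment> \<open>By p (\<alpha> + t) \<ge> \<beta> + p t + n > n - 1 \<ge> 0 the Bergman--Besov
    condition on \<open>t\<close> entails the Bloch condition.\<close>
  have "p * (\<alpha> + t) > 0" using t \<beta> n1[unfolded n_def] unfolding distrib_left by linarith
  then have A: "\<alpha> + t > 0" using p by (simp add: zero_less_mult_iff)
  define F where "F = D_parts s t g"
  have F: "expansion F" unfolding F_def by (rule expansion_D_parts[OF h])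
  define G where "G z = weight (\<alpha> + t) z * norm (esum F z)" for z
  note [measurable] = esum_measurable[OF F]
  have Gm[measurable]: "G \<in> borel_measurable borel" unfolding G_def[abs_def] by measurable
  have G0: "G z \<ge> 0" for z by (simp add: G_def weight_nonneg)
  define V where "V = weight_mass TYPE('a) \<beta>"
  have V: "V > 0" unfolding V_def by (rule weight_mass_pos)
  define J where "J z = ennreal (weight (\<beta> + p * t) z * norm (esum F z) powr p)" for z
  have Jm[measurable]: "J \<in> borel_measurable borel" unfolding J_def[abs_def] by measurable
  have Jfin: "(\<integral>\<^sup>+z. J z * indicator (ball 0 1) z \<partial>lborel) < \<infinity>"
  proof -
    have m: "(\<lambda>x. ennreal (norm (I_op s t g x) powr p)) \<in> borel_measurable ball_measure"
    proof -
      have [measurable]: "I_op s t g \<in> borel_measurable ball_measure"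
        by (rule measurable_ball_measure_continuous[OF continuous_on_I_op[OF h]])
      show ?thesis by measurable
    qed
    have eq: "J x = ennreal V * (ennreal (weight \<beta> x / V) * ennreal (norm (I_op s t g x) powr p))" if "norm x < 1" for x
    proof -
      have "norm (I_op s t g x) powr p = weight (p * t) x * norm (esum F x) powr p"
        using that by (simp add: I_op_def norm_mult D_op_eq F_def weight_nonneg powr_mult weight_def powr_powr mult.commute)
      then have "weight (\<beta> + p * t) x * norm (esum F x) powr p = V * ((weight \<beta> x / V) * norm (I_op s t g x) powr p)"
        using V by (simp add: weight_add[symmetric])
      then show ?thesis unfolding J_def using V by (simp add: ennreal_mult[symmetric] weight_nonneg)
    qed
    have "(\<integral>\<^sup>+x. J x \<partial>ball_measure) = (\<integral>\<^sup>+x. ennreal V * (ennreal (weight \<beta> x / V) * ennreal (norm (I_op s t g x) powr p)) \<partial>ball_measure)"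
      using eq by (intro nn_integral_cong) simp
    also have "\<dots> = ennreal V * (\<integral>\<^sup>+x. ennreal (weight \<beta> x / V) * ennreal (norm (I_op s t g x) powr p) \<partial>ball_measure)"
      by (intro nn_integral_cmult borel_measurable_times_ennreal m measurable_ball_measure_borel) measurable
    also have "\<dots> = ennreal V * (\<integral>\<^sup>+x. ennreal (norm (I_op s t g x) powr p) \<partial>weighted_ball_measure \<beta>)"
      unfolding V_def using nn_integral_weighted_ball_measure[OF m] by simp
    also have "\<dots> < \<infinity>" using I unfolding weighted_Lp_def by (simp add: ennreal_mult_less_top)
    finally show ?thesis
      by (subst (asm) nn_integral_ball_measure_finite_iff) (auto intro!: measurable_ball_measure_borel)
  qed
  have "vanishing (\<alpha> + t) F"
  proof (rule vanishing_if_integrable_error[OF F A])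
    fix eta :: real assume eta: "eta > 0"
    \<comment> \<open>Split at the level \<open>eta\<close>: below it \<open>G\<close> is covered by
      \<open>eta\<close>, above it by H = G (G / eta)^(p - 1).\<close>
    define H where "H z = eta powr (1 - p) * G z powr p" for z
    have "G z \<le> eta + H z" for z
    proof (cases "G z \<le> eta")
      case True
      moreover have "H z \<ge> 0" by (simp add: H_def)
      ultimately show ?thesis by linarith
    next
      case False
      then have Gz: "0 < eta" "eta < G z" using eta by auto
      have "G z = G z powr (1 - p) * G z powr p" using Gz by (simp add: powr_add[symmetric])
      also have "\<dots> \<le> eta powr (1 - p) * G z powr p"
        using Gz p by (intro mult_right_mono powr_mono2') auto
      finally show ?thesis using eta by (simp add: H_def)
    qed
    moreover have "norm (esum F z) * (1 - norm z) powr (\<alpha> + t) \<le> G z" if "norm z < 1" for z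
      using mult_right_mono[OF weight_bounds(1)[OF that less_imp_le[OF A]], of "norm (esum F z)"]
      by (simp add: G_def mult.commute)
    ultimately have 1: "\<forall>z. norm z < 1 \<longrightarrow> norm (esum F z) * (1 - norm z) powr (\<alpha> + t) \<le> eta + H z"
      by (meson order_trans)
    define c where "c = eta powr (1 - p) * 2 ^ n"
    have c: "c \<ge> 0" by (simp add: c_def)
    have "(\<integral>\<^sup>+z. ennreal (H z * (1 - norm z) powr (- real n)) * indicator (ball 0 1) z \<partial>lborel)
        \<le> (\<integral>\<^sup>+z. ennreal c * (J z * indicator (ball 0 1) z) \<partial>lborel)"
    proof (rule nn_integral_mono)
      fix z :: 'a
      show "ennreal (H z * (1 - norm z) powr (- real n)) * indicator (ball 0 1) z \<le> ennreal c * (J z * indicator (ball 0 1) z)"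
      proof (cases "norm z < 1")
        case True
        have "G z powr p = weight (p * (\<alpha> + t)) z * norm (esum F z) powr p"
          by (simp add: G_def weight_def powr_mult powr_powr mult.commute)
        then have "H z * (1 - norm z) powr (- real n)
            = (eta powr (1 - p) * norm (esum F z) powr p * weight (p * (\<alpha> + t)) z) * (1 - norm z) powr (- real n)"
          by (simp add: H_def mult_ac)
        also have "\<dots> \<le> (eta powr (1 - p) * norm (esum F z) powr p * weight (p * (\<alpha> + t)) z) * (2 ^ n * weight (- real n) z)"
          using weight_inverse_power[OF True, of n] by (intro mult_left_mono) (auto simp: weight_nonneg)
        also have "\<dots> = (c * norm (esum F z) powr p) * (weight (p * (\<alpha> + t)) z * weight (- real n) z)"
          by (simp add: c_def mult_ac)
        \<comment> \<open>The combined exponent p (\<alpha> + t) - n is at least \<beta> + p t; this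
          is where \<beta> \<le> p \<alpha> - n enters.\<close>
        also have "\<dots> \<le> (c * norm (esum F z) powr p) * weight (\<beta> + p * t) z"
          unfolding weight_add using \<beta> c True
          by (intro mult_left_mono weight_antimono) (auto simp: n_def distrib_left)
        finally have "ennreal (H z * (1 - norm z) powr (- real n)) \<le> ennreal (c * (weight (\<beta> + p * t) z * norm (esum F z) powr p))"
          by (intro ennreal_leI) (simp add: mult_ac)
        then show ?thesis using True c by (simp add: J_def ennreal_mult weight_nonneg)
      qed simp
    qed
    also have "\<dots> = ennreal c * (\<integral>\<^sup>+z. J z * indicator (ball 0 1) z \<partial>lborel)"
      by (intro nn_integral_cmult borel_measurable_times_ennreal borel_measurable_indicator) auto
    also have "\<dots> < \<infinity>" using Jfin by (simp add: ennreal_mult_less_top)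
    finally have 2: "(\<integral>\<^sup>+z. ennreal (H z * (1 - norm z) powr (- real n)) * indicator (ball 0 1) z \<partial>lborel) < \<infinity>" .
    have "H \<in> borel_measurable borel" unfolding H_def[abs_def] by measurable
    moreover have "\<forall>z. 0 \<le> H z" by (simp add: H_def)
    ultimately show "\<exists>H. H \<in> borel_measurable borel \<and> (\<forall>z. 0 \<le> H z) \<and>
      (\<integral>\<^sup>+z. ennreal (H z * (1 - norm z) powr (- real DIM('a))) * indicator (ball 0 1) z \<partial>lborel) < \<infinity> \<and>
      (\<forall>z. norm z < 1 \<longrightarrow> norm (esum F z) * (1 - norm z) powr (\<alpha> + t) \<le> eta + H z)"
      using 1 2 unfolding n_def by blast
  qed
  then show thesis using that A unfolding F_def by blast
qed


section \<open>Dilates and differences under the radial operators\<close>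

lemma harmonic_on_dilation:
  fixes f :: "'a::euclidean_space \<Rightarrow> complex"
  assumes f: "harmonic_on f (ball 0 1)" and r: "0 \<le> r" "r \<le> 1"
  shows "harmonic_on (\<lambda>x. f (r *\<^sub>R x)) (ball 0 1)"
proof -
  from f obtain f' f'' where f': "\<And>x. x \<in> ball 0 1 \<Longrightarrow> (f has_derivative f' x) (at x)"
    "\<And>x v. x \<in> ball 0 1 \<Longrightarrow> ((\<lambda>y. f' y v) has_derivative f'' x v) (at x)"
    "\<And>v w. continuous_on (ball 0 1) (\<lambda>x. f'' x v w)"
    "\<And>x. x \<in> ball 0 1 \<Longrightarrow> (\<Sum>b\<in>Basis. f'' x b b) = 0" by (rule harmonic_onE) auto
  have inb: "r *\<^sub>R x \<in> ball 0 1" if "x \<in> ball 0 1" for x :: 'a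
    using that r mult_right_mono[of r 1 "norm x"] by simp
  have lin: "((\<lambda>x. r *\<^sub>R x) has_derivative (\<lambda>v. r *\<^sub>R v)) (at x)" for x :: 'a
    by (auto intro!: derivative_eq_intros)
  show ?thesis
  proof (rule harmonic_onI[of _ _ "\<lambda>x v. r *\<^sub>R f' (r *\<^sub>R x) v" "\<lambda>x v w. (r * r) *\<^sub>R f'' (r *\<^sub>R x) v w"])
    fix x :: 'a assume x: "x \<in> ball 0 1"
    have "((\<lambda>x. f (r *\<^sub>R x)) has_derivative (\<lambda>v. f' (r *\<^sub>R x) (r *\<^sub>R v))) (at x)"
      using has_derivative_compose[OF lin f'(1)[OF inb[OF x]]] .
    then show "((\<lambda>x. f (r *\<^sub>R x)) has_derivative (\<lambda>v. r *\<^sub>R f' (r *\<^sub>R x) v)) (at x)"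
      by (rule has_derivative_eq_rhs)
        (simp add: linear_cmul[OF has_derivative_linear[OF f'(1)[OF inb[OF x]]]] fun_eq_iff)
    show "(\<Sum>b\<in>Basis. (r * r) *\<^sub>R f'' (r *\<^sub>R x) b b) = 0"
      using f'(4)[OF inb[OF x]] by (simp flip: scaleR_sum_right)
    fix v
    have "((\<lambda>x. f' (r *\<^sub>R x) v) has_derivative (\<lambda>w. f'' (r *\<^sub>R x) v (r *\<^sub>R w))) (at x)"
      using has_derivative_compose[OF lin f'(2)[OF inb[OF x]]] .
    from has_derivative_scaleR_right[OF this, of r]
    show "((\<lambda>y. r *\<^sub>R f' (r *\<^sub>R y) v) has_derivative (\<lambda>w. (r * r) *\<^sub>R f'' (r *\<^sub>R x) v w)) (at x)"
      by (rule has_derivative_eq_rhs)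
        (simp add: linear_cmul[OF has_derivative_linear[OF f'(2)[OF inb[OF x]]]] fun_eq_iff)
  next
    fix v w
    have "continuous_on (ball 0 1) (\<lambda>x. f'' (r *\<^sub>R x) v w)"
      by (rule continuous_on_compose2[OF f'(3)]) (use inb in \<open>auto intro!: continuous_intros\<close>)
    then show "continuous_on (ball 0 1) (\<lambda>x. (r * r) *\<^sub>R f'' (r *\<^sub>R x) v w)"
      by (intro continuous_intros)
  qed
qed

lemma homogeneous_part_dilation:
  fixes f :: "'a::euclidean_space \<Rightarrow> complex"
  assumes f: "harmonic_on f (ball 0 1)" and r: "0 \<le> r" "r \<le> 1"
  shows "homogeneous_part (\<lambda>x. f (r *\<^sub>R x)) = (\<lambda>k x. homogeneous_part f k (r *\<^sub>R x))"
proof (rule homogeneous_part_eq)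
  show "expansion (\<lambda>k x. homogeneous_part f k (r *\<^sub>R x))"
    by (rule expansion_scale[OF harmonic_homogeneous_part(1)[OF f] r])
  fix x :: 'a assume "x \<in> ball 0 1"
  then have "norm (r *\<^sub>R x) < 1" using r mult_right_mono[of r 1 "norm x"] by simp
  then show "(\<lambda>k. homogeneous_part f k (r *\<^sub>R x)) sums f (r *\<^sub>R x)" by (rule harmonic_homogeneous_part(2)[OF f])
qed

lemma homogeneous_part_diff:
  fixes f g :: "'a::euclidean_space \<Rightarrow> complex"
  assumes f: "harmonic_on f (ball 0 1)" and g: "harmonic_on g (ball 0 1)"
  shows "homogeneous_part (\<lambda>x. f x - g x) = (\<lambda>k x. homogeneous_part f k x - homogeneous_part g k x)"
proof (rule homogeneous_part_eq)
  show "expansion (\<lambda>k x. homogeneous_part f k x - homogeneous_part g k x)"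
    by (intro expansion_diff harmonic_homogeneous_part f g)
  show "(\<lambda>k. homogeneous_part f k x - homogeneous_part g k x) sums (f x - g x)" if "x \<in> ball 0 1" for x
    using that by (intro sums_diff harmonic_homogeneous_part(2) f g) auto
qed

lemma D_op_diff:
  fixes f g :: "'a::euclidean_space \<Rightarrow> complex"
  assumes f: "harmonic_on f (ball 0 1)" and g: "harmonic_on g (ball 0 1)" and x: "norm x < 1"
  shows "D_op s t (\<lambda>x. f x - g x) x = D_op s t f x - D_op s t g x"
proof -
  have "D_parts s t (\<lambda>x. f x - g x) = (\<lambda>k x. D_parts s t f k x - D_parts s t g k x)"
    unfolding homogeneous_part_diff[OF f g] by (simp add: emul_def right_diff_distrib)
  then show ?thesis using x by (simp add: D_op_eq esum_diff expansion_D_parts f g)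
qed

lemma D_op_dilation:
  fixes f :: "'a::euclidean_space \<Rightarrow> complex"
  assumes f: "harmonic_on f (ball 0 1)" and r: "0 \<le> r" "r \<le> 1" and x: "norm x < 1"
  shows "D_op s t (\<lambda>x. f (r *\<^sub>R x)) x = esum (D_parts s t f) (r *\<^sub>R x)"
proof -
  have "D_parts s t (\<lambda>x. f (r *\<^sub>R x)) = (\<lambda>k x. D_parts s t f k (r *\<^sub>R x))"
    unfolding homogeneous_part_dilation[OF f r] by (simp add: emul_def)
  then show ?thesis using x by (simp add: D_op_eq esum_scale expansion_D_parts f r)
qed

text \<open>The radial operator commutes with dilation, so on the dilate it is bounded by its
  maximum over the closed ball of radius \<open>r\<close>. The choice t = |\<beta>| / p gives
  \<beta> + p t \<ge> 0, so the total weight is at most 1 for every real \<beta>.\<close>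

lemma dilation_in_besov:
  fixes f :: "'a::euclidean_space \<Rightarrow> complex"
  assumes f: "harmonic_on f (ball 0 1)" and r: "0 \<le> r" "r < 1" and p: "1 \<le> p"
  shows "(\<lambda>x. f (r *\<^sub>R x)) \<in> bergman_besov p \<beta>"
proof -
  define g where "g = (\<lambda>x. f (r *\<^sub>R x))"
  define t where "t = \<bar>\<beta>\<bar> / p"
  have t: "\<beta> + p * t \<ge> 0" using p by (simp add: t_def)
  have h: "harmonic_on g (ball 0 1)" unfolding g_def using harmonic_on_dilation[OF f] r by simp
  have eF: "expansion (D_parts 0 t f)" by (rule expansion_D_parts[OF f])
  have "compact (esum (D_parts 0 t f) ` cball 0 r)"
    using r by (intro compact_continuous_image continuous_on_subset[OF continuous_on_esum[OF eF]]) auto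
  then obtain M where M: "M > 0" "\<And>x. norm x \<le> r \<Longrightarrow> norm (esum (D_parts 0 t f) x) \<le> M"
    using compact_imp_bounded bounded_pos by (metis (no_types, lifting) image_eqI mem_cball_0)
  have DM: "norm (D_op 0 t g x) \<le> M" if x: "norm x < 1" for x
  proof -
    have "norm (r *\<^sub>R x) \<le> r" using r x by (simp add: mult_left_le)
    then show ?thesis unfolding g_def D_op_dilation[OF f r(1) less_imp_le[OF r(2)] x] by (rule M(2))
  qed
  define V where "V = weight_mass TYPE('a) \<beta>"
  have V: "V > 0" unfolding V_def by (rule weight_mass_pos)
  have Im[measurable]: "I_op 0 t g \<in> borel_measurable ball_measure"
    by (rule measurable_ball_measure_continuous[OF continuous_on_I_op[OF h]])
  have m: "(\<lambda>x. ennreal (norm (I_op 0 t g x) powr p)) \<in> borel_measurable ball_measure" by measurable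
  have "(\<integral>\<^sup>+x. ennreal (norm (I_op 0 t g x) powr p) \<partial>weighted_ball_measure \<beta>)
      = (\<integral>\<^sup>+x. ennreal (weight \<beta> x / V) * ennreal (norm (I_op 0 t g x) powr p) \<partial>ball_measure)"
    unfolding V_def by (rule nn_integral_weighted_ball_measure[OF m])
  also have "\<dots> \<le> (\<integral>\<^sup>+x. ennreal (M powr p / V) \<partial>(ball_measure :: 'a measure))"
  proof (rule nn_integral_mono)
    fix x :: 'a assume "x \<in> space ball_measure"
    then have x: "norm x < 1" by simp
    have "norm (I_op 0 t g x) powr p = weight (p * t) x * norm (D_op 0 t g x) powr p"
      by (simp add: I_op_def norm_mult weight_nonneg powr_mult weight_def powr_powr mult.commute)
    then have "weight \<beta> x / V * norm (I_op 0 t g x) powr p = weight (\<beta> + p * t) x * norm (D_op 0 t g x) powr p / V"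
      by (simp add: weight_add[symmetric])
    also have "\<dots> \<le> 1 * M powr p / V"
      using V M DM[OF x] p t x by (intro divide_right_mono mult_mono weight_le_1 powr_mono2) auto
    finally show "ennreal (weight \<beta> x / V) * ennreal (norm (I_op 0 t g x) powr p) \<le> ennreal (M powr p / V)"
      using V by (simp add: ennreal_mult[symmetric] weight_nonneg ennreal_leI)
  qed
  also have "\<dots> < \<infinity>" by (simp add: emeasure_ball_measure)
  finally have "I_op 0 t g \<in> weighted_Lp p \<beta>"
    unfolding weighted_Lp_def measurable_weighted_ball_measure using Im by simp
  then show ?thesis unfolding bergman_besov_def g_def[symmetric] using h t by force
qed

lemma Omega_set_eq:
  "Omega_set \<alpha> s t \<epsilon> f = {x \<in> ball 0 1. \<epsilon> \<le> weight (\<alpha> + t) x * norm (esum (D_parts s t f) x)}"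
  unfolding Omega_set_def weight_I_op by (auto simp: D_op_eq)

text \<open>The level set stays within a ball of radius R < 1, where the weight is bounded.\<close>

lemma vanishing_imp_Omega_finite:
  fixes f :: "'a::euclidean_space \<Rightarrow> complex"
  assumes t: "\<alpha> + t > 0" and van: "vanishing (\<alpha> + t) (D_parts s t f)" and e: "\<epsilon> > 0"
  shows "(\<integral>\<^sup>+x\<in>Omega_set \<alpha> s t \<epsilon> f. ennreal (weight (- real n) x) \<partial>ball_measure) < \<infinity>"
proof -
  obtain r where r: "r < 1" "\<And>x. r < norm x \<Longrightarrow> norm x < 1 \<Longrightarrow> weight (\<alpha> + t) x * norm (esum (D_parts s t f) x) < \<epsilon>"
    using van e unfolding vanishing_iff_weight[OF t] by blast
  define R where "R = max r 0"
  have R: "0 \<le> R" "R < 1" using r by (auto simp: R_def)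
  have sub: "norm x \<le> R" if "x \<in> Omega_set \<alpha> s t \<epsilon> f" for x
    using that r(2)[of x] unfolding Omega_set_eq R_def by (force simp: not_less[symmetric])
  have "(\<integral>\<^sup>+x\<in>Omega_set \<alpha> s t \<epsilon> f. ennreal (weight (- real n) x) \<partial>ball_measure)
      \<le> (\<integral>\<^sup>+x. ennreal ((1 - R\<^sup>2) powr (- real n)) \<partial>(ball_measure :: 'a measure))"
  proof (rule nn_integral_mono)
    fix x :: 'a
    show "ennreal (weight (- real n) x) * indicator (Omega_set \<alpha> s t \<epsilon> f) x \<le> ennreal ((1 - R\<^sup>2) powr (- real n))"
    proof (cases "x \<in> Omega_set \<alpha> s t \<epsilon> f")
      case True
      have "(norm x)\<^sup>2 \<le> R\<^sup>2" using sub[OF True] by (intro power_mono) auto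
      moreover have "R\<^sup>2 < 1" using R abs_square_less_1[of R] by simp
      ultimately have "weight (- real n) x \<le> (1 - R\<^sup>2) powr (- real n)"
        unfolding weight_def by (intro powr_mono2') auto
      then show ?thesis using True by (simp add: ennreal_leI)
    qed simp
  qed
  also have "\<dots> < \<infinity>" by (simp add: emeasure_ball_measure)
  finally show ?thesis .
qed

text \<open>Off the level set at height \<open>eta\<close> the weighted function is below
  \<open>eta\<close>; on it the Bloch bound \<open>K\<close> applies. The error is thus
  \<open>K\<close> times the indicator, integrable by hypothesis.\<close>

lemma Omega_finite_imp_vanishing:
  fixes f :: "'a::euclidean_space \<Rightarrow> complex"
  assumes f: "f \<in> bloch \<alpha>" and t: "\<alpha> + t > 0"
    and fin: "\<And>\<epsilon>. \<epsilon> > 0 \<Longrightarrow>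
      (\<integral>\<^sup>+x\<in>Omega_set \<alpha> s t \<epsilon> f. ennreal (weight (- real DIM('a)) x) \<partial>ball_measure) < \<infinity>"
  shows "vanishing (\<alpha> + t) (D_parts s t f)"
proof -
  define n where "n = DIM('a)"
  define F where "F = D_parts s t f"
  have F: "expansion F" unfolding F_def by (rule expansion_D_parts[OF bloch_harmonic[OF f]])
  note [measurable] = esum_measurable[OF F]
  obtain K where K: "K \<ge> 0" "growth (\<alpha> + t) K F" using bloch_growth[OF f t, of s] unfolding F_def by blast
  show ?thesis
    unfolding F_def[symmetric]
  proof (rule vanishing_if_integrable_error[OF F t])
    fix eta :: real assume eta: "eta > 0"
    define Om where "Om = Omega_set \<alpha> s t eta f"
    have Om_eq: "Om = ball 0 1 \<inter> {x. eta \<le> weight (\<alpha> + t) x * norm (esum F x)}"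
      unfolding Om_def Omega_set_eq F_def by blast
    have "{x. eta \<le> weight (\<alpha> + t) x * norm (esum F x)} \<in> sets borel" by measurable
    then have Om[measurable]: "Om \<in> sets borel" unfolding Om_eq by (intro sets.Int) auto
    define H where "H z = K * indicator Om z" for z :: 'a
    have 1: "norm (esum F z) * (1 - norm z) powr (\<alpha> + t) \<le> eta + H z" if z: "norm z < 1" for z
    proof (cases "z \<in> Om")
      case True
      have "norm (esum F z) * (1 - norm z) powr (\<alpha> + t)
          \<le> (K * (1 - norm z) powr (- (\<alpha> + t))) * (1 - norm z) powr (\<alpha> + t)"
        using K(2) z unfolding growth_def by (intro mult_right_mono) auto
      also have "\<dots> = K * ((1 - norm z) powr (- (\<alpha> + t)) * (1 - norm z) powr (\<alpha> + t))" by (rule mult.assoc)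
      also have "(1 - norm z) powr (- (\<alpha> + t)) * (1 - norm z) powr (\<alpha> + t) = 1"
        using z by (simp only: powr_add[symmetric]) simp
      finally show ?thesis using True eta by (simp add: H_def)
    next
      case False
      then have "weight (\<alpha> + t) z * norm (esum F z) < eta" using z by (auto simp: Om_eq)
      moreover have "(1 - norm z) powr (\<alpha> + t) * norm (esum F z) \<le> weight (\<alpha> + t) z * norm (esum F z)"
        using weight_bounds(1)[OF z] t by (intro mult_right_mono) auto
      ultimately show ?thesis using False by (simp add: H_def mult.commute)
    qed
    have m: "(\<lambda>x. ennreal (weight (- real n) x) * indicator Om x) \<in> borel_measurable borel" by measurable
    have finO: "(\<integral>\<^sup>+x. (ennreal (weight (- real n) x) * indicator Om x) * indicator (ball 0 1) x \<partial>lborel) < \<infinity>"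
      using fin[OF eta] unfolding n_def Om_def
      by (subst (asm) nn_integral_ball_measure_finite_iff)
        (use m in \<open>auto intro!: measurable_ball_measure_borel simp: n_def Om_def\<close>)
    have "(\<integral>\<^sup>+z. ennreal (H z * (1 - norm z) powr (- real n)) * indicator (ball 0 1) z \<partial>lborel)
        \<le> (\<integral>\<^sup>+z. ennreal (K * 2 ^ n) * ((ennreal (weight (- real n) z) * indicator Om z) * indicator (ball 0 1) z) \<partial>lborel)"
    proof (rule nn_integral_mono)
      fix z :: 'a
      show "ennreal (H z * (1 - norm z) powr (- real n)) * indicator (ball 0 1) z
        \<le> ennreal (K * 2 ^ n) * ((ennreal (weight (- real n) z) * indicator Om z) * indicator (ball 0 1) z)"
      proof (cases "norm z < 1 \<and> z \<in> Om")
        case True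
        have "K * (1 - norm z) powr (- real n) \<le> K * (2 ^ n * weight (- real n) z)"
          using True K(1) weight_inverse_power by (intro mult_left_mono) auto
        then have "ennreal (K * (1 - norm z) powr (- real n)) \<le> ennreal ((K * 2 ^ n) * weight (- real n) z)"
          by (intro ennreal_leI) (simp add: mult.assoc)
        then show ?thesis using True K(1) by (simp add: H_def ennreal_mult weight_nonneg)
      qed (auto simp: H_def)
    qed
    also have "\<dots> = ennreal (K * 2 ^ n) * (\<integral>\<^sup>+z. (ennreal (weight (- real n) z) * indicator Om z) * indicator (ball 0 1) z \<partial>lborel)"
      by (intro nn_integral_cmult borel_measurable_times_ennreal[OF _ borel_measurable_indicator]) (use m in auto)
    also have "\<dots> < \<infinity>" using finO by (simp add: ennreal_mult_less_top)
    finally have 2: "(\<integral>\<^sup>+z. ennreal (H z * (1 - norm z) powr (- real n)) * indicator (ball 0 1) z \<partial>lborel) < \<infinity>" .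
    have "H \<in> borel_measurable borel" unfolding H_def[abs_def] by measurable
    moreover have "\<forall>z. 0 \<le> H z" using K(1) by (simp add: H_def)
    ultimately show "\<exists>H. H \<in> borel_measurable borel \<and> (\<forall>z. 0 \<le> H z) \<and>
      (\<integral>\<^sup>+z. ennreal (H z * (1 - norm z) powr (- real DIM('a))) * indicator (ball 0 1) z \<partial>lborel) < \<infinity> \<and>
      (\<forall>z. norm z < 1 \<longrightarrow> norm (esum F z) * (1 - norm z) powr (\<alpha> + t) \<le> eta + H z)"
      using 1 2 unfolding n_def by blast
  qed
qed

lemma bloch_norm_le_iff:
  fixes f g :: "'a::euclidean_space \<Rightarrow> complex"
  assumes f: "harmonic_on f (ball 0 1)" and g: "harmonic_on g (ball 0 1)" and K: "K \<ge> 0"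
  shows "bloch_norm \<alpha> s t (\<lambda>x. f x - g x) \<le> ennreal K \<longleftrightarrow>
    (\<forall>x. norm x < 1 \<longrightarrow> weight (\<alpha> + t) x * norm (D_op s t f x - D_op s t g x) \<le> K)"
proof -
  have h: "harmonic_on (\<lambda>x. f x - g x) (ball 0 1)" using f g by (rule harmonic_on_diff)
  show ?thesis
    unfolding bloch_norm_def weighted_Linf_norm_le_iff[OF continuous_on_I_op[OF h] K] weight_I_op
    using D_op_diff[OF f g] by simp
qed

lemma vanishing_imp_closure:
  fixes f :: "'a::euclidean_space \<Rightarrow> complex"
  assumes f: "f \<in> bloch \<alpha>" and t: "\<alpha> + t > 0" and van: "vanishing (\<alpha> + t) (D_parts s t f)" and p: "1 \<le> p"
  shows "f \<in> bloch_closure \<alpha> s t (bergman_besov p \<beta>)"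
  unfolding bloch_closure_def
proof (intro CollectI conjI f allI impI)
  fix \<epsilon> :: real assume e: "\<epsilon> > 0"
  have h: "harmonic_on f (ball 0 1)" by (rule bloch_harmonic[OF f])
  define A where "A = \<alpha> + t"
  define F where "F = D_parts s t f"
  have F: "expansion F" unfolding F_def by (rule expansion_D_parts[OF h])
  \<comment> \<open>The factor 2^A is what \<open>weight A\<close> costs against (1 - |x|)^A; the
    remaining half makes the norm strictly less than \<epsilon>.\<close>
  have e': "\<epsilon> / 2 / 2 powr A > 0" using e by simp
  obtain r where r: "0 < r" "r < 1" "growth A (\<epsilon> / 2 / 2 powr A) (\<lambda>k x. F k x - F k (r *\<^sub>R x))"
    using vanishing_dilation[OF F t van[folded F_def] e'] unfolding A_def by blast
  define g where "g = (\<lambda>x. f (r *\<^sub>R x))"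
  have g: "g \<in> bergman_besov p \<beta>" unfolding g_def using dilation_in_besov[OF h _ r(2) p] r by simp
  then have hg: "harmonic_on g (ball 0 1)" unfolding bergman_besov_def by blast
  have "weight A x * norm (D_op s t f x - D_op s t g x) \<le> \<epsilon> / 2" if x: "norm x < 1" for x
  proof -
    have "D_op s t f x - D_op s t g x = esum F x - esum F (r *\<^sub>R x)"
      unfolding g_def using D_op_dilation[OF h _ _ x] r x by (simp add: D_op_eq F_def)
    also have "\<dots> = esum (\<lambda>k x. F k x - F k (r *\<^sub>R x)) x"
      using esum_diff[OF F expansion_scale[OF F, of r]] esum_scale[OF F, of r x] r x by simp
    finally have "norm (D_op s t f x - D_op s t g x) \<le> \<epsilon> / 2 / 2 powr A * (1 - norm x) powr (- A)"
      using r(3)[unfolded growth_def, rule_format, OF x] by simp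
    then have "weight A x * norm (D_op s t f x - D_op s t g x)
        \<le> (2 powr A * (1 - norm x) powr A) * (\<epsilon> / 2 / 2 powr A * (1 - norm x) powr (- A))"
      using weight_bounds(2)[OF x, of A] t unfolding A_def by (intro mult_mono) auto
    also have "\<dots> = \<epsilon> / 2 * ((1 - norm x) powr A * (1 - norm x) powr (- A))" by simp
    also have "(1 - norm x) powr A * (1 - norm x) powr (- A) = 1"
      using x by (simp only: powr_add[symmetric]) simp
    finally show ?thesis by simp
  qed
  then have "bloch_norm \<alpha> s t (\<lambda>x. f x - g x) \<le> ennreal (\<epsilon> / 2)"
    using bloch_norm_le_iff[OF h hg, of "\<epsilon> / 2" \<alpha> s t] e unfolding A_def by simp
  also have "\<dots> < ennreal \<epsilon>" using e by (intro ennreal_lessI) auto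
  finally show "\<exists>g\<in>bergman_besov p \<beta>. bloch_norm \<alpha> s t (\<lambda>x. f x - g x) < ennreal \<epsilon>" using g by blast
qed

text \<open>Boundary decay is closed under Bloch limits: half of \<open>e\<close> goes to the
  distance from an approximant, half to the decay of the approximant in the same parameters.\<close>

lemma closure_imp_vanishing:
  fixes f :: "'a::euclidean_space \<Rightarrow> complex"
  assumes f: "f \<in> bloch_closure \<alpha> s t (bergman_besov p \<beta>)" and t: "\<alpha> + t > 0"
    and p: "1 \<le> p" and \<beta>: "\<beta> \<le> p * \<alpha> - real DIM('a)"
  shows "vanishing (\<alpha> + t) (D_parts s t f)"
  unfolding vanishing_iff_weight[OF t]
proof (intro allI impI)
  fix e :: real assume e: "e > 0"
  then have "e / 2 > 0" by simp
  have fb: "f \<in> bloch \<alpha>" using f unfolding bloch_closure_def by blast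
  have h: "harmonic_on f (ball 0 1)" by (rule bloch_harmonic[OF fb])
  obtain g where g: "g \<in> bergman_besov p \<beta>" "bloch_norm \<alpha> s t (\<lambda>x. f x - g x) < ennreal (e / 2)"
    using f \<open>e / 2 > 0\<close> unfolding bloch_closure_def by blast
  have hg: "harmonic_on g (ball 0 1)" using g unfolding bergman_besov_def by blast
  obtain s0 t0 where "\<alpha> + t0 > 0" "vanishing (\<alpha> + t0) (D_parts s0 t0 g)"
    by (rule besov_vanishing[OF g(1) p \<beta>])
  then have "vanishing (\<alpha> + t) (D_parts s t g)" by (intro vanishing_change[OF hg _ t])
  then obtain r where r: "r < 1" "\<And>x. r < norm x \<Longrightarrow> norm x < 1 \<Longrightarrow> weight (\<alpha> + t) x * norm (esum (D_parts s t g) x) < e / 2"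
    using \<open>e / 2 > 0\<close> unfolding vanishing_iff_weight[OF t] by blast
  have fg: "weight (\<alpha> + t) x * norm (D_op s t f x - D_op s t g x) \<le> e / 2" if "norm x < 1" for x
    using bloch_norm_le_iff[OF h hg, of "e / 2" \<alpha> s t] less_imp_le[OF g(2)] e that by simp
  have "weight (\<alpha> + t) x * norm (esum (D_parts s t f) x) < e" if x: "r < norm x" "norm x < 1" for x
  proof -
    have "norm (D_op s t f x) \<le> norm (D_op s t f x - D_op s t g x) + norm (D_op s t g x)"
      by (rule norm_diff_triangle_le[of _ _ _ 0, simplified]) auto
    then have "weight (\<alpha> + t) x * norm (D_op s t f x)
        \<le> weight (\<alpha> + t) x * (norm (D_op s t f x - D_op s t g x) + norm (D_op s t g x))"
      by (intro mult_left_mono weight_nonneg)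
    then show ?thesis using fg[OF x(2)] r(2)[OF x] x(2) by (simp add: D_op_eq distrib_left)
  qed
  then show "\<exists>r<1. \<forall>x. r < norm x \<and> norm x < 1 \<longrightarrow> weight (\<alpha> + t) x * norm (esum (D_parts s t f) x) < e"
    using r(1) by blast
qed

theorem theorem1p2:
  fixes f :: "real ^ 'n \<Rightarrow> complex"
    and p \<alpha> \<beta> s t s' t' :: real
  assumes "CARD('n) \<ge> 2"
    and "1 \<le> p"
    and "\<beta> \<le> p * \<alpha> - real CARD('n)"
    and "\<alpha> + t > 0"
    and "\<alpha> + t' > 0"  \<comment> \<open>\<open>s'\<close>, \<open>t'\<close> fix an arbitrary one of the norms of \<open>bloch \<alpha>\<close>\<close>
    and "f \<in> bloch \<alpha>"
  shows "(f \<in> little_bloch \<alpha> \<longleftrightarrow> f \<in> bloch_closure \<alpha> s' t' (bergman_besov p \<beta>)) \<and>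
         (f \<in> bloch_closure \<alpha> s' t' (bergman_besov p \<beta>) \<longleftrightarrow>
           (\<forall>\<epsilon>>0. (\<integral>\<^sup>+x\<in>Omega_set \<alpha> s t \<epsilon> f. ennreal (weight (- real CARD('n)) x) \<partial>ball_measure) < \<infinity>))"
proof -
  have dim: "DIM(real ^ 'n) = CARD('n)" by simp
  have 1: "f \<in> little_bloch \<alpha> \<longleftrightarrow> vanishing (\<alpha> + t') (D_parts s' t' f)"
    by (rule little_bloch_iff[OF assms(6,5)])
  have 2: "f \<in> bloch_closure \<alpha> s' t' (bergman_besov p \<beta>) \<longleftrightarrow> vanishing (\<alpha> + t') (D_parts s' t' f)"
    using vanishing_imp_closure[OF assms(6,5) _ assms(2), of s' \<beta>]
      closure_imp_vanishing[OF _ assms(5,2) assms(3)[folded dim], of f s'] by blast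
  \<comment> \<open>\<open>little_bloch\<close> names no parameters, so it links the pair
    \<open>s'\<close>, \<open>t'\<close> of the norm with the pair \<open>s\<close>,
    \<open>t\<close> of the level sets.\<close>
  have 3: "f \<in> little_bloch \<alpha> \<longleftrightarrow> vanishing (\<alpha> + t) (D_parts s t f)"
    by (rule little_bloch_iff[OF assms(6,4)])
  have 4: "(\<forall>\<epsilon>>0. (\<integral>\<^sup>+x\<in>Omega_set \<alpha> s t \<epsilon> f. ennreal (weight (- real CARD('n)) x) \<partial>ball_measure) < \<infinity>)
      \<longleftrightarrow> vanishing (\<alpha> + t) (D_parts s t f)"
    using vanishing_imp_Omega_finite[OF assms(4), of s f _ "CARD('n)"]
      Omega_finite_imp_vanishing[OF assms(6,4), of s, unfolded dim] by blast
  show ?thesis using 1 2 3 4 by blast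
qed

end
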